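(* Let $\mathcal{G}$ be a connected groupoid with finite object set $\mathcal{G}_0$, let $x\in\mathcal{G}_0$, and let $\alpha=(A_g,\alpha_g)_{g\in\mathcal{G}}$ be a unital group-type partial action of $\mathcal{G}$ on a ring $A=\bigoplus_{y\in\mathcal{G}_0}A_y$. The partial skew groupoid ring $A\star_\alpha\mathcal{G}$ is artinian if and only if $A$ is artinian and $A_h=\{0\}$ for all but finitely many $h\in\mathcal{G}(x)$.
   Context: Rings are associative, not necessarily unital. Artinian means left and right artinian. A groupoid is a small category in which every morphism is invertible; for $g:x\to y$ write $s(g)=x$, $t(g)=y$; objects are identified with their identity morphisms; $gh$ is defined iff $s(g)=t(h)$. $\mathcal{G}(x)=\{g : s(g)=t(g)=x\}$ is the isotropy group (possibly infinite). $\mathcal{G}$ is connected if any two objects are joined by a morphism. A partial action of $\mathcal{G}$ on a ring $A$ is a family $\alpha=(A_g,\alpha_g)_{g\in\mathcal{G}}$ such that: (i) $A_g$ is an ideal of $A_{t(g)}$ and $A_{t(g)}$ is an ideal of $A$ for all $g$; (ii) $\alpha_g:A_{g^{-1}}\to A_g$ is a ring isomorphism; (iii) $\alpha_y=\mathrm{id}_{A_y}$ for each object $y$; (iv) $\alpha_{gh}$ extends $\alpha_g\alpha_h$ (defined on $\alpha_h^{-1}(A_{g^{-1}}\cap A_h)$) whenever $s(g)=t(h)$. It is unital if for each $g$ there is a central idempotent $1_g$ of $A$ with $A_g=A1_g$. A transversal for an object $x$ is a family $\{\tau_y\}_{y\in\mathcal{G}_0}$ of morphisms $\tau_y:x\to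 y$ with $\tau_x=x$. A partial action $\alpha$ of a connected groupoid is group-type if for some object $x$ there is a transversal $\{\tau_y\}$ for $x$ with $A_{\tau_y^{-1}}=A_x$ and $A_{\tau_y}=A_y$ for all $y\in\mathcal{G}_0$ (this does not depend on the choice of $x$). For a unital partial action, the partial skew groupoid ring $A\star_\alpha\mathcal{G}$ is the set of finite formal sums $\sum_g a_g\delta_g$, $a_g\in A_g$, with componentwise addition and $(a_g\delta_g)(a_h\delta_h)=a_g\alpha_g(a_h1_{g^{-1}})\delta_{gh}$ if $s(g)=t(h)$ and $0$ otherwise. When $\mathcal{G}_0$ is finite it is unital with identity $\sum_{y\in\mathcal{G}_0}1_y\delta_y$. *)

theory Defs
  imports "HOL-Algebra.Algebra"
begin

section \<open>Rings without unit\<close>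

text \<open>
  Associative rings that need not have an identity. The record type is the one of \<open>HOL-Algebra\<close>;
  the field for \<open>\<one>\<close> is left unconstrained and must be ignored.
\<close>

locale rng = abelian_group R for R (structure) +
  assumes m_closed: "\<lbrakk>a \<in> carrier R; b \<in> carrier R\<rbrakk> \<Longrightarrow> a \<otimes> b \<in> carrier R"
    and m_assoc: "\<lbrakk>a \<in> carrier R; b \<in> carrier R; c \<in> carrier R\<rbrakk>
      \<Longrightarrow> (a \<otimes> b) \<otimes> c = a \<otimes> (b \<otimes> c)"
    and l_distr: "\<lbrakk>a \<in> carrier R; b \<in> carrier R; c \<in> carrier R\<rbrakk>
      \<Longrightarrow> (a \<oplus> b) \<otimes> c = a \<otimes> c \<oplus> b \<otimes> c"
    and r_distr: "\<lbrakk>a \<in> carrier R; b \<in> carrier R; c \<in> carrier R\<rbrakk>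
      \<Longrightarrow> c \<otimes> (a \<oplus> b) = c \<otimes> a \<oplus> c \<otimes> b"

definition left_ideal :: "'a set \<Rightarrow> ('a, 'r) ring_scheme \<Rightarrow> bool" where
  "left_ideal I R \<longleftrightarrow> additive_subgroup I R \<and> (\<forall>a\<in>carrier R. \<forall>b\<in>I. a \<otimes>\<^bsub>R\<^esub> b \<in> I)"

definition right_ideal :: "'a set \<Rightarrow> ('a, 'r) ring_scheme \<Rightarrow> bool" where
  "right_ideal I R \<longleftrightarrow> additive_subgroup I R \<and> (\<forall>a\<in>carrier R. \<forall>b\<in>I. b \<otimes>\<^bsub>R\<^esub> a \<in> I)"

text \<open>Two-sided ideals; the locale \<open>ideal\<close> of the library is restricted to unital rings.\<close>

definition rng_ideal :: "'a set \<Rightarrow> ('a, 'r) ring_scheme \<Rightarrow> bool" where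
  "rng_ideal I R \<longleftrightarrow> left_ideal I R \<and> right_ideal I R"

definition left_artinian :: "('a, 'r) ring_scheme \<Rightarrow> bool" where
  "left_artinian R \<longleftrightarrow>
    (\<forall>I :: nat \<Rightarrow> 'a set. (\<forall>n. left_ideal (I n) R) \<and> (\<forall>n. I (Suc n) \<subseteq> I n)
      \<longrightarrow> (\<exists>N. \<forall>n\<ge>N. I n = I N))"

definition right_artinian :: "('a, 'r) ring_scheme \<Rightarrow> bool" where
  "right_artinian R \<longleftrightarrow>
    (\<forall>I :: nat \<Rightarrow> 'a set. (\<forall>n. right_ideal (I n) R) \<and> (\<forall>n. I (Suc n) \<subseteq> I n)
      \<longrightarrow> (\<exists>N. \<forall>n\<ge>N. I n = I N))"

definition artinian :: "('a, 'r) ring_scheme \<Rightarrow> bool" where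
  "artinian R \<longleftrightarrow> left_artinian R \<and> right_artinian R"

text \<open>Ring isomorphisms, with no condition on \<open>\<one>\<close> (unlike \<open>ring_iso\<close> of the library).\<close>

definition rng_iso :: "('a, 'r) ring_scheme \<Rightarrow> ('b, 's) ring_scheme \<Rightarrow> ('a \<Rightarrow> 'b) set" where
  "rng_iso R S = {\<phi>. bij_betw \<phi> (carrier R) (carrier S) \<and>
    (\<forall>a\<in>carrier R. \<forall>b\<in>carrier R.
      \<phi> (a \<oplus>\<^bsub>R\<^esub> b) = \<phi> a \<oplus>\<^bsub>S\<^esub> \<phi> b \<and> \<phi> (a \<otimes>\<^bsub>R\<^esub> b) = \<phi> a \<otimes>\<^bsub>S\<^esub> \<phi> b)}"

definition central_idempotent :: "('a, 'r) ring_scheme \<Rightarrow> 'a \<Rightarrow> bool" where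
  "central_idempotent R e \<longleftrightarrow> e \<in> carrier R \<and> e \<otimes>\<^bsub>R\<^esub> e = e \<and>
    (\<forall>a\<in>carrier R. e \<otimes>\<^bsub>R\<^esub> a = a \<otimes>\<^bsub>R\<^esub> e)"

definition generates_unital :: "('a, 'r) ring_scheme \<Rightarrow> 'a set \<Rightarrow> 'a \<Rightarrow> bool" where
  "generates_unital R I e \<longleftrightarrow> central_idempotent R e \<and> I = (\<lambda>a. a \<otimes>\<^bsub>R\<^esub> e) ` carrier R"

text \<open>A central idempotent \<open>e\<close> with \<open>I = Re\<close> is an identity of \<open>I\<close>, hence unique.\<close>

lemma (in rng) generates_unital_unique:
  assumes "generates_unital R I e" "generates_unital R I e'"
  shows "e = e'"
proof -
  have *: "f \<otimes> f' = f" if g: "generates_unital R I f" "generates_unital R I f'" for f f'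
  proof -
    have f: "f \<in> carrier R" "f \<otimes> f = f" and f': "f' \<in> carrier R" "f' \<otimes> f' = f'"
      using g unfolding generates_unital_def central_idempotent_def by blast+
    have "f \<in> I"
      using g(1) f unfolding generates_unital_def by (metis imageI)
    then obtain a where "a \<in> carrier R" "f = a \<otimes> f'"
      using g(2) unfolding generates_unital_def by blast
    then show ?thesis
      using f' by (metis m_assoc)
  qed
  have "e \<otimes> e' = e' \<otimes> e"
    using assms unfolding generates_unital_def central_idempotent_def by blast
  then show ?thesis
    using *[OF assms] *[OF assms(2) assms(1)] by metis
qed

definition ideal_unit :: "('a, 'r) ring_scheme \<Rightarrow> 'a set \<Rightarrow> 'a" where
  "ideal_unit R I = (THE e. generates_unital R I e)"

text \<open>Internal direct sum decomposition over a finite index set.\<close>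

definition is_direct_sum :: "('a, 'r) ring_scheme \<Rightarrow> ('i \<Rightarrow> 'a set) \<Rightarrow> 'i set \<Rightarrow> bool" where
  "is_direct_sum R B Y \<longleftrightarrow> (\<forall>y\<in>Y. B y \<subseteq> carrier R) \<and>
    (\<forall>a\<in>carrier R. \<exists>!b. b \<in> (\<Pi>\<^sub>E y\<in>Y. B y) \<and> a = (\<Oplus>\<^bsub>R\<^esub>y\<in>Y. b y))"


section \<open>Groupoids\<close>

text \<open>
  Groupoids are given by their morphisms alone: objects are identified with identity morphisms, so
  source and target take values in the morphisms. The product \<open>Comp G g h\<close> stands for \<open>gh\<close> and is
  meaningful only if \<open>Src G g = Tgt G h\<close>.
\<close>

record 'g groupoid_data =
  Mor :: "'g set"
  Src :: "'g \<Rightarrow> 'g"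
  Tgt :: "'g \<Rightarrow> 'g"
  Comp :: "'g \<Rightarrow> 'g \<Rightarrow> 'g"

locale groupoid =
  fixes G :: "('g, 'm) groupoid_data_scheme"
  assumes Src_Mor: "g \<in> Mor G \<Longrightarrow> Src G g \<in> Mor G"
    and Tgt_Mor: "g \<in> Mor G \<Longrightarrow> Tgt G g \<in> Mor G"
    and Src_Src: "g \<in> Mor G \<Longrightarrow> Src G (Src G g) = Src G g"
    and Tgt_Src: "g \<in> Mor G \<Longrightarrow> Tgt G (Src G g) = Src G g"
    and Src_Tgt: "g \<in> Mor G \<Longrightarrow> Src G (Tgt G g) = Tgt G g"
    and Tgt_Tgt: "g \<in> Mor G \<Longrightarrow> Tgt G (Tgt G g) = Tgt G g"
    and Comp_Mor: "\<lbrakk>g \<in> Mor G; h \<in> Mor G; Src G g = Tgt G h\<rbrakk> \<Longrightarrow> Comp G g h \<in> Mor G"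
    and Src_Comp: "\<lbrakk>g \<in> Mor G; h \<in> Mor G; Src G g = Tgt G h\<rbrakk> \<Longrightarrow> Src G (Comp G g h) = Src G h"
    and Tgt_Comp: "\<lbrakk>g \<in> Mor G; h \<in> Mor G; Src G g = Tgt G h\<rbrakk> \<Longrightarrow> Tgt G (Comp G g h) = Tgt G g"
    and Comp_assoc: "\<lbrakk>g \<in> Mor G; h \<in> Mor G; k \<in> Mor G; Src G g = Tgt G h; Src G h = Tgt G k\<rbrakk>
      \<Longrightarrow> Comp G (Comp G g h) k = Comp G g (Comp G h k)"
    and Comp_Src: "g \<in> Mor G \<Longrightarrow> Comp G g (Src G g) = g"
    and Comp_Tgt: "g \<in> Mor G \<Longrightarrow> Comp G (Tgt G g) g = g"
    and invertible: "g \<in> Mor G \<Longrightarrow> \<exists>h\<in>Mor G. Src G h = Tgt G g \<and> Tgt G h = Src G g \<and>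
      Comp G h g = Src G g \<and> Comp G g h = Tgt G g"

definition Obj :: "('g, 'm) groupoid_data_scheme \<Rightarrow> 'g set" where
  "Obj G = {x \<in> Mor G. Src G x = x \<and> Tgt G x = x}"

definition ginv :: "('g, 'm) groupoid_data_scheme \<Rightarrow> 'g \<Rightarrow> 'g" where
  "ginv G g = (THE h. h \<in> Mor G \<and> Src G h = Tgt G g \<and> Tgt G h = Src G g \<and>
     Comp G h g = Src G g \<and> Comp G g h = Tgt G g)"

definition isotropy :: "('g, 'm) groupoid_data_scheme \<Rightarrow> 'g \<Rightarrow> 'g set" where
  "isotropy G x = {g \<in> Mor G. Src G g = x \<and> Tgt G g = x}"

definition connected_groupoid :: "('g, 'm) groupoid_data_scheme \<Rightarrow> bool" where
  "connected_groupoid G \<longleftrightarrow> groupoid G \<and>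
    (\<forall>x\<in>Obj G. \<forall>y\<in>Obj G. \<exists>g\<in>Mor G. Src G g = x \<and> Tgt G g = y)"

definition transversal :: "('g, 'm) groupoid_data_scheme \<Rightarrow> 'g \<Rightarrow> ('g \<Rightarrow> 'g) \<Rightarrow> bool" where
  "transversal G x \<tau> \<longleftrightarrow> x \<in> Obj G \<and> \<tau> x = x \<and>
    (\<forall>y\<in>Obj G. \<tau> y \<in> Mor G \<and> Src G (\<tau> y) = x \<and> Tgt G (\<tau> y) = y)"


section \<open>Partial actions of groupoids on rings\<close>

text \<open>
  \<open>D g\<close> is the ideal \<open>A\<^sub>g\<close> and \<open>\<alpha> g\<close> the isomorphism from \<open>D (ginv G g)\<close> to \<open>D g\<close>; the values of \<open>D\<close>
  outside \<open>Mor G\<close> and of \<open>\<alpha> g\<close> outside \<open>D (ginv G g)\<close> are irrelevant.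
\<close>

locale partial_action = groupoid G + rng A
  for G :: "('g, 'm) groupoid_data_scheme" and A :: "('a, 'r) ring_scheme" +
  fixes D :: "'g \<Rightarrow> 'a set" and \<alpha> :: "'g \<Rightarrow> 'a \<Rightarrow> 'a"
  assumes ideal_in_Tgt: "g \<in> Mor G \<Longrightarrow> rng_ideal (D g) (A\<lparr>carrier := D (Tgt G g)\<rparr>)"
    and ideal_Tgt: "g \<in> Mor G \<Longrightarrow> rng_ideal (D (Tgt G g)) A"
    and iso: "g \<in> Mor G \<Longrightarrow>
      \<alpha> g \<in> rng_iso (A\<lparr>carrier := D (ginv G g)\<rparr>) (A\<lparr>carrier := D g\<rparr>)"
    and act_Obj: "\<lbrakk>y \<in> Obj G; a \<in> D y\<rbrakk> \<Longrightarrow> \<alpha> y a = a"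
    and act_Comp: "\<lbrakk>g \<in> Mor G; h \<in> Mor G; Src G g = Tgt G h;
        a \<in> D (ginv G h); \<alpha> h a \<in> D (ginv G g)\<rbrakk>
      \<Longrightarrow> a \<in> D (ginv G (Comp G g h)) \<and> \<alpha> (Comp G g h) a = \<alpha> g (\<alpha> h a)"

locale unital_partial_action = partial_action +
  assumes unital: "g \<in> Mor G \<Longrightarrow> \<exists>e. generates_unital A (D g) e"

definition group_type :: "('g, 'm) groupoid_data_scheme \<Rightarrow> ('g \<Rightarrow> 'a set) \<Rightarrow> bool" where
  "group_type G D \<longleftrightarrow> (\<exists>x\<in>Obj G. \<exists>\<tau>. transversal G x \<tau> \<and>
    (\<forall>y\<in>Obj G. D (ginv G (\<tau> y)) = D x \<and> D (\<tau> y) = D y))"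


section \<open>The partial skew groupoid ring\<close>

text \<open>
  The formal sum \<open>\<Sum>\<^sub>g a\<^sub>g\<delta>\<^sub>g\<close> is the finitely supported function \<open>g \<mapsto> a\<^sub>g\<close>, extended by \<open>\<zero>\<close> outside
  \<open>Mor G\<close>. The product is the biadditive extension of the rule for \<open>(a\<^sub>g\<delta>\<^sub>g)(a\<^sub>h\<delta>\<^sub>h)\<close>: its coefficient
  at \<open>k\<close> collects the pairs \<open>(g, h)\<close> of the supports with \<open>gh = k\<close>. The field \<open>one\<close> is an identity
  only when \<open>Obj G\<close> is finite.
\<close>

definition skew_ring :: "('g, 'm) groupoid_data_scheme \<Rightarrow> ('a, 'r) ring_scheme \<Rightarrow>
    ('g \<Rightarrow> 'a set) \<Rightarrow> ('g \<Rightarrow> 'a \<Rightarrow> 'a) \<Rightarrow> ('g \<Rightarrow> 'a) ring" where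
  "skew_ring G A D \<alpha> =
    \<lparr>carrier = {u. (\<forall>g\<in>Mor G. u g \<in> D g) \<and> (\<forall>g. g \<notin> Mor G \<longrightarrow> u g = \<zero>\<^bsub>A\<^esub>) \<and>
        finite {g. u g \<noteq> \<zero>\<^bsub>A\<^esub>}},
     monoid.mult = (\<lambda>u v k. finsum A
        (\<lambda>(g, h). u g \<otimes>\<^bsub>A\<^esub> \<alpha> g (v h \<otimes>\<^bsub>A\<^esub> ideal_unit A (D (ginv G g))))
        {(g, h). g \<in> Mor G \<and> h \<in> Mor G \<and> u g \<noteq> \<zero>\<^bsub>A\<^esub> \<and> v h \<noteq> \<zero>\<^bsub>A\<^esub> \<and>
          Src G g = Tgt G h \<and> Comp G g h = k}),
     monoid.one = (\<lambda>g. if g \<in> Obj G then ideal_unit A (D g) else \<zero>\<^bsub>A\<^esub>),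
     ring.zero = (\<lambda>g. \<zero>\<^bsub>A\<^esub>),
     ring.add = (\<lambda>u v g. u g \<oplus>\<^bsub>A\<^esub> v g)\<rparr>"

end

theory Submission
  imports Defs
begin

text \<open>
  Right-to-left, the ring is a finite direct sum of components \<open>A\<^sub>g\<delta>\<^sub>g\<close>, each of which is, up to the
  isomorphism \<open>\<alpha>\<^sub>g\<close> on the right-hand side, a one-sided ideal of \<open>A\<close>.

  Left-to-right, the point is the finiteness of the support. If it is infinite, then, because \<open>A\<close> has
  only finitely many primitive central idempotents, one of them is fixed by an infinite subgroup \<open>H\<close> of
  the isotropy group. A \<open>\<int>\<close>-linear functional on \<open>A\<close> with values in the prime field \<open>F\<close> and nonzero at
  that idempotent pulls left ideals of \<open>F[H]\<close> back to left ideals of the skew groupoid ring,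
  injectively, so \<open>F[H]\<close> is artinian.

  An artinian group ring \<open>F[G]\<close> has finite \<open>G\<close>: its chain conditions pass to subgroups and quotients
  and bound chains of subgroups, so an infinite \<open>G\<close> would contain an infinite subgroup all of whose
  proper subgroups are finite. It is not abelian, so its center is finite, and modulo the center all
  centralizers of nontrivial elements are finite. Then a suitable translate of one factor makes a
  product of two nonzero elements nonzero, and an argument with a minimal left ideal produces a nonzero
  element invariant under left translation, which infinite groups do not admit.
\<close>

section \<open>The descending chain condition\<close>

text \<open>The prime field is never built. Its characteristic is an integer \<open>p\<close> with
  \<open>p = 0\<close> allowed, and \<open>p dvd n\<close> then reads \<open>n = 0\<close>. Vectors
  are integer-valued functions taken modulo \<open>p\<close>, and division is replaced by closure
  under cancelling multipliers not divisible by \<open>p\<close>. One argument thus covers the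
  rationals and all finite prime fields.

  The obstacle in passing from the skew ring to F[H] is that, for the idempotent \<open>e\<close>
  fixed by H, the ring \<open>e A\<close> may be noncommutative and H may act on it nontrivially.
  There need not be a ring homomorphism from \<open>e A\<close> to F, only additive functionals.
  These are enough for the following reason: for any additive subgroup \<open>Y\<close> of a ring S,
  the elements s with all products r s in \<open>Y\<close> form a left ideal. Hence an additive
  condition on coefficients already yields a left ideal of S, and what remains is to recover the
  original ideal from it. The same device, with the coefficients at the objects in place of the
  functional, carries the chain conditions from the skew ring down to A.\<close>

definition dcc :: "'a set set \<Rightarrow> bool" where
  "dcc \<F> \<longleftrightarrow> (\<forall>I :: nat \<Rightarrow> 'a set. (\<forall>n. I n \<in> \<F>) \<and> (\<forall>n. I (Suc n) \<subseteq> I n)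
    \<longrightarrow> (\<exists>N. \<forall>n\<ge>N. I n = I N))"

lemma dcc_minimal:
  assumes "dcc \<F>" "\<And>J. P J \<Longrightarrow> J \<in> \<F>" "P I"
  obtains J where "P J" "J \<subseteq> I" "\<And>K. \<lbrakk>P K; K \<subseteq> J\<rbrakk> \<Longrightarrow> K = J"
proof -
  have "\<exists>J. P J \<and> J \<subseteq> I \<and> (\<forall>K. P K \<longrightarrow> K \<subseteq> J \<longrightarrow> K = J)"
  proof (rule ccontr)
    assume "\<not> ?thesis"
    then have step: "\<exists>K. P K \<and> K \<subset> J" if "P J \<and> J \<subseteq> I" for J
      using that by blast
    define f where "f J = (SOME K. P K \<and> K \<subset> J)" for J
    have f: "P (f J) \<and> f J \<subset> J" if "P J \<and> J \<subseteq> I" for J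
      unfolding f_def by (rule someI_ex) (rule step[OF that])
    define s where "s n = (f ^^ n) I" for n
    have s: "P (s n) \<and> s n \<subseteq> I" for n
    proof (induction n)
      case 0 then show ?case using assms(3) by (simp add: s_def)
    next
      case (Suc n) then show ?case using f[of "s n"] by (auto simp: s_def)
    qed
    have lt: "s (Suc n) \<subset> s n" for n
      using f[OF s[of n]] by (simp add: s_def)
    have "\<exists>N. \<forall>n\<ge>N. s n = s N"
      using assms(1)[unfolded dcc_def, rule_format, of s] assms(2) s lt by blast
    then show False
      using lt by (metis le_SucI order_refl psubset_eq)
  qed
  then show ?thesis using that by blast
qed

text \<open>Injectivity and monotonicity preserve strict inclusions, so a strictly descending
  sequence in \<open>\<G>\<close> would give one in \<open>\<F>\<close>. A transfer of the chain
  condition then amounts to a monotone construction \<open>\<Phi>\<close> and a way to read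
  \<open>I\<close> off from \<open>\<Phi> I\<close>.\<close>

lemma dcc_embed:
  assumes "dcc \<F>" "\<And>I. I \<in> \<G> \<Longrightarrow> \<Phi> I \<in> \<F>"
    and "\<And>I J. \<lbrakk>I \<in> \<G>; J \<in> \<G>; I \<subseteq> J\<rbrakk> \<Longrightarrow> \<Phi> I \<subseteq> \<Phi> J" "inj_on \<Phi> \<G>"
  shows "dcc \<G>"
  unfolding dcc_def
proof (intro allI impI)
  fix I :: "nat \<Rightarrow> _" assume I: "(\<forall>n. I n \<in> \<G>) \<and> (\<forall>n. I (Suc n) \<subseteq> I n)"
  then have "(\<forall>n. \<Phi> (I n) \<in> \<F>) \<and> (\<forall>n. \<Phi> (I (Suc n)) \<subseteq> \<Phi> (I n))"
    using assms(2,3) by blast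
  then obtain N where "\<forall>n\<ge>N. \<Phi> (I n) = \<Phi> (I N)"
    using assms(1)[unfolded dcc_def, rule_format, of "\<lambda>n. \<Phi> (I n)"] by blast
  then show "\<exists>N. \<forall>n\<ge>N. I n = I N"
    using I assms(4) by (metis inj_onD)
qed

section \<open>Integral group rings modulo a prime\<close>

definition group_ring :: "('g, 'm) monoid_scheme \<Rightarrow> ('g \<Rightarrow> int) set" where
  "group_ring G = {v. finite {g. v g \<noteq> 0} \<and> {g. v g \<noteq> 0} \<subseteq> carrier G}"

text \<open>Left multiplication by the basis element \<open>g\<close>. The case distinction keeps
  the support inside the carrier.\<close>

definition translate :: "('g, 'm) monoid_scheme \<Rightarrow> 'g \<Rightarrow> ('g \<Rightarrow> int) \<Rightarrow> 'g \<Rightarrow> int" where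
  "translate G g v = (\<lambda>h. if h \<in> carrier G then v (inv\<^bsub>G\<^esub> g \<otimes>\<^bsub>G\<^esub> h) else 0)"

text \<open>
  These sets stand for the left ideals of the group ring over the prime field of characteristic \<open>p\<close>:
  they are the inverse images in the integral group ring if \<open>p\<close> is prime, and the intersections
  with the integral group ring if \<open>p = 0\<close>.
\<close>

definition saturated_ideal :: "int \<Rightarrow> ('g, 'm) monoid_scheme \<Rightarrow> ('g \<Rightarrow> int) set \<Rightarrow> bool" where
  "saturated_ideal p G L \<longleftrightarrow> L \<subseteq> group_ring G \<and>
    (\<forall>u\<in>L. \<forall>v\<in>L. (\<lambda>g. u g - v g) \<in> L) \<and>
    (\<forall>v\<in>group_ring G. (\<forall>g. p dvd v g) \<longrightarrow> v \<in> L) \<and>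
    (\<forall>n. \<forall>v\<in>group_ring G. \<not> p dvd n \<and> (\<lambda>g. n * v g) \<in> L \<longrightarrow> v \<in> L) \<and>
    (\<forall>g\<in>carrier G. \<forall>v\<in>L. translate G g v \<in> L)"

definition group_ring_dcc :: "int \<Rightarrow> ('g, 'm) monoid_scheme \<Rightarrow> bool" where
  "group_ring_dcc p G \<longleftrightarrow> dcc {L. saturated_ideal p G L}"

text \<open>The product of the group ring, written as a combination of left translates of the second
  factor, so that a left ideal containing \<open>v\<close> contains it term by term.\<close>

definition conv :: "('g, 'm) monoid_scheme \<Rightarrow> ('g \<Rightarrow> int) \<Rightarrow> ('g \<Rightarrow> int) \<Rightarrow> 'g \<Rightarrow> int" where
  "conv G u v = (\<lambda>k. \<Sum>g | u g \<noteq> 0. u g * translate G g v k)"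

lemma group_ringI: "\<lbrakk>finite S; S \<subseteq> carrier G; \<And>g. v g \<noteq> 0 \<Longrightarrow> g \<in> S\<rbrakk> \<Longrightarrow> v \<in> group_ring G"
  unfolding group_ring_def by (auto intro: finite_subset)

lemma group_ring_finite: "v \<in> group_ring G \<Longrightarrow> finite {g. v g \<noteq> 0}"
  and group_ring_carrier: "\<lbrakk>v \<in> group_ring G; v g \<noteq> 0\<rbrakk> \<Longrightarrow> g \<in> carrier G"
  and group_ring_outside: "\<lbrakk>v \<in> group_ring G; g \<notin> carrier G\<rbrakk> \<Longrightarrow> v g = 0"
  unfolding group_ring_def by auto

lemma group_ring_diff:
  "\<lbrakk>u \<in> group_ring G; v \<in> group_ring G\<rbrakk> \<Longrightarrow> (\<lambda>g. u g - v g) \<in> group_ring G"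
  by (rule group_ringI[of "{g. u g \<noteq> 0} \<union> {g. v g \<noteq> 0}"]) (auto simp: group_ring_def)

lemma group_ring_scale: "v \<in> group_ring G \<Longrightarrow> (\<lambda>g. n * v g) \<in> group_ring G"
  by (rule group_ringI[of "{g. v g \<noteq> 0}"]) (auto simp: group_ring_def)

lemma group_ring_sum:
  assumes "finite S" "\<And>i. i \<in> S \<Longrightarrow> f i \<in> group_ring G"
  shows "(\<lambda>g. \<Sum>i\<in>S. f i g) \<in> group_ring G"
proof (rule group_ringI[of "\<Union>i\<in>S. {g. f i g \<noteq> 0}"])
  fix g assume "(\<Sum>i\<in>S. f i g) \<noteq> 0"
  then show "g \<in> (\<Union>i\<in>S. {g. f i g \<noteq> 0})" by (auto dest: sum.not_neutral_contains_not_neutral)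
qed (use assms in \<open>auto simp: group_ring_def\<close>)

context group
begin

lemma translate_group_ring:
  assumes "g \<in> carrier G" "v \<in> group_ring G"
  shows "translate G g v \<in> group_ring G"
proof (rule group_ringI[of "(\<lambda>h. g \<otimes> h) ` {h. v h \<noteq> 0}"])
  fix h assume "translate G g v h \<noteq> 0"
  then have "h \<in> carrier G" "v (inv g \<otimes> h) \<noteq> 0"
    by (auto simp: translate_def split: if_splits)
  moreover have "h = g \<otimes> (inv g \<otimes> h)"
    using \<open>h \<in> carrier G\<close> assms(1) by (simp add: m_assoc[symmetric])
  ultimately show "h \<in> (\<lambda>h. g \<otimes> h) ` {h. v h \<noteq> 0}" by blast
qed (use assms in \<open>auto simp: group_ring_def\<close>)

lemma translate_mult:
  assumes "g \<in> carrier G" "h \<in> carrier G"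
  shows "translate G g (translate G h v) = translate G (g \<otimes> h) v"
  using assms by (auto simp: translate_def inv_mult_group m_assoc)

lemma conv_superset:
  assumes "finite S" "{g. u g \<noteq> 0} \<subseteq> S"
  shows "conv G u v k = (\<Sum>g\<in>S. u g * translate G g v k)"
  unfolding conv_def using assms by (intro sum.mono_neutral_left) auto

lemma conv_group_ring:
  assumes "u \<in> group_ring G" "v \<in> group_ring G"
  shows "conv G u v \<in> group_ring G"
  unfolding conv_def using assms
  by (intro group_ring_sum group_ring_scale translate_group_ring) (auto simp: group_ring_def)

lemma conv_diff:
  assumes "u \<in> group_ring G" "u' \<in> group_ring G"
  shows "conv G (\<lambda>g. u g - u' g) v k = conv G u v k - conv G u' v k"
proof -
  let ?S = "{g. u g \<noteq> 0} \<union> {g. u' g \<noteq> 0}"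
  have S: "finite ?S" using assms by (simp add: group_ring_def)
  show ?thesis
    by (subst (1 2 3) conv_superset[OF S]) (auto simp: sum_subtractf left_diff_distrib)
qed

lemma conv_scale:
  assumes "u \<in> group_ring G"
  shows "conv G (\<lambda>g. n * u g) v k = n * conv G u v k"
proof -
  have S: "finite {g. u g \<noteq> 0}" using assms by (simp add: group_ring_def)
  show ?thesis
    by (subst (1 2) conv_superset[OF S]) (auto simp: sum_distrib_left mult.assoc)
qed

text \<open>Reindexing the sum by \<open>g \<mapsto> h \<otimes> g\<close> moves the translation
  outside. Right multiplication by \<open>v\<close> is therefore a map of left modules, which makes
  annihilators and images of left ideals into left ideals.\<close>

lemma conv_translate:
  assumes "h \<in> carrier G" "u \<in> group_ring G"
  shows "conv G (translate G h u) v = translate G h (conv G u v)"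
proof
  fix k
  have fin: "finite {g. u g \<noteq> 0}" and c: "{g. u g \<noteq> 0} \<subseteq> carrier G"
    using assms by (auto simp: group_ring_def)
  have sub: "{g. translate G h u g \<noteq> 0} \<subseteq> (\<lambda>g. h \<otimes> g) ` {g. u g \<noteq> 0}"
  proof
    fix g assume "g \<in> {g. translate G h u g \<noteq> 0}"
    then have "g \<in> carrier G" "u (inv h \<otimes> g) \<noteq> 0" by (auto simp: translate_def split: if_splits)
    moreover have "g = h \<otimes> (inv h \<otimes> g)"
      using \<open>g \<in> carrier G\<close> assms(1) by (simp add: m_assoc[symmetric])
    ultimately show "g \<in> (\<lambda>g. h \<otimes> g) ` {g. u g \<noteq> 0}" by blast
  qed
  have inj: "inj_on (\<lambda>g. h \<otimes> g) {g. u g \<noteq> 0}"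
    using assms(1) c by (auto simp: inj_on_def subset_iff)
  have "conv G (translate G h u) v k
      = (\<Sum>g | u g \<noteq> 0. translate G h u (h \<otimes> g) * translate G (h \<otimes> g) v k)"
    by (subst conv_superset[OF finite_imageI[OF fin] sub], subst sum.reindex[OF inj]) simp
  also have "\<dots> = (\<Sum>g | u g \<noteq> 0. u g * translate G h (translate G g v) k)"
  proof (rule sum.cong)
    fix g assume "g \<in> {g. u g \<noteq> 0}"
    then have g: "g \<in> carrier G" using c by auto
    then have "translate G h u (h \<otimes> g) = u g"
      using assms(1) by (simp add: translate_def m_assoc[symmetric])
    then show "translate G h u (h \<otimes> g) * translate G (h \<otimes> g) v k
        = u g * translate G h (translate G g v) k"
      by (simp add: translate_mult[OF assms(1) g])
  qed simp
  also have "\<dots> = translate G h (conv G u v) k"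
    by (simp add: translate_def conv_def)
  finally show "conv G (translate G h u) v k = translate G h (conv G u v) k" .
qed

end

context
  fixes p :: int and G :: "('g, 'm) monoid_scheme" and L
  assumes L: "saturated_ideal p G L"
begin

lemma sat_sub: "v \<in> L \<Longrightarrow> v \<in> group_ring G"
  and sat_diff: "\<lbrakk>u \<in> L; v \<in> L\<rbrakk> \<Longrightarrow> (\<lambda>g. u g - v g) \<in> L"
  and sat_dvd: "\<lbrakk>v \<in> group_ring G; \<And>g. p dvd v g\<rbrakk> \<Longrightarrow> v \<in> L"
  and sat_cancel: "\<lbrakk>v \<in> group_ring G; \<not> p dvd n; (\<lambda>g. n * v g) \<in> L\<rbrakk> \<Longrightarrow> v \<in> L"
  and sat_translate: "\<lbrakk>g \<in> carrier G; v \<in> L\<rbrakk> \<Longrightarrow> translate G g v \<in> L"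
  using L unfolding saturated_ideal_def by blast+

lemma sat_zero: "(\<lambda>g. 0) \<in> L"
  by (rule sat_dvd) (auto simp: group_ring_def)

lemma sat_add:
  assumes "u \<in> L" "v \<in> L"
  shows "(\<lambda>g. u g + v g) \<in> L"
proof -
  have "(\<lambda>g. 0 - v g) \<in> L" using sat_diff[OF sat_zero assms(2)] .
  from sat_diff[OF assms(1) this] show ?thesis by simp
qed

lemma sat_scale:
  assumes "v \<in> L"
  shows "(\<lambda>g. n * v g) \<in> L"
proof (induction n rule: int_induct[where k = 0])
  case base then show ?case using sat_zero by simp
next
  case (step1 i) then show ?case using sat_add[OF step1(2) assms] by (simp add: algebra_simps)
next
  case (step2 i) then show ?case using sat_diff[OF step2(2) assms] by (simp add: algebra_simps)
qed

lemma sat_sum: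
  assumes "finite S" "\<And>i. i \<in> S \<Longrightarrow> f i \<in> L"
  shows "(\<lambda>g. \<Sum>i\<in>S. f i g) \<in> L"
  using assms
proof (induction S rule: finite_induct)
  case empty then show ?case using sat_zero by simp
next
  case (insert i S)
  then have "(\<lambda>g. f i g + (\<Sum>i\<in>S. f i g)) \<in> L" by (intro sat_add) auto
  then show ?case using insert by simp
qed

lemma sat_conv:
  assumes "u \<in> group_ring G" "v \<in> L"
  shows "conv G u v \<in> L"
  unfolding conv_def using assms
  by (intro sat_sum sat_scale sat_translate) (auto simp: group_ring_def)

end

lemma saturated_idealI:
  assumes "L \<subseteq> group_ring G" "\<And>u v. \<lbrakk>u \<in> L; v \<in> L\<rbrakk> \<Longrightarrow> (\<lambda>g. u g - v g) \<in> L"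
    and "\<And>v. \<lbrakk>v \<in> group_ring G; \<And>g. p dvd v g\<rbrakk> \<Longrightarrow> v \<in> L"
    and "\<And>n v. \<lbrakk>v \<in> group_ring G; \<not> p dvd n; (\<lambda>g. n * v g) \<in> L\<rbrakk> \<Longrightarrow> v \<in> L"
    and "\<And>g v. \<lbrakk>g \<in> carrier G; v \<in> L\<rbrakk> \<Longrightarrow> translate G g v \<in> L"
  shows "saturated_ideal p G L"
  using assms unfolding saturated_ideal_def by blast

lemma saturated_ideal_Int:
  assumes "saturated_ideal p G L" "saturated_ideal p G L'"
  shows "saturated_ideal p G (L \<inter> L')"
  using assms unfolding saturated_ideal_def by (intro conjI ballI allI impI) auto

section \<open>Nonzero products in groups with finite centralizers\<close>

lemma (in group) finite_conjugators:
  assumes "y \<in> carrier G" "finite {g \<in> carrier G. g \<otimes> y = y \<otimes> g}"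
  shows "finite {h \<in> carrier G. inv h \<otimes> y \<otimes> h = c}"
proof (cases "{h \<in> carrier G. inv h \<otimes> y \<otimes> h = c} = {}")
  case False
  then obtain k where k: "k \<in> carrier G" "inv k \<otimes> y \<otimes> k = c" by blast
  \<comment> \<open>With one solution \<open>k\<close> at hand, the solutions \<open>h\<close> form
    the coset of the centralizer of \<open>y\<close> through \<open>k\<close>.\<close>
  have "h \<in> (\<lambda>g. g \<otimes> k) ` {g \<in> carrier G. g \<otimes> y = y \<otimes> g}"
    if h: "h \<in> carrier G" "inv h \<otimes> y \<otimes> h = c" for h
  proof
    show "h = (h \<otimes> inv k) \<otimes> k" using h k by (simp add: m_assoc)
    have "y \<otimes> h = h \<otimes> c" using h assms(1) by (simp add: m_assoc[symmetric] h(2)[symmetric])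
    moreover have "c \<otimes> inv k = inv k \<otimes> y" using k assms(1) by (simp add: m_assoc k(2)[symmetric])
    moreover have "c \<in> carrier G" using k assms(1) by auto
    ultimately have "y \<otimes> (h \<otimes> inv k) = h \<otimes> inv k \<otimes> y"
      using h k assms(1) by (metis inv_closed m_assoc)
    then show "h \<otimes> inv k \<in> {g \<in> carrier G. g \<otimes> y = y \<otimes> g}"
      using h k by simp
  qed
  then show ?thesis
    by (intro finite_subset[OF _ finite_imageI[OF assms(2)]]) blast
qed (metis finite.emptyI)

text \<open>
  A suitable translate of \<open>v\<close> isolates a product of one coefficient of \<open>u\<close> and one of \<open>v\<close>: the
  translations to be avoided lie in finitely many cosets of centralizers.
\<close>

lemma (in group) conv_translate_not_dvd:
  assumes inf: "infinite (carrier G)"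
    and fin: "\<And>x. \<lbrakk>x \<in> carrier G; x \<noteq> \<one>\<rbrakk> \<Longrightarrow> finite {g \<in> carrier G. g \<otimes> x = x \<otimes> g}"
    and p: "\<And>a b. p dvd a * b \<Longrightarrow> p dvd a \<or> p dvd b"
    and u: "u \<in> group_ring G" "\<not> p dvd u g0" and v: "v \<in> group_ring G" "\<not> p dvd v k0"
  obtains h k where "h \<in> carrier G" "\<not> p dvd conv G u (translate G h v) k"
proof -
  have c: "g0 \<in> carrier G" "k0 \<in> carrier G"
    using u v by (auto simp: group_ring_def)
  let ?U = "{g. u g \<noteq> 0}" let ?V = "{g. v g \<noteq> 0}"
  have U: "finite ?U" "?U \<subseteq> carrier G" and V: "finite ?V" "?V \<subseteq> carrier G"
    using u v by (auto simp: group_ring_def)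
  \<comment> \<open>In the coefficient at \<open>g0 \<otimes> h \<otimes> k0\<close> the term of
    \<open>g\<close> is \<open>u g\<close> times the value of \<open>v\<close> at \<open>inv h
    \<otimes> (inv g \<otimes> g0) \<otimes> h \<otimes> k0\<close>. For
    \<open>g \<noteq> g0\<close> it survives only if that point is some \<open>w\<close> in the
    support of \<open>v\<close>; \<open>B\<close> collects these \<open>h\<close>. Each set in the
    union is finite because \<open>inv g \<otimes> g0\<close> is not the identity.\<close>
  define B where "B = (\<Union>g\<in>?U - {g0}. \<Union>w\<in>?V.
    {h \<in> carrier G. inv h \<otimes> (inv g \<otimes> g0) \<otimes> h = w \<otimes> inv k0})"
  have "finite B"
    unfolding B_def
  proof (intro finite_UN_I finite_conjugators fin)
    fix g assume "g \<in> ?U - {g0}"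
    then have g: "g \<in> carrier G" "g \<noteq> g0" using U by auto
    then show "inv g \<otimes> g0 \<in> carrier G" "inv g \<otimes> g0 \<in> carrier G" using c by auto
    show "inv g \<otimes> g0 \<noteq> \<one>" using g c by (metis inv_equality inv_inv inv_closed)
  qed (use U V in auto)
  then obtain h where h: "h \<in> carrier G" "h \<notin> B"
    using inf by (meson finite_subset subsetI)
  define k where "k = g0 \<otimes> h \<otimes> k0"
  have k: "k \<in> carrier G" using c h by (simp add: k_def)
  have "conv G u (translate G h v) k = (\<Sum>g\<in>?U. if g = g0 then u g0 * v k0 else 0)"
    unfolding conv_def
  proof (rule sum.cong)
    fix g assume g: "g \<in> ?U"
    then have gc: "g \<in> carrier G" using U by auto
    have eq: "translate G g (translate G h v) k = v (inv h \<otimes> (inv g \<otimes> g0) \<otimes> h \<otimes> k0)"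
      using gc h c by (simp add: translate_def k_def m_assoc)
    show "u g * translate G g (translate G h v) k = (if g = g0 then u g0 * v k0 else 0)"
    proof (cases "g = g0")
      case True then show ?thesis using eq h c by (simp add: m_assoc)
    next
      case False
      have "v (inv h \<otimes> (inv g \<otimes> g0) \<otimes> h \<otimes> k0) = 0"
      proof (rule ccontr)
        assume w: "v (inv h \<otimes> (inv g \<otimes> g0) \<otimes> h \<otimes> k0) \<noteq> 0"
        define w where "w = inv h \<otimes> (inv g \<otimes> g0) \<otimes> h \<otimes> k0"
        have "w \<in> ?V" using w by (simp add: w_def)
        moreover have "inv h \<otimes> (inv g \<otimes> g0) \<otimes> h = w \<otimes> inv k0"
          using gc h c by (simp add: w_def m_assoc)
        ultimately show False using h g False unfolding B_def by blast
      qed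
      then show ?thesis using eq False by simp
    qed
  qed simp
  also have "\<dots> = u g0 * v k0" using U u by (simp add: sum.delta)
  finally show ?thesis using that h p u v by metis
qed

section \<open>Augmentation ideal, annihilators and images of left ideals\<close>

definition zero_mod :: "int \<Rightarrow> ('g \<Rightarrow> int) \<Rightarrow> bool" where
  "zero_mod p v \<longleftrightarrow> (\<forall>g. p dvd v g)"

text \<open>Intersecting with the support keeps the sum meaningful for infinite \<open>C\<close>,
  where \<open>sum v C\<close> would be \<open>0\<close> by convention.\<close>

definition coefficient_sum :: "('g \<Rightarrow> int) \<Rightarrow> 'g set \<Rightarrow> int" where
  "coefficient_sum v C = sum v ({g. v g \<noteq> 0} \<inter> C)"

text \<open>If \<open>\<C>\<close> consists of the left cosets of a subgroup K, this stands for the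
  kernel of the map from F[G] to F[G/K]. The single coset \<open>carrier G\<close> gives the
  augmentation ideal.\<close>

definition vanishing_sums :: "int \<Rightarrow> ('g, 'm) monoid_scheme \<Rightarrow> 'g set set \<Rightarrow> ('g \<Rightarrow> int) set" where
  "vanishing_sums p G \<C> = {v. v \<in> group_ring G \<and> (\<forall>C\<in>\<C>. p dvd coefficient_sum v C)}"

abbreviation augmentation_ideal :: "int \<Rightarrow> ('g, 'm) monoid_scheme \<Rightarrow> ('g \<Rightarrow> int) set" where
  "augmentation_ideal p G \<equiv> vanishing_sums p G {carrier G}"

definition left_annihilator :: "int \<Rightarrow> ('g, 'm) monoid_scheme \<Rightarrow> ('g \<Rightarrow> int) set \<Rightarrow> ('g \<Rightarrow> int) set" where
  "left_annihilator p G Y = {u. u \<in> group_ring G \<and> (\<forall>v\<in>Y. zero_mod p (conv G u v))}"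

text \<open>Both \<open>0\<close> and the primes qualify. Integers not divisible by \<open>p\<close>
  are closed under multiplication and serve as denominators.\<close>

definition prime_modulus :: "int \<Rightarrow> bool" where
  "prime_modulus p \<longleftrightarrow> \<not> p dvd 1 \<and> (\<forall>a b. p dvd a * b \<longrightarrow> p dvd a \<or> p dvd b)"

lemma prime_modulusD: "prime_modulus p \<Longrightarrow> p dvd a * b \<Longrightarrow> p dvd a \<or> p dvd b"
  unfolding prime_modulus_def by blast

lemma coefficient_sum_superset:
  assumes "finite S" "{g. v g \<noteq> 0} \<subseteq> S"
  shows "coefficient_sum v C = sum v (S \<inter> C)"
  unfolding coefficient_sum_def using assms by (intro sum.mono_neutral_left) auto

lemma coefficient_sum_diff:
  assumes "u \<in> group_ring G" "v \<in> group_ring G"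
  shows "coefficient_sum (\<lambda>g. u g - v g) C = coefficient_sum u C - coefficient_sum v C"
proof -
  let ?S = "{g. u g \<noteq> 0} \<union> {g. v g \<noteq> 0}"
  have S: "finite ?S" using assms by (simp add: group_ring_def)
  show ?thesis
    by (subst (1 2 3) coefficient_sum_superset[OF S]) (auto simp: sum_subtractf)
qed

lemma coefficient_sum_scale: "coefficient_sum (\<lambda>g. n * v g) C = n * coefficient_sum v C"
  by (cases "n = 0") (auto simp: coefficient_sum_def sum_distrib_left)

context group
begin

lemma coefficient_sum_translate:
  assumes "h \<in> carrier G" "v \<in> group_ring G" "C \<subseteq> carrier G"
  shows "coefficient_sum (translate G h v) C = coefficient_sum v {g \<in> carrier G. h \<otimes> g \<in> C}"
proof -
  have c: "{g. v g \<noteq> 0} \<subseteq> carrier G" using assms by (auto simp: group_ring_def)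
  show ?thesis
    unfolding coefficient_sum_def
  proof (rule sum.reindex_bij_witness[of _ "\<lambda>g. h \<otimes> g" "\<lambda>g. inv h \<otimes> g"])
    fix g assume "g \<in> {g. translate G h v g \<noteq> 0} \<inter> C"
    then show "h \<otimes> (inv h \<otimes> g) = g" "inv h \<otimes> g \<in> {g. v g \<noteq> 0} \<inter> {g \<in> carrier G. h \<otimes> g \<in> C}"
      "v (inv h \<otimes> g) = translate G h v g"
      using assms by (auto simp: translate_def m_assoc[symmetric] split: if_splits)
  next
    fix g assume "g \<in> {g. v g \<noteq> 0} \<inter> {g \<in> carrier G. h \<otimes> g \<in> C}"
    then have "g \<in> carrier G" "v g \<noteq> 0" "h \<otimes> g \<in> C" using c by auto
    then show "inv h \<otimes> (h \<otimes> g) = g" "h \<otimes> g \<in> {g. translate G h v g \<noteq> 0} \<inter> C"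
      using assms by (auto simp: translate_def m_assoc[symmetric])
  qed
qed

lemma vanishing_sums_saturated:
  assumes p: "prime_modulus p" and C: "\<And>C. C \<in> \<C> \<Longrightarrow> C \<subseteq> carrier G"
    "\<And>C h. \<lbrakk>C \<in> \<C>; h \<in> carrier G\<rbrakk> \<Longrightarrow> {g \<in> carrier G. h \<otimes> g \<in> C} \<in> \<C>"
  shows "saturated_ideal p G (vanishing_sums p G \<C>)"
proof (rule saturated_idealI)
  show "vanishing_sums p G \<C> \<subseteq> group_ring G" by (auto simp: vanishing_sums_def)
next
  fix u v assume "u \<in> vanishing_sums p G \<C>" "v \<in> vanishing_sums p G \<C>"
  then show "(\<lambda>g. u g - v g) \<in> vanishing_sums p G \<C>"
    by (simp add: vanishing_sums_def group_ring_diff coefficient_sum_diff[of u G v])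
next
  fix v assume "v \<in> group_ring G" "\<And>g. p dvd v g"
  then show "v \<in> vanishing_sums p G \<C>"
    by (auto simp: vanishing_sums_def coefficient_sum_def intro: dvd_sum)
next
  fix n v assume "v \<in> group_ring G" "\<not> p dvd n" "(\<lambda>g. n * v g) \<in> vanishing_sums p G \<C>"
  then show "v \<in> vanishing_sums p G \<C>"
    unfolding vanishing_sums_def mem_Collect_eq coefficient_sum_scale
    using prime_modulusD[OF p] by blast
next
  fix g v assume "g \<in> carrier G" "v \<in> vanishing_sums p G \<C>"
  then show "translate G g v \<in> vanishing_sums p G \<C>"
    unfolding vanishing_sums_def mem_Collect_eq
    using C by (simp add: translate_group_ring coefficient_sum_translate)
qed

lemma augmentation_ideal_saturated: "prime_modulus p \<Longrightarrow> saturated_ideal p G (augmentation_ideal p G)"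
  by (rule vanishing_sums_saturated) auto

lemma zero_mod_translate: "zero_mod p v \<Longrightarrow> zero_mod p (translate G g v)"
  by (auto simp: zero_mod_def translate_def)

lemma left_annihilator_saturated:
  assumes p: "prime_modulus p" and Y: "Y \<subseteq> group_ring G"
  shows "saturated_ideal p G (left_annihilator p G Y)"
proof (rule saturated_idealI)
  show "left_annihilator p G Y \<subseteq> group_ring G" by (auto simp: left_annihilator_def)
next
  fix u v assume "u \<in> left_annihilator p G Y" "v \<in> left_annihilator p G Y"
  then show "(\<lambda>g. u g - v g) \<in> left_annihilator p G Y"
    by (auto simp: left_annihilator_def group_ring_diff conv_diff zero_mod_def)
next
  fix v assume "v \<in> group_ring G" "\<And>g. p dvd v g"
  then show "v \<in> left_annihilator p G Y"
    by (auto simp: left_annihilator_def zero_mod_def conv_def intro!: dvd_sum)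
next
  fix n v assume v: "v \<in> group_ring G" "\<not> p dvd n" "(\<lambda>g. n * v g) \<in> left_annihilator p G Y"
  have "p dvd conv G v y k" if "y \<in> Y" for y k
  proof -
    have "p dvd conv G (\<lambda>g. n * v g) y k"
      using v(3) that unfolding left_annihilator_def zero_mod_def by simp
    then show ?thesis unfolding conv_scale[OF v(1)] using v(2) prime_modulusD[OF p] by blast
  qed
  then show "v \<in> left_annihilator p G Y"
    using v(1) unfolding left_annihilator_def zero_mod_def by simp
next
  fix g v assume "g \<in> carrier G" "v \<in> left_annihilator p G Y"
  then show "translate G g v \<in> left_annihilator p G Y"
    by (simp add: left_annihilator_def translate_group_ring conv_translate zero_mod_translate)
qed

text \<open>The set below is the saturation of \<open>K * l\<close>.\<close>

lemma saturated_image: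
  assumes p: "prime_modulus p" and K: "saturated_ideal p G K" and l: "l \<in> group_ring G"
  shows "saturated_ideal p G {w \<in> group_ring G. \<exists>n. \<not> p dvd n \<and>
    (\<exists>u\<in>K. zero_mod p (\<lambda>g. n * w g - conv G u l g))}" (is "saturated_ideal p G ?C")
proof (rule saturated_idealI)
  show "?C \<subseteq> group_ring G" by auto
next
  fix w w' assume "w \<in> ?C" "w' \<in> ?C"
  then obtain n n' u u' where *: "w \<in> group_ring G" "w' \<in> group_ring G" "\<not> p dvd n" "\<not> p dvd n'"
    "u \<in> K" "u' \<in> K" "\<And>g. p dvd n * w g - conv G u l g" "\<And>g. p dvd n' * w' g - conv G u' l g"
    unfolding zero_mod_def by blast
  have uc: "u \<in> group_ring G" "u' \<in> group_ring G" using * sat_sub[OF K] by auto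
  have "p dvd n * n' * (w g - w' g) - conv G (\<lambda>g. n' * u g - n * u' g) l g" for g
  proof -
    have "p dvd n' * (n * w g - conv G u l g) - n * (n' * w' g - conv G u' l g)"
      using *(7,8) by (meson dvd_diff dvd_mult)
    then show ?thesis
      by (simp add: conv_diff conv_scale uc group_ring_scale algebra_simps)
  qed
  moreover have "(\<lambda>g. n' * u g - n * u' g) \<in> K"
    using sat_diff[OF K sat_scale[OF K *(5)] sat_scale[OF K *(6)]] .
  moreover have "\<not> p dvd n * n'" using *(3,4) prime_modulusD[OF p] by blast
  ultimately show "(\<lambda>g. w g - w' g) \<in> ?C"
    unfolding zero_mod_def using group_ring_diff *(1,2) by blast
next
  fix v assume v: "v \<in> group_ring G" "\<And>g. p dvd v g"
  have "\<not> p dvd 1" using p by (simp add: prime_modulus_def)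
  moreover have "zero_mod p (\<lambda>g. 1 * v g - conv G (\<lambda>g. 0) l g)"
    using v by (auto simp: zero_mod_def conv_def)
  ultimately show "v \<in> ?C" using sat_zero[OF K] v(1) by blast
next
  fix n v assume v: "v \<in> group_ring G" "\<not> p dvd n" "(\<lambda>g. n * v g) \<in> ?C"
  then obtain m u where *: "\<not> p dvd m" "u \<in> K" "zero_mod p (\<lambda>g. m * (n * v g) - conv G u l g)"
    by auto
  then have "\<not> p dvd m * n" "zero_mod p (\<lambda>g. m * n * v g - conv G u l g)"
    using v(2) prime_modulusD[OF p] by (auto simp: mult.assoc)
  then show "v \<in> ?C" using v(1) *(2) by blast
next
  fix g v assume v: "g \<in> carrier G" "v \<in> ?C"
  then obtain n u where *: "\<not> p dvd n" "u \<in> K" "zero_mod p (\<lambda>g. n * v g - conv G u l g)" "v \<in> group_ring G"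
    by auto
  have uc: "u \<in> group_ring G" using * sat_sub[OF K] by auto
  have "zero_mod p (\<lambda>h. n * translate G g v h - conv G (translate G g u) l h)"
    using *(3) unfolding conv_translate[OF v(1) uc] by (auto simp: zero_mod_def translate_def)
  then show "translate G g v \<in> ?C"
    using translate_group_ring[OF v(1) *(4)] *(1) sat_translate[OF K v(1) *(2)] by blast
qed

text \<open>
  Let \<open>L\<close> be a minimal left ideal and \<open>K\<close> minimal among the annihilators of subsets of \<open>L\<close> that are not
  contained in the augmentation ideal \<open>\<omega>\<close>. For \<open>l \<in> L\<close> with \<open>K * l \<noteq> 0\<close>, minimality of both forces
  \<open>(K \<inter> \<omega>) * l = 0\<close>. Since \<open>gk - k \<in> K \<inter> \<omega>\<close> for \<open>k \<in> K\<close>, the elements of \<open>K * l\<close> are invariant.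
\<close>

lemma group_ring_dcc_centralizers:
  assumes dcc: "group_ring_dcc p G" and p: "prime_modulus p"
    and fin: "\<And>x. \<lbrakk>x \<in> carrier G; x \<noteq> \<one>\<rbrakk> \<Longrightarrow> finite {g \<in> carrier G. g \<otimes> x = x \<otimes> g}"
  shows "finite (carrier G)"
proof (rule ccontr)
  assume inf: "infinite (carrier G)"
  let ?sat = "\<lambda>L. saturated_ideal p G L" and ?R = "group_ring G"
  let ?ann = "left_annihilator p G" and ?\<omega> = "augmentation_ideal p G"
  have dcc: "dcc {L. ?sat L}" using dcc by (simp add: group_ring_dcc_def)
  have p1: "\<not> p dvd 1" using p by (simp add: prime_modulus_def)
  have satR: "?sat ?R"
    by (rule saturated_idealI) (auto simp: group_ring_diff translate_group_ring)
  let ?one = "\<lambda>g. if g = \<one> then 1 else 0 :: int"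
  have one: "?one \<in> ?R" by (auto simp: group_ring_def)
  have "coefficient_sum ?one (carrier G) = 1" by (simp add: coefficient_sum_def)
  then have one_\<omega>: "?one \<notin> ?\<omega>"
    unfolding vanishing_sums_def using p1 by simp
  have nz_one: "\<not> zero_mod p ?one" using p1 by (auto simp: zero_mod_def)
  obtain L where "?sat L \<and> (\<exists>v\<in>L. \<not> zero_mod p v)"
    and Lmin': "\<And>L'. \<lbrakk>?sat L' \<and> (\<exists>v\<in>L'. \<not> zero_mod p v); L' \<subseteq> L\<rbrakk> \<Longrightarrow> L' = L"
  proof (rule dcc_minimal[OF dcc, of "\<lambda>L. ?sat L \<and> (\<exists>v\<in>L. \<not> zero_mod p v)" ?R])
    show "?sat ?R \<and> (\<exists>v\<in>?R. \<not> zero_mod p v)" using satR one nz_one by blast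
  qed auto
  then obtain v where L: "?sat L" and v: "v \<in> L" "\<not> zero_mod p v" by blast
  have Lmin: "L' = L" if "?sat L'" "L' \<subseteq> L" "w \<in> L'" "\<not> zero_mod p w" for L' w
    using Lmin'[of L'] that by blast
  \<comment> \<open>Annihilators of subsets of \<open>L\<close> are used because intersecting
    \<open>K\<close> with the annihilator of a further element \<open>l\<close> of \<open>L\<close>
    stays in this class unless it falls into \<open>?\<omega>\<close>. The whole ring, the
    annihilator of the empty set, starts the descent.\<close>
  define \<K> where "\<K> K \<longleftrightarrow> (\<exists>s. s \<subseteq> L \<and> K = ?ann s \<and> \<not> K \<subseteq> ?\<omega>)" for K
  have LR: "L \<subseteq> ?R" using sat_sub[OF L] by blast
  obtain K where "\<K> K" and Kmin: "\<And>K'. \<lbrakk>\<K> K'; K' \<subseteq> K\<rbrakk> \<Longrightarrow> K' = K"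
  proof (rule dcc_minimal[OF dcc, of \<K> ?R])
    have "?ann {} = ?R" by (auto simp: left_annihilator_def)
    then show "\<K> ?R" unfolding \<K>_def using one one_\<omega> by blast
    show "J \<in> {L. ?sat L}" if "\<K> J" for J
      using that left_annihilator_saturated[OF p] LR unfolding \<K>_def by blast
  qed auto
  then obtain s where s: "s \<subseteq> L" "K = ?ann s" and K\<omega>: "\<not> K \<subseteq> ?\<omega>"
    unfolding \<K>_def by blast
  have K: "?sat K" using left_annihilator_saturated[OF p] s LR by blast
  have \<omega>: "?sat ?\<omega>" using augmentation_ideal_saturated[OF p] .
  obtain u where u: "u \<in> K" "u \<notin> ?\<omega>" using K\<omega> by blast
  have uR: "u \<in> ?R" using u sat_sub[OF K] by blast
  have vR: "v \<in> ?R" using v LR by blast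
  obtain g0 where "\<not> p dvd u g0" using u sat_dvd[OF \<omega> uR] by blast
  moreover obtain k0 where "\<not> p dvd v k0" using v(2) by (auto simp: zero_mod_def)
  ultimately obtain h k where h: "h \<in> carrier G" "\<not> p dvd conv G u (translate G h v) k"
    using conv_translate_not_dvd[OF inf fin prime_modulusD[OF p] uR _ vR] by metis
  define l where "l = translate G h v"
  have lL: "l \<in> L" using sat_translate[OF L h(1) v(1)] by (simp add: l_def)
  have lR: "l \<in> ?R" using lL LR by blast
  have ul: "\<not> zero_mod p (conv G u l)" using h(2) by (auto simp: zero_mod_def l_def)
  \<comment> \<open>An intersection not contained in \<open>?\<omega>\<close> would belong to
    \<open>\<K>\<close> and equal \<open>K\<close> by minimality, so \<open>u\<close> would
    annihilate \<open>l\<close>.\<close>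
  have Kl: "K \<inter> ?ann {l} \<subseteq> ?\<omega>"
  proof (rule ccontr)
    assume "\<not> ?thesis"
    moreover have "K \<inter> ?ann {l} = ?ann (insert l s)"
      unfolding s(2) left_annihilator_def by blast
    ultimately have "\<K> (K \<inter> ?ann {l})"
      unfolding \<K>_def using s(1) lL by (metis insert_subset)
    then have "K \<inter> ?ann {l} = K" using Kmin by blast
    then have "u \<in> ?ann {l}" using u by blast
    then show False using ul by (simp add: left_annihilator_def)
  qed
  have zero: "zero_mod p (conv G w l)" if w: "w \<in> K" "w \<in> ?\<omega>" for w
  proof (rule ccontr)
    assume nz: "\<not> zero_mod p (conv G w l)"
    have wR: "w \<in> ?R" using w sat_sub[OF K] by blast
    let ?C = "{w \<in> group_ring G. \<exists>n. \<not> p dvd n \<and>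
      (\<exists>u\<in>K \<inter> ?\<omega>. zero_mod p (\<lambda>g. n * w g - conv G u l g))}"
    have C: "?sat ?C" by (rule saturated_image[OF p saturated_ideal_Int[OF K \<omega>] lR])
    have "?C \<subseteq> L"
    proof
      fix w assume "w \<in> ?C"
      then obtain n u where *: "w \<in> ?R" "\<not> p dvd n" "u \<in> K" "zero_mod p (\<lambda>g. n * w g - conv G u l g)"
        by blast
      have uR: "u \<in> ?R" using * sat_sub[OF K] by blast
      have "(\<lambda>g. n * w g - conv G u l g) \<in> L"
        using *(4) sat_dvd[OF L] group_ring_diff[OF group_ring_scale[OF *(1)] conv_group_ring[OF uR lR]]
        by (auto simp: zero_mod_def)
      from sat_add[OF L this sat_conv[OF L uR lL]]
      have "(\<lambda>g. n * w g) \<in> L" by simp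
      then show "w \<in> L" using sat_cancel[OF L *(1,2)] by blast
    qed
    moreover have "conv G w l \<in> ?C"
    proof -
      have "zero_mod p (\<lambda>g. 1 * conv G w l g - conv G w l g)" by (simp add: zero_mod_def)
      then show ?thesis using w conv_group_ring[OF wR lR] p1 by blast
    qed
    \<comment> \<open>Minimality of \<open>L\<close> puts \<open>conv G u l\<close> into the
      saturation of \<open>(K \<inter> ?\<omega>) * l\<close>: up to a denominator \<open>n\<close>
      it equals \<open>conv G w' l\<close> with \<open>w'\<close> in \<open>?\<omega>\<close>. Then
      \<open>n u - w'\<close> annihilates \<open>l\<close>, lies in \<open>?\<omega>\<close> by
      \<open>Kl\<close>, and forces \<open>u\<close> into \<open>?\<omega>\<close>.\<close>
    ultimately have "?C = L" using Lmin[OF C] nz by blast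
    then have "conv G u l \<in> ?C" using sat_conv[OF L uR lL] by blast
    then obtain n w' where *: "\<not> p dvd n" "w' \<in> K" "w' \<in> ?\<omega>"
      "zero_mod p (\<lambda>g. n * conv G u l g - conv G w' l g)" by blast
    have w'R: "w' \<in> ?R" using * sat_sub[OF K] by blast
    have "(\<lambda>g. n * u g - w' g) \<in> K"
      using sat_diff[OF K sat_scale[OF K u(1)] *(2)] .
    moreover have "(\<lambda>g. n * u g - w' g) \<in> ?ann {l}"
      using *(4) uR w'R
      by (simp add: left_annihilator_def group_ring_diff group_ring_scale conv_diff conv_scale zero_mod_def)
    ultimately have "(\<lambda>g. n * u g - w' g) \<in> ?\<omega>" using Kl by blast
    from sat_add[OF \<omega> this *(3)] have "(\<lambda>g. n * u g) \<in> ?\<omega>" by simp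
    then show False using sat_cancel[OF \<omega> uR *(1)] u(2) by blast
  qed
  define w where "w = conv G u l"
  have wR: "w \<in> ?R" using conv_group_ring[OF uR lR] by (simp add: w_def)
  have inv: "p dvd w (inv g \<otimes> h) - w h" if g: "g \<in> carrier G" "h \<in> carrier G" for g h
  proof -
    let ?d = "\<lambda>h. translate G g u h - u h"
    have "?d \<in> K" using sat_diff[OF K sat_translate[OF K g(1) u(1)] u(1)] .
    moreover have "?d \<in> ?\<omega>"
      using group_ring_diff[OF translate_group_ring[OF g(1) uR] uR] g(1)
        coefficient_sum_diff[OF translate_group_ring[OF g(1) uR] uR, of "carrier G"]
        coefficient_sum_translate[OF g(1) uR, of "carrier G"]
      by (simp add: vanishing_sums_def cong: conj_cong)
    ultimately have "zero_mod p (conv G ?d l)" by (rule zero)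
    then have "p dvd translate G g w h - w h"
      using conv_diff[OF translate_group_ring[OF g(1) uR] uR] conv_translate[OF g(1) uR]
      by (simp add: zero_mod_def w_def)
    then show ?thesis using g(2) by (simp add: translate_def)
  qed
  obtain k where k: "\<not> p dvd w k" using ul by (auto simp: w_def zero_mod_def)
  then have kc: "k \<in> carrier G" using group_ring_carrier[OF wR, of k] by (metis dvd_0_right)
  \<comment> \<open>Invariance carries the coefficient at \<open>k\<close>, which is nonzero modulo
    \<open>p\<close>, to every element of the group, so the support of \<open>w\<close> could not be
    finite.\<close>
  have "carrier G \<subseteq> {g. w g \<noteq> 0}"
  proof
    fix h assume h: "h \<in> carrier G"
    have "inv (k \<otimes> inv h) \<otimes> k = h" using h kc by (simp add: inv_mult_group m_assoc)
    then have "p dvd w h - w k" using inv[of "k \<otimes> inv h" k] h kc by simp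
    then show "h \<in> {g. w g \<noteq> 0}" using k by auto
  qed
  then show False using inf group_ring_finite[OF wR] finite_subset by blast
qed

end

section \<open>Chain conditions for subgroups and quotients\<close>

lemma saturated_ideal_group_ring:
  "Group.group G \<Longrightarrow> saturated_ideal p G (group_ring G)"
  by (rule saturated_idealI) (auto simp: group_ring_diff group.translate_group_ring)

lemma saturated_ideal_Inter:
  assumes "\<And>L. L \<in> \<L> \<Longrightarrow> saturated_ideal p G L" "\<L> \<noteq> {}"
  shows "saturated_ideal p G (\<Inter>\<L>)"
proof (rule saturated_idealI)
  show "\<Inter>\<L> \<subseteq> group_ring G" using assms sat_sub by blast
  show "(\<lambda>g. u g - v g) \<in> \<Inter>\<L>" if "u \<in> \<Inter>\<L>" "v \<in> \<Inter>\<L>" for u v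
    using that sat_diff[OF assms(1)] by blast
  show "v \<in> \<Inter>\<L>" if "v \<in> group_ring G" "\<And>g. p dvd v g" for v
    using that sat_dvd[OF assms(1)] by blast
  show "v \<in> \<Inter>\<L>" if "v \<in> group_ring G" "\<not> p dvd n" "(\<lambda>g. n * v g) \<in> \<Inter>\<L>" for n v
    using that sat_cancel[OF assms(1)] by blast
  show "translate G g v \<in> \<Inter>\<L>" if "g \<in> carrier G" "v \<in> \<Inter>\<L>" for g v
    using that sat_translate[OF assms(1)] by blast
qed

text \<open>The element \<open>k - 1\<close> of the group ring. Its coset sums all vanish exactly
  when \<open>k\<close> and the identity lie in the same coset.\<close>

definition basis_diff :: "('g, 'm) monoid_scheme \<Rightarrow> 'g \<Rightarrow> 'g \<Rightarrow> int" where
  "basis_diff G k = (\<lambda>g. of_bool (g = k) - of_bool (g = \<one>\<^bsub>G\<^esub>))"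

lemma coefficient_sum_basis_diff:
  "coefficient_sum (basis_diff G k) C = of_bool (k \<in> C) - of_bool (\<one>\<^bsub>G\<^esub> \<in> C)"
proof -
  have "coefficient_sum (basis_diff G k) C = sum (basis_diff G k) ({k, \<one>\<^bsub>G\<^esub>} \<inter> C)"
    by (rule coefficient_sum_superset) (auto simp: basis_diff_def)
  then show ?thesis
    by (cases "k \<in> C"; cases "\<one>\<^bsub>G\<^esub> \<in> C"; cases "k = \<one>\<^bsub>G\<^esub>") (auto simp: basis_diff_def)
qed

context group
begin

lemma subgroup_mult_right_iff:
  assumes "subgroup K G" "m \<in> K" "g \<in> carrier G"
  shows "g \<otimes> m \<in> K \<longleftrightarrow> g \<in> K"
proof
  have m: "m \<in> carrier G" using assms by (simp add: subgroup.mem_carrier)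
  assume "g \<otimes> m \<in> K"
  then have "(g \<otimes> m) \<otimes> inv m \<in> K" using assms by (simp add: subgroup.m_closed subgroup.m_inv_closed)
  then show "g \<in> K" using assms m by (simp add: m_assoc)
qed (use assms in \<open>simp add: subgroup.m_closed\<close>)

text \<open>A subgroup \<open>K\<close> is sent to the left ideal generated by the elements
  \<open>k - 1\<close> with \<open>k \<in> K\<close>. It can be read off from that ideal: the kernel
  of the map from F[G] to F[G/K] is a left ideal containing the generators, but it does not contain
  \<open>k - 1\<close> for \<open>k\<close> outside \<open>K\<close>.\<close>

lemma dcc_subgroups:
  assumes dcc: "group_ring_dcc p G" and p: "prime_modulus p"
  shows "dcc {K. subgroup K G}"
proof (rule dcc_embed)
  let ?\<L> = "\<lambda>K. {L. saturated_ideal p G L \<and> (\<forall>k\<in>K. basis_diff G k \<in> L)}"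
  define \<Phi> where "\<Phi> K = \<Inter>(?\<L> K)" for K
  show "dcc {L. saturated_ideal p G L}" using dcc by (simp add: group_ring_dcc_def)
  have bd: "basis_diff G k \<in> group_ring G" if "k \<in> carrier G" for k
    by (rule group_ringI[of "{k, \<one>}"]) (use that in \<open>auto simp: basis_diff_def\<close>)
  show "\<Phi> K \<in> {L. saturated_ideal p G L}" if "K \<in> {K. subgroup K G}" for K
  proof -
    have "group_ring G \<in> ?\<L> K"
      using saturated_ideal_group_ring[OF group_axioms] bd that by (auto dest: subgroup.mem_carrier)
    then show ?thesis unfolding \<Phi>_def mem_Collect_eq by (intro saturated_ideal_Inter) blast+
  qed
  show "\<Phi> I \<subseteq> \<Phi> J" if "I \<subseteq> J" for I J unfolding \<Phi>_def using that by blast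
  have *: "k \<in> K" if K: "subgroup K G" "k \<in> carrier G" "basis_diff G k \<in> \<Phi> K" for K k
  proof (rule ccontr)
    assume k: "k \<notin> K"
    \<comment> \<open>The set \<open>{h \<in> carrier G. g \<otimes> h \<in> K}\<close> is the left
      coset of \<open>K\<close> through \<open>inv g\<close>, so all left cosets occur.\<close>
    let ?V = "vanishing_sums p G {C. \<exists>g\<in>carrier G. C = {h \<in> carrier G. g \<otimes> h \<in> K}}"
    have "saturated_ideal p G ?V"
    proof (rule vanishing_sums_saturated[OF p])
      fix C h assume "C \<in> {C. \<exists>g\<in>carrier G. C = {h \<in> carrier G. g \<otimes> h \<in> K}}" and h: "h \<in> carrier G"
      then obtain g where g: "g \<in> carrier G" "C = {h \<in> carrier G. g \<otimes> h \<in> K}" by blast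
      have "{l \<in> carrier G. h \<otimes> l \<in> C} = {l \<in> carrier G. (g \<otimes> h) \<otimes> l \<in> K}"
        using g h by (auto simp: m_assoc)
      then show "{l \<in> carrier G. h \<otimes> l \<in> C} \<in> {C. \<exists>g\<in>carrier G. C = {h \<in> carrier G. g \<otimes> h \<in> K}}"
        using g h by blast
    qed auto
    moreover have "basis_diff G m \<in> ?V" if m: "m \<in> K" for m
    proof -
      have mc: "m \<in> carrier G" using K(1) m by (simp add: subgroup.mem_carrier)
      have "coefficient_sum (basis_diff G m) {h \<in> carrier G. g \<otimes> h \<in> K} = 0" if g: "g \<in> carrier G" for g
      proof -
        have "g \<otimes> m \<in> K \<longleftrightarrow> g \<in> K"
          using subgroup_mult_right_iff[OF K(1) m g] .
        then show ?thesis using mc g by (simp add: coefficient_sum_basis_diff)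
      qed
      then show ?thesis using bd[OF mc] by (auto simp: vanishing_sums_def)
    qed
    ultimately have "basis_diff G k \<in> ?V" using K(3) unfolding \<Phi>_def by blast
    moreover have "K = {h \<in> carrier G. \<one> \<otimes> h \<in> K}" using K(1) by (auto dest: subgroup.mem_carrier)
    then have "K \<in> {C. \<exists>g\<in>carrier G. C = {h \<in> carrier G. g \<otimes> h \<in> K}}" using one_closed by blast
    ultimately have "p dvd coefficient_sum (basis_diff G k) K"
      unfolding vanishing_sums_def by blast
    moreover have "coefficient_sum (basis_diff G k) K = -1"
      using k K(1) by (simp add: coefficient_sum_basis_diff subgroup.one_closed)
    ultimately show False using p by (simp add: prime_modulus_def)
  qed
  have **: "basis_diff G k \<in> \<Phi> K" if "k \<in> K" for k K using that unfolding \<Phi>_def by blast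
  show "inj_on \<Phi> {K. subgroup K G}"
  proof (rule inj_onI)
    fix I J assume IJ: "I \<in> {K. subgroup K G}" "J \<in> {K. subgroup K G}" "\<Phi> I = \<Phi> J"
    have "k \<in> J" if "k \<in> I" for k using **[OF that] *[of J k] IJ that by (auto dest: subgroup.mem_carrier)
    moreover have "k \<in> I" if "k \<in> J" for k using **[OF that] *[of I k] IJ that by (auto dest: subgroup.mem_carrier)
    ultimately show "I = J" by blast
  qed
qed

text \<open>F[G] is the direct sum of copies of F[K], one for each left coset of \<open>K\<close>. A
  left ideal \<open>L\<close> of F[K] extends to the elements all of whose coset components, moved
  back to \<open>K\<close> by \<open>r\<close>, lie in \<open>L\<close>. Left translation in G only
  permutes the components up to translation inside \<open>K\<close>. The elements of the extension
  that are supported on \<open>K\<close> are those of \<open>L\<close>.\<close>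

lemma group_ring_dcc_subgroup:
  assumes dcc: "group_ring_dcc p G" and K: "subgroup K G"
  shows "group_ring_dcc p (G\<lparr>carrier := K\<rparr>)"
  unfolding group_ring_dcc_def
proof (rule dcc_embed)
  let ?H = "G\<lparr>carrier := K\<rparr>"
  interpret H: group ?H using K by (rule subgroup_imp_group)
  define r where "r g u = (\<lambda>k. if k \<in> K then u (g \<otimes> k) else 0)" for g and u :: "'a \<Rightarrow> int"
  define \<Phi> where "\<Phi> L = {u. u \<in> group_ring G \<and> (\<forall>g\<in>carrier G. r g u \<in> L)}" for L
  have KG: "k \<in> carrier G" if "k \<in> K" for k using K that by (simp add: subgroup.mem_carrier)
  have invK: "inv\<^bsub>?H\<^esub> k = inv k" if "k \<in> K" for k using K that by (rule m_inv_consistent)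
  have rR: "r g u \<in> group_ring ?H" if "u \<in> group_ring G" "g \<in> carrier G" for g u
  proof (rule group_ringI[of "{k \<in> K. u (g \<otimes> k) \<noteq> 0}"])
    have "inj_on (\<lambda>k. g \<otimes> k) {k \<in> K. u (g \<otimes> k) \<noteq> 0}"
      using that KG by (auto simp: inj_on_def)
    moreover have "(\<lambda>k. g \<otimes> k) ` {k \<in> K. u (g \<otimes> k) \<noteq> 0} \<subseteq> {g. u g \<noteq> 0}" by auto
    ultimately show "finite {k \<in> K. u (g \<otimes> k) \<noteq> 0}"
      using group_ring_finite[OF that(1)] by (meson finite_imageD finite_subset)
  qed (auto simp: r_def split: if_splits)
  show "dcc {L. saturated_ideal p G L}" using dcc by (simp add: group_ring_dcc_def)
  show "\<Phi> L \<in> {L. saturated_ideal p G L}" if "L \<in> {L. saturated_ideal p ?H L}" for L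
  proof (rule CollectI, rule saturated_idealI)
    from that have L: "saturated_ideal p ?H L" by simp
    show "\<Phi> L \<subseteq> group_ring G" by (auto simp: \<Phi>_def)
    show "(\<lambda>g. u g - v g) \<in> \<Phi> L" if "u \<in> \<Phi> L" "v \<in> \<Phi> L" for u v
    proof -
      have "r g (\<lambda>g. u g - v g) \<in> L" if "g \<in> carrier G" for g
      proof -
        have "r g (\<lambda>g. u g - v g) = (\<lambda>k. r g u k - r g v k)" by (auto simp: r_def)
        then show ?thesis using sat_diff[OF L] that \<open>u \<in> \<Phi> L\<close> \<open>v \<in> \<Phi> L\<close> by (simp add: \<Phi>_def)
      qed
      then show ?thesis using that by (simp add: \<Phi>_def group_ring_diff)
    qed
    show "v \<in> \<Phi> L" if "v \<in> group_ring G" "\<And>g. p dvd v g" for v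
      unfolding \<Phi>_def using that by (auto intro!: sat_dvd[OF L] rR) (simp add: r_def)
    show "v \<in> \<Phi> L" if v: "v \<in> group_ring G" "\<not> p dvd n" "(\<lambda>g. n * v g) \<in> \<Phi> L" for n v
    proof -
      have "r g v \<in> L" if "g \<in> carrier G" for g
      proof (rule sat_cancel[OF L rR[OF v(1) that] v(2)])
        have "(\<lambda>k. n * r g v k) = r g (\<lambda>g. n * v g)" by (auto simp: r_def)
        then show "(\<lambda>k. n * r g v k) \<in> L" using v(3) that by (simp add: \<Phi>_def)
      qed
      then show ?thesis using v(1) by (simp add: \<Phi>_def)
    qed
    show "translate G h v \<in> \<Phi> L" if h: "h \<in> carrier G" "v \<in> \<Phi> L" for h v
    proof -
      have "r g (translate G h v) \<in> L" if g: "g \<in> carrier G" for g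
      proof -
        have "r g (translate G h v) = r (inv h \<otimes> g) v"
          using g h KG by (auto simp: r_def translate_def m_assoc)
        then show ?thesis using h g by (simp add: \<Phi>_def)
      qed
      then show ?thesis using h by (simp add: \<Phi>_def translate_group_ring)
    qed
  qed
  show "\<Phi> I \<subseteq> \<Phi> J" if "I \<subseteq> J" for I J using that by (auto simp: \<Phi>_def)
  have *: "v \<in> L \<longleftrightarrow> v \<in> group_ring ?H \<and> v \<in> \<Phi> L" if L: "saturated_ideal p ?H L" for L v
  proof
    assume "v \<in> group_ring ?H \<and> v \<in> \<Phi> L"
    then have v: "v \<in> group_ring ?H" "r \<one> v \<in> L" by (auto simp: \<Phi>_def)
    have "r \<one> v = v" using KG group_ring_outside[OF v(1)] by (auto simp: r_def)
    then show "v \<in> L" using v by simp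
  next
    assume v: "v \<in> L"
    then have vH: "v \<in> group_ring ?H" using sat_sub[OF L] by blast
    have "r g v \<in> L" if g: "g \<in> carrier G" for g
    proof (cases "g \<in> K")
      case True
      then have "r g v = translate ?H (inv g) v"
        using K by (auto simp: r_def translate_def invK subgroup.m_inv_closed g)
      then show ?thesis using sat_translate[OF L _ v, of "inv g"] True K by (simp add: subgroup.m_inv_closed)
    next
      case False
      then have "g \<otimes> k \<notin> K" if "k \<in> K" for k
        using subgroup_mult_right_iff[OF K that g] by simp
      then have "r g v = (\<lambda>k. 0)" using group_ring_outside[OF vH] by (auto simp: r_def)
      then show ?thesis using sat_zero[OF L] by simp
    qed
    moreover have "v \<in> group_ring G" using vH KG by (auto simp: group_ring_def)
    ultimately show "v \<in> group_ring ?H \<and> v \<in> \<Phi> L" using vH by (simp add: \<Phi>_def)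
  qed
  show "inj_on \<Phi> {L. saturated_ideal p ?H L}"
    by (rule inj_onI) (use * in auto)
qed

text \<open>
  Complements turn the ascending chain condition on finite subgroups into a descending one.
\<close>

lemma dcc_complements_finite_subgroups:
  assumes dcc: "group_ring_dcc p G" and p: "prime_modulus p"
  shows "dcc {- K |K. subgroup K G \<and> finite K}"
proof (rule dcc_embed)
  \<comment> \<open>These are the elements invariant modulo \<open>p\<close> under right
    multiplication by the subgroup K with complement \<open>C\<close>. A larger K imposes more
    conditions, so \<open>\<Phi>\<close> is monotone in \<open>C\<close>.\<close>
  define \<Phi> where "\<Phi> C = {u. u \<in> group_ring G \<and> (\<forall>g\<in>carrier G. \<forall>k\<in>carrier G - C. p dvd u (g \<otimes> k) - u g)}"
    for C
  show "dcc {L. saturated_ideal p G L}" using dcc by (simp add: group_ring_dcc_def)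
  show "\<Phi> C \<in> {L. saturated_ideal p G L}" for C
  proof (rule CollectI, rule saturated_idealI)
    show "\<Phi> C \<subseteq> group_ring G" by (auto simp: \<Phi>_def)
    show "(\<lambda>g. u g - v g) \<in> \<Phi> C" if "u \<in> \<Phi> C" "v \<in> \<Phi> C" for u v
    proof -
      have "p dvd (u (g \<otimes> k) - v (g \<otimes> k)) - (u g - v g)" if "g \<in> carrier G" "k \<in> carrier G - C" for g k
      proof -
        have "p dvd (u (g \<otimes> k) - u g) - (v (g \<otimes> k) - v g)"
          using \<open>u \<in> \<Phi> C\<close> \<open>v \<in> \<Phi> C\<close> that by (intro dvd_diff[of p "u (g \<otimes> k) - u g"]) (auto simp: \<Phi>_def)
        then show ?thesis by (simp add: algebra_simps)
      qed
      then show ?thesis using that by (simp add: \<Phi>_def group_ring_diff)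
    qed
    show "v \<in> \<Phi> C" if "v \<in> group_ring G" "\<And>g. p dvd v g" for v
      using that by (auto simp: \<Phi>_def)
    show "v \<in> \<Phi> C" if v: "v \<in> group_ring G" "\<not> p dvd n" "(\<lambda>g. n * v g) \<in> \<Phi> C" for n v
    proof -
      have "p dvd v (g \<otimes> k) - v g" if "g \<in> carrier G" "k \<in> carrier G - C" for g k
      proof -
        have "p dvd n * (v (g \<otimes> k) - v g)" using v(3) that by (simp add: \<Phi>_def right_diff_distrib)
        then show ?thesis using v(2) prime_modulusD[OF p] by blast
      qed
      then show ?thesis using v(1) by (simp add: \<Phi>_def)
    qed
    show "translate G h v \<in> \<Phi> C" if h: "h \<in> carrier G" "v \<in> \<Phi> C" for h v
      using h by (simp add: \<Phi>_def translate_group_ring) (simp add: translate_def m_assoc[symmetric])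
  qed
  show "\<Phi> I \<subseteq> \<Phi> J" if "I \<subseteq> J" for I J using that by (auto simp: \<Phi>_def)
  have *: "K \<subseteq> K'" if K: "subgroup K G" and K': "subgroup K' G" "finite K'" and eq: "\<Phi> (- K) = \<Phi> (- K')"
    for K K'
  proof
    \<comment> \<open>The sum of the elements of \<open>K'\<close>, which lies in the group ring
      because \<open>K'\<close> is finite. It is invariant under \<open>K'\<close>, and comparing
      its values at the identity and at \<open>k\<close> detects every \<open>k\<close> outside
      \<open>K'\<close>.\<close>
    let ?i = "\<lambda>g. of_bool (g \<in> K') :: int"
    have K'c: "k \<in> carrier G" if "k \<in> K'" for k using K'(1) that by (simp add: subgroup.mem_carrier)
    fix k assume k: "k \<in> K"
    then have kc: "k \<in> carrier G" using K by (simp add: subgroup.mem_carrier)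
    have "?i \<in> group_ring G" using K' K'c by (intro group_ringI[of K']) auto
    then have "?i \<in> \<Phi> (- K')"
      using subgroup_mult_right_iff[OF K'(1)] by (auto simp: \<Phi>_def)
    then have "?i \<in> \<Phi> (- K)" using eq by simp
    then have "p dvd ?i (\<one> \<otimes> k) - ?i \<one>"
      using k kc unfolding \<Phi>_def by blast
    then show "k \<in> K'"
      using kc K'(1) p by (cases "k \<in> K'") (auto simp: prime_modulus_def subgroup.one_closed)
  qed
  show "inj_on \<Phi> {- K |K. subgroup K G \<and> finite K}"
  proof (rule inj_onI)
    fix C D assume "C \<in> {- K |K. subgroup K G \<and> finite K}" "D \<in> {- K |K. subgroup K G \<and> finite K}"
      and eq: "\<Phi> C = \<Phi> D"
    then obtain K K' where "C = - K" "D = - K'" "subgroup K G" "finite K" "subgroup K' G" "finite K'"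
      by blast
    then show "C = D" using *[of K K'] *[of K' K] eq by auto
  qed
qed

end

text \<open>Summing coefficients over the fibres of \<open>\<pi>\<close> is the surjection from F[G]
  onto F[Q], and left ideals are pulled back along it. They are determined by their preimages
  because every \<open>v\<close> lifts: its coefficients are placed on one representative per
  fibre.\<close>

lemma group_ring_dcc_image:
  assumes hom: "group_hom G Q \<pi>" and surj: "\<pi> ` carrier G = carrier Q" and dcc: "group_ring_dcc p G"
  shows "group_ring_dcc p Q"
  unfolding group_ring_dcc_def
proof (rule dcc_embed)
  interpret group_hom G Q \<pi> by (rule hom)
  define push where "push u = (\<lambda>c. if c \<in> carrier Q then coefficient_sum u {g \<in> carrier G. \<pi> g = c} else 0)"
    for u :: "'a \<Rightarrow> int"
  define \<Phi> where "\<Phi> L = {u. u \<in> group_ring G \<and> push u \<in> L}" for L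
  have pushR: "push u \<in> group_ring Q" if u: "u \<in> group_ring G" for u
  proof (rule group_ringI[of "\<pi> ` {g. u g \<noteq> 0}"])
    show "finite (\<pi> ` {g. u g \<noteq> 0})" using group_ring_finite[OF u] by simp
    show "\<pi> ` {g. u g \<noteq> 0} \<subseteq> carrier Q" using group_ring_carrier[OF u] by auto
    fix c assume c: "push u c \<noteq> 0"
    then have "{g. u g \<noteq> 0} \<inter> {g \<in> carrier G. \<pi> g = c} \<noteq> {}"
      unfolding push_def coefficient_sum_def by (metis sum.empty)
    then show "c \<in> \<pi> ` {g. u g \<noteq> 0}" by blast
  qed
  show "dcc {L. saturated_ideal p G L}" using dcc by (simp add: group_ring_dcc_def)
  show "\<Phi> L \<in> {L. saturated_ideal p G L}" if "L \<in> {L. saturated_ideal p Q L}" for L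
  proof (rule CollectI, rule saturated_idealI)
    from that have L: "saturated_ideal p Q L" by simp
    show "\<Phi> L \<subseteq> group_ring G" by (auto simp: \<Phi>_def)
    show "(\<lambda>g. u g - v g) \<in> \<Phi> L" if uv: "u \<in> \<Phi> L" "v \<in> \<Phi> L" for u v
    proof -
      have R: "u \<in> group_ring G" "v \<in> group_ring G" using uv by (auto simp: \<Phi>_def)
      have "push (\<lambda>g. u g - v g) = (\<lambda>c. push u c - push v c)"
        by (auto simp: push_def coefficient_sum_diff[OF R])
      then show ?thesis using uv sat_diff[OF L, of "push u" "push v"] R by (simp add: \<Phi>_def group_ring_diff)
    qed
    show "v \<in> \<Phi> L" if "v \<in> group_ring G" "\<And>g. p dvd v g" for v
      using that sat_dvd[OF L pushR[OF that(1)]]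
      by (auto simp: \<Phi>_def push_def coefficient_sum_def dvd_sum)
    show "v \<in> \<Phi> L" if v: "v \<in> group_ring G" "\<not> p dvd n" "(\<lambda>g. n * v g) \<in> \<Phi> L" for n v
    proof -
      have "push (\<lambda>g. n * v g) = (\<lambda>c. n * push v c)"
        by (auto simp: push_def coefficient_sum_scale)
      then show ?thesis using v sat_cancel[OF L pushR[OF v(1)] v(2)] by (simp add: \<Phi>_def)
    qed
    show "translate G h v \<in> \<Phi> L" if h: "h \<in> carrier G" "v \<in> \<Phi> L" for h v
    proof -
      have vR: "v \<in> group_ring G" using h by (simp add: \<Phi>_def)
      have "push (translate G h v) c = translate Q (\<pi> h) (push v) c" for c
      proof (cases "c \<in> carrier Q")
        case True
        have "\<pi> h \<otimes>\<^bsub>Q\<^esub> \<pi> g = c \<longleftrightarrow> \<pi> g = inv\<^bsub>Q\<^esub> \<pi> h \<otimes>\<^bsub>Q\<^esub> c" if "g \<in> carrier G" for g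
          using h True that H.inv_solve_left by (metis hom_closed)
        then have eq: "{g \<in> carrier G. h \<otimes>\<^bsub>G\<^esub> g \<in> {g \<in> carrier G. \<pi> g = c}}
            = {g \<in> carrier G. \<pi> g = inv\<^bsub>Q\<^esub> \<pi> h \<otimes>\<^bsub>Q\<^esub> c}"
          by (intro Collect_cong) (use h in \<open>simp cong: conj_cong\<close>)
        have "push (translate G h v) c = coefficient_sum (translate G h v) {g \<in> carrier G. \<pi> g = c}"
          using True by (simp add: push_def)
        also have "\<dots> = coefficient_sum v {g \<in> carrier G. h \<otimes>\<^bsub>G\<^esub> g \<in> {g \<in> carrier G. \<pi> g = c}}"
          by (rule G.coefficient_sum_translate[OF h(1) vR]) blast
        also have "\<dots> = push v (inv\<^bsub>Q\<^esub> \<pi> h \<otimes>\<^bsub>Q\<^esub> c)"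
          unfolding eq using True h by (simp add: push_def)
        finally show ?thesis using True by (simp add: translate_def)
      qed (simp add: push_def translate_def)
      then have "push (translate G h v) = translate Q (\<pi> h) (push v)" by blast
      then show ?thesis
        using h sat_translate[OF L, of "\<pi> h" "push v"] by (simp add: \<Phi>_def G.translate_group_ring)
    qed
  qed
  show "\<Phi> I \<subseteq> \<Phi> J" if "I \<subseteq> J" for I J using that by (auto simp: \<Phi>_def)
  have lift: "\<exists>u. u \<in> group_ring G \<and> push u = v" if v: "v \<in> group_ring Q" for v
  proof -
    define rep where "rep = inv_into (carrier G) \<pi>"
    have rep: "rep c \<in> carrier G" "\<pi> (rep c) = c" if "c \<in> carrier Q" for c
      unfolding rep_def using that surj inv_into_into[of c \<pi> "carrier G"] f_inv_into_f[of c \<pi> "carrier G"]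
      by simp_all
    define u where "u g = (if g \<in> carrier G \<and> g = rep (\<pi> g) then v (\<pi> g) else 0)" for g
    have uR: "u \<in> group_ring G"
    proof (rule group_ringI[of "rep ` {c. v c \<noteq> 0}"])
      show "finite (rep ` {c. v c \<noteq> 0})" using group_ring_finite[OF v] by simp
      show "rep ` {c. v c \<noteq> 0} \<subseteq> carrier G" using group_ring_carrier[OF v] rep by blast
      show "g \<in> rep ` {c. v c \<noteq> 0}" if "u g \<noteq> 0" for g using that by (auto simp: u_def split: if_splits)
    qed
    have "push u c = v c" for c
    proof (cases "c \<in> carrier Q")
      case True
      have "coefficient_sum u {g \<in> carrier G. \<pi> g = c} = sum u {rep c}"
        unfolding coefficient_sum_def using group_ring_finite[OF uR] rep[OF True]
        by (intro sum.mono_neutral_cong) (auto simp: u_def split: if_splits)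
      also have "\<dots> = v c" using rep[OF True] by (simp add: u_def)
      finally show ?thesis using True by (simp add: push_def)
    qed (use group_ring_outside[OF v] in \<open>simp add: push_def\<close>)
    then show ?thesis using uR by blast
  qed
  show "inj_on \<Phi> {L. saturated_ideal p Q L}"
  proof (rule inj_onI)
    have *: "I \<subseteq> J" if I: "saturated_ideal p Q I" and eq: "\<Phi> I = \<Phi> J" for I J
    proof
      fix v assume v: "v \<in> I"
      then obtain u where u: "u \<in> group_ring G" "push u = v" using lift[OF sat_sub[OF I v]] by blast
      then have "u \<in> \<Phi> I" using v by (simp add: \<Phi>_def)
      then show "v \<in> J" using u unfolding eq by (simp add: \<Phi>_def)
    qed
    fix I J assume "I \<in> {L. saturated_ideal p Q L}" "J \<in> {L. saturated_ideal p Q L}" "\<Phi> I = \<Phi> J"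
    then show "I = J" using *[of I J] *[of J I] by auto
  qed
qed

section \<open>Infinite groups all of whose proper subgroups are finite\<close>

context group
begin

lemma subgroup_centralizer:
  assumes "x \<in> carrier G"
  shows "subgroup {g \<in> carrier G. g \<otimes> x = x \<otimes> g} G"
proof (rule subgroupI)
  show "{g \<in> carrier G. g \<otimes> x = x \<otimes> g} \<noteq> {}" using assms by (auto intro!: exI[of _ \<one>])
next
  fix a assume a: "a \<in> {g \<in> carrier G. g \<otimes> x = x \<otimes> g}"
  then have ac: "a \<in> carrier G" "a \<otimes> x = x \<otimes> a" by auto
  have "inv a \<otimes> x = inv a \<otimes> (x \<otimes> a) \<otimes> inv a" using ac(1) assms by (simp add: m_assoc)
  also have "\<dots> = inv a \<otimes> (a \<otimes> x) \<otimes> inv a" using ac(2) by simp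
  also have "\<dots> = x \<otimes> inv a" using ac(1) assms by (simp add: m_assoc[symmetric])
  finally show "inv a \<in> {g \<in> carrier G. g \<otimes> x = x \<otimes> g}" using ac(1) by simp
next
  fix a b assume "a \<in> {g \<in> carrier G. g \<otimes> x = x \<otimes> g}" "b \<in> {g \<in> carrier G. g \<otimes> x = x \<otimes> g}"
  then show "a \<otimes> b \<in> {g \<in> carrier G. g \<otimes> x = x \<otimes> g}"
    using assms by (simp add: m_assoc) (simp add: m_assoc[symmetric])
qed auto

lemma subgroup_center: "subgroup {z \<in> carrier G. \<forall>g\<in>carrier G. z \<otimes> g = g \<otimes> z} G"
proof -
  have "{z \<in> carrier G. \<forall>g\<in>carrier G. z \<otimes> g = g \<otimes> z}
      = \<Inter> ((\<lambda>x. {g \<in> carrier G. g \<otimes> x = x \<otimes> g}) ` carrier G)" by auto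
  then show ?thesis using subgroup_centralizer by (auto intro!: subgroups_Inter)
qed

lemma subgroup_vimage:
  assumes hom: "group_hom G Q \<pi>" and K: "subgroup K Q"
  shows "subgroup {g \<in> carrier G. \<pi> g \<in> K} G"
proof (rule subgroupI)
  interpret h: group_hom G Q \<pi> by fact
  show "{g \<in> carrier G. \<pi> g \<in> K} \<noteq> {}"
    using subgroup.one_closed[OF K] h.hom_one by (metis (mono_tags, lifting) empty_iff mem_Collect_eq one_closed)
  show "inv a \<in> {g \<in> carrier G. \<pi> g \<in> K}" if "a \<in> {g \<in> carrier G. \<pi> g \<in> K}" for a
    using that K by (auto simp: subgroup.m_inv_closed)
  show "a \<otimes> b \<in> {g \<in> carrier G. \<pi> g \<in> K}"
    if "a \<in> {g \<in> carrier G. \<pi> g \<in> K}" "b \<in> {g \<in> carrier G. \<pi> g \<in> K}" for a b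
    using that K by (auto simp: subgroup.m_closed)
qed auto

text \<open>If \<open>y\<close> had infinite order, encoded as \<open>ord y = 0\<close>, its square
  would generate an infinite subgroup, hence the whole group. Then \<open>y\<close> would be an even
  power of itself, which requires \<open>2 * k = 1\<close>.\<close>

lemma finite_generate_singleton:
  assumes min: "\<And>K. \<lbrakk>subgroup K G; infinite K\<rbrakk> \<Longrightarrow> K = carrier G" and y: "y \<in> carrier G"
  shows "finite (generate G {y})"
proof (rule ccontr)
  assume inf: "infinite (generate G {y})"
  have ord: "ord z = 0 \<longleftrightarrow> infinite (generate G {z})" if "z \<in> carrier G" for z
  proof -
    have "generate G {z} \<noteq> {}" using generate.one by blast
    then show ?thesis using generate_pow_card[OF that] by auto
  qed
  have "ord y = 0" using ord[OF y] inf by simp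
  let ?z = "y [^] (2::int)"
  have zc: "?z \<in> carrier G" using y by simp
  have "ord ?z = 0"
  proof -
    have "y [^] (2 * int (ord ?z)) = ?z [^] int (ord ?z)" using y by (simp add: int_pow_pow)
    also have "\<dots> = \<one>" using int_pow_eq_id[OF zc, of "int (ord ?z)"] by simp
    finally show ?thesis using int_pow_eq_id[OF y] \<open>ord y = 0\<close> by simp
  qed
  then have "generate G {?z} = carrier G" using ord[OF zc] min generate_is_subgroup zc by simp
  then have "y \<in> generate G {?z}" using y by simp
  then obtain k :: int where "y = ?z [^] k" using generate_pow[OF zc] by auto
  then have "y [^] (1::int) = y [^] (2 * k)" using y by (simp add: int_pow_pow)
  then have "int (ord y) dvd 2 * k - 1" using int_pow_eq[OF y] by blast
  then have "2 * k = 1" using \<open>ord y = 0\<close> by simp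
  then show False by presburger
qed

lemma minimal_infinite_contradiction:
  assumes dcc: "group_ring_dcc p G" and p: "prime_modulus p"
    and min: "\<And>K. \<lbrakk>subgroup K G; infinite K\<rbrakk> \<Longrightarrow> K = carrier G" and inf: "infinite (carrier G)"
  shows False
proof -
  define Z where "Z = {z \<in> carrier G. \<forall>g\<in>carrier G. z \<otimes> g = g \<otimes> z}"
  have Z: "subgroup Z G" unfolding Z_def by (rule subgroup_center)
  show False
  proof (cases "finite Z")
    case False
    then have "Z = carrier G" using min[OF Z] by simp
    then have comm: "a \<otimes> b = b \<otimes> a" if "a \<in> carrier G" "b \<in> carrier G" for a b
      using that unfolding Z_def by blast
    \<comment> \<open>A minimal complement belongs to a maximal finite subgroup \<open>K\<close>. In
      the abelian case the product of \<open>K\<close> with the finite cyclic group of an element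
      outside \<open>K\<close> is a larger finite subgroup.\<close>
    obtain C where "C \<in> {- K |K. subgroup K G \<and> finite K}"
      and Cmin: "\<And>D. \<lbrakk>D \<in> {- K |K. subgroup K G \<and> finite K}; D \<subseteq> C\<rbrakk> \<Longrightarrow> D = C"
    proof (rule dcc_minimal[OF dcc_complements_finite_subgroups[OF dcc p], of "\<lambda>C. C \<in> {- K |K. subgroup K G \<and> finite K}" "- {\<one>}"])
      show "- {\<one>} \<in> {- K |K. subgroup K G \<and> finite K}" using triv_subgroup by auto
    qed blast+
    then obtain K where K: "subgroup K G" "finite K" "C = - K" by blast
    have "\<not> carrier G \<subseteq> K" using inf K(2) finite_subset by metis
    then obtain y where y: "y \<in> carrier G" "y \<notin> K" by blast
    define Y where "Y = generate G {y}"
    have Y: "subgroup Y G" "finite Y" "y \<in> Y"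
      using y generate_is_subgroup finite_generate_singleton[OF min] generate.incl[of y "{y}" G] by (auto simp: Y_def)
    have c: "a \<in> carrier G" if "a \<in> K \<or> a \<in> Y" for a using that K(1) Y(1) by (auto dest: subgroup.mem_carrier)
    have "subgroup (K <#> Y) G"
    proof (rule subgroupI)
      show "K <#> Y \<subseteq> carrier G" using c by (auto simp: set_mult_def)
      show "K <#> Y \<noteq> {}" using K(1) Y(3) by (auto simp: set_mult_def dest: subgroup.one_closed)
      show "inv a \<in> K <#> Y" if a: "a \<in> K <#> Y" for a
      proof -
        obtain k y where *: "k \<in> K" "y \<in> Y" "a = k \<otimes> y" using a by (auto simp: set_mult_def)
        then have "inv a = inv k \<otimes> inv y" using c comm by (simp add: inv_mult_group)
        moreover have "inv k \<in> K" "inv y \<in> Y" using * K(1) Y(1) by (auto simp: subgroup.m_inv_closed)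
        ultimately show ?thesis by (auto simp: set_mult_def)
      qed
      show "a \<otimes> b \<in> K <#> Y" if ab: "a \<in> K <#> Y" "b \<in> K <#> Y" for a b
      proof -
        obtain k y k' y' where *: "k \<in> K" "y \<in> Y" "a = k \<otimes> y" "k' \<in> K" "y' \<in> Y" "b = k' \<otimes> y'"
          using ab by (auto simp: set_mult_def)
        have cs: "k \<in> carrier G" "y \<in> carrier G" "k' \<in> carrier G" "y' \<in> carrier G" using * c by auto
        have "a \<otimes> b = k \<otimes> (y \<otimes> k') \<otimes> y'" using * cs by (simp add: m_assoc)
        also have "\<dots> = k \<otimes> (k' \<otimes> y) \<otimes> y'" using comm[OF cs(2,3)] by simp
        also have "\<dots> = (k \<otimes> k') \<otimes> (y \<otimes> y')" using cs by (simp add: m_assoc)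
        finally have "a \<otimes> b = (k \<otimes> k') \<otimes> (y \<otimes> y')" .
        moreover have "k \<otimes> k' \<in> K" "y \<otimes> y' \<in> Y" using * K(1) Y(1) by (auto simp: subgroup.m_closed)
        ultimately show ?thesis by (auto simp: set_mult_def)
      qed
    qed
    moreover have "finite (K <#> Y)" using K(2) Y(2) by (simp add: set_mult_def)
    moreover have "K \<subseteq> K <#> Y"
    proof
      fix k assume k: "k \<in> K"
      then have "k = k \<otimes> \<one>" using c by simp
      then show "k \<in> K <#> Y" using k subgroup.one_closed[OF Y(1)] unfolding set_mult_def by blast
    qed
    ultimately have "- (K <#> Y) = - K" using Cmin[of "- (K <#> Y)"] K(3) by blast
    moreover have "y \<in> K <#> Y"
    proof -
      have "y = \<one> \<otimes> y" using y by simp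
      then show ?thesis using Y(3) subgroup.one_closed[OF K(1)] unfolding set_mult_def by blast
    qed
    ultimately show False using y(2) by blast
  next
    case True
    have "Z \<lhd> G"
    proof (rule normal_invI[OF Z])
      fix g h assume g: "g \<in> carrier G" and "h \<in> Z"
      then have h: "h \<in> carrier G" "g \<otimes> h = h \<otimes> g" unfolding Z_def by auto
      then have "g \<otimes> h \<otimes> inv g = h" using g by (simp add: m_assoc)
      then show "g \<otimes> h \<otimes> inv g \<in> Z" using \<open>h \<in> Z\<close> by simp
    qed
    then interpret N: normal Z G .
    define Q where "Q = G Mod Z"
    define \<pi> where "\<pi> = (\<lambda>g. Z #> g)"
    interpret Q: group Q unfolding Q_def by (rule N.factorgroup_is_group)
    interpret \<pi>: group_hom G Q \<pi>
      by unfold_locales (use N.r_coset_hom_Mod in \<open>simp add: Q_def \<pi>_def\<close>)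
    have surj: "\<pi> ` carrier G = carrier Q" by (auto simp: Q_def \<pi>_def carrier_FactGroup)
    have dccQ: "group_ring_dcc p Q" using group_ring_dcc_image[OF \<pi>.group_hom_axioms surj dcc] .
    have mem: "h \<in> \<pi> g" if "\<pi> h = \<pi> g" "h \<in> carrier G" for g h
      using that rcos_self[OF _ Z] by (auto simp: \<pi>_def)
    have fin\<pi>: "finite (\<pi> g)" if "g \<in> carrier G" for g
      using True by (simp add: \<pi>_def r_coset_def)
    have "finite (carrier Q)"
    proof (rule Q.group_ring_dcc_centralizers[OF dccQ p])
      fix c assume c: "c \<in> carrier Q" "c \<noteq> \<one>\<^bsub>Q\<^esub>"
      then obtain x where x: "x \<in> carrier G" "c = \<pi> x" using surj by blast
      have xZ: "x \<notin> Z" using c x N.rcos_const[OF group_axioms] by (auto simp: Q_def \<pi>_def)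
      let ?P = "{g \<in> carrier G. \<pi> g \<in> {d \<in> carrier Q. d \<otimes>\<^bsub>Q\<^esub> c = c \<otimes>\<^bsub>Q\<^esub> d}}"
      have P: "subgroup ?P G" by (rule subgroup_vimage[OF \<pi>.group_hom_axioms Q.subgroup_centralizer[OF c(1)]])
      \<comment> \<open>Otherwise \<open>?P\<close> is the whole group, so all conjugates of
        \<open>x\<close> lie in the coset of \<open>x\<close> modulo \<open>Z\<close>. That coset is
        finite, so one conjugate arises from infinitely many elements, which makes the centralizer
        of \<open>x\<close> infinite. The centralizer is then everything and \<open>x\<close> is
        central, although its coset is not trivial.\<close>
      have "finite ?P"
      proof (rule ccontr)
        assume "infinite ?P"
        then have PG: "?P = carrier G" using min[OF P] by simp
        have "inv g \<otimes> x \<otimes> g \<in> \<pi> x" if g: "g \<in> carrier G" for g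
        proof (rule mem)
          have "\<pi> g \<otimes>\<^bsub>Q\<^esub> c = c \<otimes>\<^bsub>Q\<^esub> \<pi> g" using g PG by blast
          then show "\<pi> (inv g \<otimes> x \<otimes> g) = \<pi> x"
            using g x c by (simp add: Q.m_assoc) (metis Q.inv_solve_left \<pi>.hom_closed Q.m_closed)
        qed (use g x in simp)
        then have "carrier G \<subseteq> (\<Union>d\<in>\<pi> x. {h \<in> carrier G. inv h \<otimes> x \<otimes> h = d})" by blast
        then have "\<exists>d\<in>\<pi> x. infinite {h \<in> carrier G. inv h \<otimes> x \<otimes> h = d}"
          using inf fin\<pi>[OF x(1)] by (meson finite_UN finite_subset)
        then have "infinite {g \<in> carrier G. g \<otimes> x = x \<otimes> g}"
          using finite_conjugators[OF x(1)] by blast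
        then have eq: "{g \<in> carrier G. g \<otimes> x = x \<otimes> g} = carrier G"
          using min[OF subgroup_centralizer[OF x(1)]] by blast
        have "x \<otimes> g = g \<otimes> x" if "g \<in> carrier G" for g
        proof -
          have "g \<in> {g \<in> carrier G. g \<otimes> x = x \<otimes> g}" unfolding eq by (rule that)
          then show ?thesis by simp
        qed
        then have "x \<in> Z" unfolding Z_def using x(1) by blast
        then show False using xZ by blast
      qed
      moreover have "d \<in> \<pi> ` ?P" if d: "d \<in> carrier Q" "d \<otimes>\<^bsub>Q\<^esub> c = c \<otimes>\<^bsub>Q\<^esub> d" for d
      proof -
        obtain g where g: "g \<in> carrier G" "d = \<pi> g" using d(1) surj by blast
        then have "g \<in> ?P" using d by simp
        then show ?thesis unfolding g(2) by (rule imageI)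
      qed
      then have "{d \<in> carrier Q. d \<otimes>\<^bsub>Q\<^esub> c = c \<otimes>\<^bsub>Q\<^esub> d} \<subseteq> \<pi> ` ?P" by auto
      ultimately show "finite {d \<in> carrier Q. d \<otimes>\<^bsub>Q\<^esub> c = c \<otimes>\<^bsub>Q\<^esub> d}"
        by (meson finite_imageI finite_subset)
    qed
    moreover have "carrier G \<subseteq> \<Union>(carrier Q)" using surj mem by blast
    moreover have "finite c" if c: "c \<in> carrier Q" for c
    proof -
      obtain x where "x \<in> carrier G" "c = \<pi> x" using c surj by blast
      then show ?thesis using fin\<pi> by simp
    qed
    ultimately show False using inf by (meson finite_Union finite_subset)
  qed
qed

lemma group_ring_dcc_finite:
  assumes dcc: "group_ring_dcc p G" and p: "prime_modulus p"
  shows "finite (carrier G)"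
proof (rule ccontr)
  assume inf: "infinite (carrier G)"
  obtain H where H: "subgroup H G \<and> infinite H"
    and min: "\<And>K. \<lbrakk>subgroup K G \<and> infinite K; K \<subseteq> H\<rbrakk> \<Longrightarrow> K = H"
  proof (rule dcc_minimal[OF dcc_subgroups[OF dcc p], of "\<lambda>K. subgroup K G \<and> infinite K" "carrier G"])
    show "subgroup (carrier G) G \<and> infinite (carrier G)" using inf subgroup_self by blast
  qed auto
  interpret H: group "G\<lparr>carrier := H\<rparr>" using H by (simp add: subgroup_imp_group)
  show False
  proof (rule H.minimal_infinite_contradiction[OF group_ring_dcc_subgroup[OF dcc] p])
    show "subgroup H G" using H by simp
    show "infinite (carrier (G\<lparr>carrier := H\<rparr>))" using H by simp
    show "K = carrier (G\<lparr>carrier := H\<rparr>)" if "subgroup K (G\<lparr>carrier := H\<rparr>)" "infinite K" for K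
      using that H min incl_subgroup subgroup.subset by fastforce
  qed
qed

end

section \<open>Rings without unit\<close>

lemma left_artinian_iff_dcc: "left_artinian R \<longleftrightarrow> dcc {I. left_ideal I R}"
  and right_artinian_iff_dcc: "right_artinian R \<longleftrightarrow> dcc {I. right_ideal I R}"
  by (simp_all add: left_artinian_def right_artinian_def dcc_def)

lemma (in abelian_group) additive_subgroup_iff:
  "additive_subgroup I G \<longleftrightarrow> I \<subseteq> carrier G \<and> \<zero> \<in> I \<and>
    (\<forall>a\<in>I. \<forall>b\<in>I. a \<oplus> b \<in> I) \<and> (\<forall>a\<in>I. \<ominus> a \<in> I)"
proof
  assume "additive_subgroup I G"
  then interpret I: additive_subgroup I G .
  show "I \<subseteq> carrier G \<and> \<zero> \<in> I \<and> (\<forall>a\<in>I. \<forall>b\<in>I. a \<oplus> b \<in> I) \<and> (\<forall>a\<in>I. \<ominus> a \<in> I)"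
    using I.a_subset by simp
next
  assume I: "I \<subseteq> carrier G \<and> \<zero> \<in> I \<and> (\<forall>a\<in>I. \<forall>b\<in>I. a \<oplus> b \<in> I) \<and> (\<forall>a\<in>I. \<ominus> a \<in> I)"
  show "additive_subgroup I G"
  proof (rule additive_subgroup.intro, rule add.subgroupI)
    show "\<ominus> a \<in> I" if "a \<in> I" for a using I that by blast
    show "a \<oplus> b \<in> I" if "a \<in> I" "b \<in> I" for a b using I that by blast
  qed (use I in auto)
qed

section \<open>Saturated subgroups and additive functionals\<close>

context abelian_group
begin

text \<open>The quotient by \<open>M\<close> is a vector space over the prime field if
  \<open>p\<close> is prime, and torsion-free if \<open>p = 0\<close>. In both cases it embeds into
  a vector space over the prime field.\<close>

definition saturated_subgroup :: "int \<Rightarrow> 'a set \<Rightarrow> bool" where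
  "saturated_subgroup p M \<longleftrightarrow> additive_subgroup M G \<and> (\<forall>a\<in>carrier G. [p] \<cdot> a \<in> M) \<and>
    (\<forall>n. \<forall>a\<in>carrier G. \<not> p dvd n \<and> [n] \<cdot> a \<in> M \<longrightarrow> a \<in> M)"

definition saturation :: "int \<Rightarrow> 'a set \<Rightarrow> 'a set" where
  "saturation p N = {a. a \<in> carrier G \<and> (\<exists>n. \<not> p dvd n \<and> [n] \<cdot> a \<in> N)}"

lemma additive_subgroup_int_pow:
  "\<lbrakk>additive_subgroup N G; a \<in> N\<rbrakk> \<Longrightarrow> [(n::int)] \<cdot> a \<in> N"
  using add.subgroup_int_pow_closed additive_subgroup.a_subgroup by blast

lemma int_pow_zero [simp]: "[(0::int)] \<cdot> a = \<zero>"
  by (simp add: add_pow_int_ge)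

lemma saturated_saturation:
  assumes p: "prime_modulus p" and N: "additive_subgroup N G" and pN: "\<And>a. a \<in> carrier G \<Longrightarrow> [p] \<cdot> a \<in> N"
  shows "saturated_subgroup p (saturation p N)" "N \<subseteq> saturation p N"
proof -
  have N': "N \<subseteq> carrier G" "\<zero> \<in> N" "\<And>a b. \<lbrakk>a \<in> N; b \<in> N\<rbrakk> \<Longrightarrow> a \<oplus> b \<in> N" "\<And>a. a \<in> N \<Longrightarrow> \<ominus> a \<in> N"
    using N unfolding additive_subgroup_iff by blast+
  have p1: "\<not> p dvd 1" using p by (simp add: prime_modulus_def)
  show sub: "N \<subseteq> saturation p N"
  proof
    fix a assume a: "a \<in> N"
    then have "[(1::int)] \<cdot> a \<in> N" using N' by auto
    then show "a \<in> saturation p N" using p1 a N' unfolding saturation_def by blast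
  qed
  show "saturated_subgroup p (saturation p N)"
    unfolding saturated_subgroup_def additive_subgroup_iff
  proof (intro conjI ballI allI impI)
    show "saturation p N \<subseteq> carrier G" by (auto simp: saturation_def)
    show "\<zero> \<in> saturation p N" using sub N' by blast
    show "[p] \<cdot> a \<in> saturation p N" if "a \<in> carrier G" for a using sub pN that by blast
    show "a \<in> saturation p N" if a: "a \<in> carrier G" "\<not> p dvd n \<and> [n] \<cdot> a \<in> saturation p N" for n a
    proof -
      obtain m where "\<not> p dvd m" "[m] \<cdot> ([n] \<cdot> a) \<in> N" using a unfolding saturation_def by blast
      then have "[(n * m)] \<cdot> a \<in> N" "\<not> p dvd n * m"
        using a(1) add.int_pow_pow[OF a(1), of m n] prime_modulusD[OF p, of n m] a(2) by auto
      then show ?thesis using a(1) unfolding saturation_def by blast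
    qed
    show "\<ominus> a \<in> saturation p N" if "a \<in> saturation p N" for a
      using that N' add.int_pow_inv[of a] unfolding saturation_def by auto
    show "a \<oplus> b \<in> saturation p N" if ab: "a \<in> saturation p N" "b \<in> saturation p N" for a b
    proof -
      obtain n m where *: "a \<in> carrier G" "b \<in> carrier G" "\<not> p dvd n" "\<not> p dvd m" "[n] \<cdot> a \<in> N" "[m] \<cdot> b \<in> N"
        using ab unfolding saturation_def by blast
      have "[m] \<cdot> ([n] \<cdot> a) \<in> N" "[n] \<cdot> ([m] \<cdot> b) \<in> N"
        using additive_subgroup_int_pow[OF N] * by blast+
      then have "[(n * m)] \<cdot> a \<oplus> [(n * m)] \<cdot> b \<in> N"
        using add.int_pow_pow[OF *(1), of m n] add.int_pow_pow[OF *(2), of n m] N'(3) by (simp add: mult.commute)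
      then have "[(n * m)] \<cdot> (a \<oplus> b) \<in> N" using add.int_pow_distrib[of a b "n * m"] * by simp
      moreover have "\<not> p dvd n * m" using * prime_modulusD[OF p] by blast
      ultimately show ?thesis using * unfolding saturation_def by blast
    qed
  qed
qed

text \<open>
  For \<open>M\<close> maximal by Zorn's lemma, every element is a fraction \<open>m/n\<close> of \<open>e\<close> modulo \<open>M\<close>, so that \<open>M\<close> is
  the kernel of an additive functional with values in the prime field of characteristic \<open>p\<close>.
\<close>

lemma exists_functional_kernel:
  assumes p: "prime_modulus p" and e: "e \<in> carrier G"
    and nd: "\<And>n a. \<lbrakk>a \<in> carrier G; \<not> p dvd n\<rbrakk> \<Longrightarrow> [n] \<cdot> e \<noteq> [p] \<cdot> a"
  obtains M where "saturated_subgroup p M" "e \<notin> M"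
    "\<And>b. b \<in> carrier G \<Longrightarrow> \<exists>n m. \<not> p dvd n \<and> [n] \<cdot> b \<ominus> [(m::int)] \<cdot> e \<in> M"
proof -
  let ?A = "{M. saturated_subgroup p M \<and> e \<notin> M}"
  let ?N = "(\<lambda>a. [p] \<cdot> a) ` carrier G"
  have N: "additive_subgroup ?N G"
    unfolding additive_subgroup_iff
  proof (intro conjI ballI)
    show "?N \<subseteq> carrier G" by auto
    show "\<zero> \<in> ?N" using add.int_pow_one by (intro image_eqI[of _ _ \<zero>]) auto
    show "a \<oplus> b \<in> ?N" if "a \<in> ?N" "b \<in> ?N" for a b
      using that by (auto simp: add.int_pow_distrib[symmetric])
    show "\<ominus> a \<in> ?N" if "a \<in> ?N" for a using that by (auto simp: add.int_pow_inv[symmetric])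
  qed
  \<comment> \<open>Every saturated subgroup contains the saturation of the
    \<open>p\<close>-multiples, so this one is the smallest candidate. The hypothesis
    \<open>nd\<close> says that it misses \<open>e\<close>, which gives Zorn's lemma a starting
    point.\<close>
  have "e \<notin> saturation p ?N" using nd unfolding saturation_def by blast
  then have "?A \<noteq> {}" using saturated_saturation[OF p N] by blast
  moreover have "\<Union>\<C> \<in> ?A" if C: "\<C> \<noteq> {}" "subset.chain ?A \<C>" for \<C>
  proof -
    have sat: "saturated_subgroup p M" "e \<notin> M" if "M \<in> \<C>" for M
      using C(2) that unfolding subset.chain_def by blast+
    then have sub: "M \<subseteq> carrier G" "\<zero> \<in> M" "\<And>a b. \<lbrakk>a \<in> M; b \<in> M\<rbrakk> \<Longrightarrow> a \<oplus> b \<in> M" "\<And>a. a \<in> M \<Longrightarrow> \<ominus> a \<in> M"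
      if "M \<in> \<C>" for M
      using that unfolding saturated_subgroup_def additive_subgroup_iff by blast+
    have "saturated_subgroup p (\<Union>\<C>)"
      unfolding saturated_subgroup_def additive_subgroup_iff
    proof (intro conjI ballI allI impI)
      show "\<Union>\<C> \<subseteq> carrier G" using sub by blast
      show "\<zero> \<in> \<Union>\<C>" using sub C(1) by blast
      show "\<ominus> a \<in> \<Union>\<C>" if "a \<in> \<Union>\<C>" for a using sub that by blast
      show "[p] \<cdot> a \<in> \<Union>\<C>" if "a \<in> carrier G" for a
        using sat that C(1) unfolding saturated_subgroup_def by blast
      show "a \<in> \<Union>\<C>" if "a \<in> carrier G" "\<not> p dvd n \<and> [n] \<cdot> a \<in> \<Union>\<C>" for n a
        using sat that unfolding saturated_subgroup_def by blast
      show "a \<oplus> b \<in> \<Union>\<C>" if ab: "a \<in> \<Union>\<C>" "b \<in> \<Union>\<C>" for a b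
      proof -
        obtain M M' where M: "a \<in> M" "M \<in> \<C>" "b \<in> M'" "M' \<in> \<C>" using ab by blast
        then have "M \<subseteq> M' \<or> M' \<subseteq> M" using C(2) unfolding subset.chain_def by blast
        then show ?thesis using M sub(3) by blast
      qed
    qed
    then show ?thesis using sat by blast
  qed
  ultimately obtain M where M: "saturated_subgroup p M" "e \<notin> M"
    and max: "\<And>M'. \<lbrakk>saturated_subgroup p M'; e \<notin> M'; M \<subseteq> M'\<rbrakk> \<Longrightarrow> M' = M"
    using subset_Zorn_nonempty[of ?A] by blast
  have sub: "M \<subseteq> carrier G" "\<zero> \<in> M" "\<And>a b. \<lbrakk>a \<in> M; b \<in> M\<rbrakk> \<Longrightarrow> a \<oplus> b \<in> M" "\<And>a. a \<in> M \<Longrightarrow> \<ominus> a \<in> M"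
    using M(1) unfolding saturated_subgroup_def additive_subgroup_iff by blast+
  have pM: "[p] \<cdot> a \<in> M" if "a \<in> carrier G" for a using M(1) that unfolding saturated_subgroup_def by blast
  have "\<exists>n m. \<not> p dvd n \<and> [n] \<cdot> b \<ominus> [(m::int)] \<cdot> e \<in> M" if b: "b \<in> carrier G" for b
  proof (cases "b \<in> M")
    case True
    have "\<not> p dvd 1" using p by (simp add: prime_modulus_def)
    moreover have "[(1::int)] \<cdot> b \<ominus> [(0::int)] \<cdot> e \<in> M"
    proof -
      have z: "\<ominus> \<zero> = \<zero>" by (rule minus_equality) simp_all
      show ?thesis unfolding minus_eq int_pow_zero z using b True by simp
    qed
    ultimately show ?thesis by - (rule exI[of _ 1], rule exI[of _ 0], rule conjI)
  next
    case False
    let ?N = "{m \<oplus> [(k::int)] \<cdot> b | m k. m \<in> M}"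
    have MN: "M \<subseteq> ?N"
    proof
      fix m assume m: "m \<in> M"
      then have "m = m \<oplus> [(0::int)] \<cdot> b" using sub(1) b by auto
      then show "m \<in> ?N" using m by blast
    qed
    have N: "additive_subgroup ?N G"
      unfolding additive_subgroup_iff
    proof (intro conjI ballI)
      show "?N \<subseteq> carrier G" using sub(1) b by auto
      show "\<zero> \<in> ?N" using MN sub(2) by blast
      show "x \<oplus> y \<in> ?N" if xy: "x \<in> ?N" "y \<in> ?N" for x y
      proof -
        obtain m m' and k k' :: int where *: "m \<in> M" "m' \<in> M" "x = m \<oplus> [k] \<cdot> b" "y = m' \<oplus> [k'] \<cdot> b"
          using xy by blast
        then have c: "m \<in> carrier G" "m' \<in> carrier G" using sub(1) by auto
        have "x \<oplus> y = (m \<oplus> m') \<oplus> [(k + k')] \<cdot> b"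
          using c b * by (simp add: add.int_pow_mult a_ac)
        then show ?thesis using sub(3)[OF *(1,2)] by blast
      qed
      show "\<ominus> x \<in> ?N" if x: "x \<in> ?N" for x
      proof -
        obtain m and k :: int where *: "m \<in> M" "x = m \<oplus> [k] \<cdot> b" using x by blast
        then have c: "m \<in> carrier G" using sub(1) by auto
        have "\<ominus> x = \<ominus> m \<oplus> [(- k)] \<cdot> b"
          using c b * by (simp add: add.int_pow_neg minus_add)
        then show ?thesis using sub(4)[OF *(1)] by blast
      qed
    qed
    have pN: "[p] \<cdot> a \<in> ?N" if "a \<in> carrier G" for a using pM[OF that] MN by blast
    have "b \<in> ?N"
    proof -
      have "b = \<zero> \<oplus> [(1::int)] \<cdot> b" using b by simp
      then show ?thesis using sub(2) by blast
    qed
    then have "b \<in> saturation p ?N" "M \<subseteq> saturation p ?N"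
      using saturated_saturation(2)[OF p N pN] MN by blast+
    \<comment> \<open>Maximality of \<open>M\<close> turns \<open>b \<notin> M\<close> into a
      relation \<open>[n] \<cdot> e = m \<oplus> [k] \<cdot> b\<close> with \<open>m\<close> in
      \<open>M\<close>. Read backwards, it presents \<open>b\<close> as the fraction
      \<open>n/k\<close> of \<open>e\<close>. The denominator is legitimate: if \<open>p\<close>
      divided \<open>k\<close>, then \<open>[k] \<cdot> b\<close> and hence
      \<open>[n] \<cdot> e\<close> would lie in \<open>M\<close>, and so would
      \<open>e\<close>.\<close>
    then have "e \<in> saturation p ?N"
      using max[OF saturated_saturation(1)[OF p N pN]] False by blast
    then obtain n m and k :: int where *: "\<not> p dvd n" "m \<in> M" "[n] \<cdot> e = m \<oplus> [k] \<cdot> b"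
      unfolding saturation_def by blast
    have mc: "m \<in> carrier G" using * sub(1) by auto
    have "\<not> p dvd k"
    proof
      assume "p dvd k"
      then obtain j where "k = j * p" by (metis dvdE mult.commute)
      then have "[k] \<cdot> b \<in> M" using pM[of "[j] \<cdot> b"] add.int_pow_pow[OF b, of p j] b by simp
      then have "[n] \<cdot> e \<in> M" using *(2,3) sub(3) by simp
      then show False using M *(1) e unfolding saturated_subgroup_def by blast
    qed
    moreover have "[k] \<cdot> b \<ominus> [n] \<cdot> e = \<ominus> m"
    proof -
      have kb: "[k] \<cdot> b \<in> carrier G" using b by simp
      have "[k] \<cdot> b \<ominus> (m \<oplus> [k] \<cdot> b) = [k] \<cdot> b \<oplus> (\<ominus> ([k] \<cdot> b) \<oplus> \<ominus> m)"
        using mc kb by (simp add: minus_eq minus_add a_comm)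
      also have "\<dots> = \<ominus> m" using mc kb by (simp add: a_assoc[symmetric] r_neg)
      finally show ?thesis using *(3) by simp
    qed
    ultimately show ?thesis using sub(4)[OF *(2)] by - (rule exI[of _ k], rule exI[of _ n], simp)
  qed
  then show ?thesis using that M by blast
qed

end

section \<open>Arithmetic without an identity and the choice of the characteristic\<close>

context rng
begin

lemma zero_mult:
  assumes "a \<in> carrier R"
  shows "\<zero> \<otimes> a = \<zero>" "a \<otimes> \<zero> = \<zero>"
proof -
  have c: "\<zero> \<otimes> a \<in> carrier R" "a \<otimes> \<zero> \<in> carrier R" using assms m_closed by simp_all
  have "\<zero> \<otimes> a = \<zero> \<otimes> a \<oplus> \<zero> \<otimes> a" using l_distr[of \<zero> \<zero> a] assms by simp
  then show "\<zero> \<otimes> a = \<zero>" using c by simp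
  have "a \<otimes> \<zero> = a \<otimes> \<zero> \<oplus> a \<otimes> \<zero>" using r_distr[of \<zero> \<zero> a] assms by simp
  then show "a \<otimes> \<zero> = \<zero>" using c by simp
qed

lemma uminus_mult:
  assumes "a \<in> carrier R" "b \<in> carrier R"
  shows "(\<ominus> a) \<otimes> b = \<ominus> (a \<otimes> b)" "a \<otimes> (\<ominus> b) = \<ominus> (a \<otimes> b)"
proof -
  have c: "a \<otimes> b \<in> carrier R" "(\<ominus> a) \<otimes> b \<in> carrier R" "a \<otimes> (\<ominus> b) \<in> carrier R"
    using assms m_closed by simp_all
  have "(\<ominus> a) \<otimes> b \<oplus> a \<otimes> b = \<zero>" using l_distr[of "\<ominus> a" a b] assms by (simp add: l_neg zero_mult)
  from minus_equality[OF this c(1,2)] show "(\<ominus> a) \<otimes> b = \<ominus> (a \<otimes> b)" by (rule sym)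
  have "a \<otimes> (\<ominus> b) \<oplus> a \<otimes> b = \<zero>" using r_distr[of "\<ominus> b" b a] assms by (simp add: l_neg zero_mult)
  from minus_equality[OF this c(1,3)] show "a \<otimes> (\<ominus> b) = \<ominus> (a \<otimes> b)" by (rule sym)
qed

lemma int_pow_mult_right:
  assumes a: "a \<in> carrier R" and b: "b \<in> carrier R"
  shows "a \<otimes> [(n::int)] \<cdot> b = [n] \<cdot> (a \<otimes> b)"
proof (induction n rule: int_induct[where k = 0])
  case base then show ?case using a by (simp add: zero_mult)
next
  case (step1 i)
  then show ?case using a b m_closed by (simp add: add.int_pow_mult r_distr)
next
  case (step2 i)
  then show ?case using a b m_closed by (simp add: add.int_pow_diff r_distr uminus_mult)
qed

lemma int_pow_mult_left:
  assumes a: "a \<in> carrier R" and b: "b \<in> carrier R"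
  shows "[(n::int)] \<cdot> a \<otimes> b = [n] \<cdot> (a \<otimes> b)"
proof (induction n rule: int_induct[where k = 0])
  case base then show ?case using b by (simp add: zero_mult)
next
  case (step1 i)
  then show ?case using a b m_closed by (simp add: add.int_pow_mult l_distr)
next
  case (step2 i)
  then show ?case using a b m_closed by (simp add: add.int_pow_diff l_distr uminus_mult)
qed

text \<open>The characteristic is \<open>0\<close> if \<open>e\<close> has infinite additive order,
  and otherwise a prime q dividing its order o = q t. If n e = q a, then left multiplication by
  \<open>e\<close> replaces a by e a, which is annihilated by o because o e = 0. Multiplying by t
  gives n t e = 0, so q t divides n t and q divides n.\<close>

lemma exists_prime_modulus:
  assumes e: "e \<in> carrier R" "e \<otimes> e = e" "e \<noteq> \<zero>"
  obtains p where "prime_modulus p" "\<And>n a. \<lbrakk>a \<in> carrier R; \<not> p dvd n\<rbrakk> \<Longrightarrow> [n] \<cdot> e \<noteq> [p] \<cdot> a"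
proof (cases "add.ord e = 0")
  case True
  have "prime_modulus 0" by (simp add: prime_modulus_def)
  moreover have "[n] \<cdot> e \<noteq> [(0::int)] \<cdot> a" if "a \<in> carrier R" "\<not> 0 dvd n" for n :: int and a
    using add.int_pow_eq_id[OF e(1), of n] True that by simp
  ultimately show ?thesis using that by blast
next
  case False
  let ?o = "add.ord e"
  have "?o \<noteq> 1" using add.int_pow_eq_id[OF e(1), of 1] e by simp
  then obtain q where q: "Factorial_Ring.prime q" "q dvd ?o" using prime_factor_nat by blast
  then obtain t where t: "?o = q * t" by blast
  have "t \<noteq> 0" using t False by auto
  have "Factorial_Ring.prime (int q)" using q(1) by simp
  then have "prime_modulus (int q)"
    unfolding prime_modulus_def using not_prime_unit prime_dvd_multD by blast
  moreover have "[n] \<cdot> e \<noteq> [(int q)] \<cdot> a" if a: "a \<in> carrier R" and n: "\<not> int q dvd n" for n :: int and a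
  proof
    assume eq: "[n] \<cdot> e = [(int q)] \<cdot> a"
    have ae: "e \<otimes> a \<in> carrier R" using e a m_closed by simp
    have "[n] \<cdot> e = e \<otimes> [n] \<cdot> e" using e by (simp add: int_pow_mult_right)
    also have "\<dots> = [(int q)] \<cdot> (e \<otimes> a)" unfolding eq using e a by (simp add: int_pow_mult_right)
    finally have "[(int t)] \<cdot> ([n] \<cdot> e) = [(int t)] \<cdot> ([(int q)] \<cdot> (e \<otimes> a))" by simp
    then have "[(n * int t)] \<cdot> e = [(int ?o)] \<cdot> (e \<otimes> a)"
      using e ae by (simp add: add.int_pow_pow t)
    also have "\<dots> = [(int ?o)] \<cdot> e \<otimes> a" using e a by (simp add: int_pow_mult_left)
    also have "[(int ?o)] \<cdot> e = \<zero>" using add.int_pow_eq_id[OF e(1)] by simp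
    finally have "[(n * int t)] \<cdot> e = \<zero>" using a by (simp add: zero_mult)
    then have "int q * int t dvd n * int t" using add.int_pow_eq_id[OF e(1), of "n * int t"] t by simp
    then show False using n \<open>t \<noteq> 0\<close> by simp
  qed
  ultimately show ?thesis using that by blast
qed

end

context abelian_group
begin

lemma uminus_zero: "\<ominus> \<zero> = \<zero>"
  by (rule minus_equality) simp_all

text \<open>
  Modulo \<open>M\<close>, the element \<open>b\<close> is the fraction \<open>m/n\<close> of \<open>e\<close>.
\<close>

definition fraction_of :: "'a set \<Rightarrow> 'a \<Rightarrow> 'a \<Rightarrow> int \<Rightarrow> int \<Rightarrow> bool" where
  "fraction_of M e b n m \<longleftrightarrow> [n] \<cdot> b \<ominus> [m] \<cdot> e \<in> M"

context
  fixes p M e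
  assumes M: "saturated_subgroup p M" and e: "e \<in> carrier G"
begin

lemma saturated_subgroupD:
  shows "M \<subseteq> carrier G" "\<zero> \<in> M" "\<And>a b. \<lbrakk>a \<in> M; b \<in> M\<rbrakk> \<Longrightarrow> a \<oplus> b \<in> M" "\<And>a. a \<in> M \<Longrightarrow> \<ominus> a \<in> M"
    "\<And>a (k::int). a \<in> M \<Longrightarrow> [k] \<cdot> a \<in> M"
  using M additive_subgroup_int_pow unfolding saturated_subgroup_def additive_subgroup_iff by blast+

lemma fraction_of_zero: "fraction_of M e \<zero> n 0"
  using saturated_subgroupD(2) by (simp add: fraction_of_def minus_eq uminus_zero)

lemma fraction_of_scale:
  assumes "fraction_of M e b n m" "b \<in> carrier G"
  shows "fraction_of M e ([k] \<cdot> b) n (k * m)"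
proof -
  have "[k] \<cdot> ([n] \<cdot> b \<ominus> [m] \<cdot> e) = [n] \<cdot> ([k] \<cdot> b) \<ominus> [(k * m)] \<cdot> e"
    using assms(2) e by (simp add: minus_eq add.int_pow_distrib add.int_pow_inv add.int_pow_pow mult.commute)
  then show ?thesis using saturated_subgroupD(5)[of "[n] \<cdot> b \<ominus> [m] \<cdot> e" k] assms(1)
    by (simp add: fraction_of_def)
qed

lemma fraction_of_minus:
  assumes "fraction_of M e b n m" "b \<in> carrier G"
  shows "fraction_of M e (\<ominus> b) n (- m)"
proof -
  have "[(-1::int)] \<cdot> b = \<ominus> b" using assms(2) add.int_pow_neg[of b 1] by simp
  then show ?thesis using fraction_of_scale[OF assms, of "-1"] by simp
qed

lemma fraction_of_add:
  assumes "fraction_of M e b n m" "b \<in> carrier G" "fraction_of M e c k l" "c \<in> carrier G"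
  shows "fraction_of M e (b \<oplus> c) (n * k) (k * m + n * l)"
proof -
  have cc: "[(n * k)] \<cdot> b \<in> carrier G" "[(n * k)] \<cdot> c \<in> carrier G" "[(k * m)] \<cdot> e \<in> carrier G" "[(n * l)] \<cdot> e \<in> carrier G"
    using assms e by auto
  have "[k] \<cdot> ([n] \<cdot> b \<ominus> [m] \<cdot> e) \<oplus> [n] \<cdot> ([k] \<cdot> c \<ominus> [l] \<cdot> e)
      = ([(n * k)] \<cdot> b \<oplus> \<ominus> ([(k * m)] \<cdot> e)) \<oplus> ([(n * k)] \<cdot> c \<oplus> \<ominus> ([(n * l)] \<cdot> e))"
    using assms e by (simp add: minus_eq add.int_pow_distrib add.int_pow_inv add.int_pow_pow mult.commute)
  also have "\<dots> = ([(n * k)] \<cdot> b \<oplus> [(n * k)] \<cdot> c) \<oplus> \<ominus> ([(k * m)] \<cdot> e \<oplus> [(n * l)] \<cdot> e)"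
    using cc by (simp add: minus_add a_ac)
  also have "\<dots> = [(n * k)] \<cdot> (b \<oplus> c) \<ominus> [(k * m + n * l)] \<cdot> e"
    using assms e by (simp add: minus_eq add.int_pow_distrib add.int_pow_mult)
  finally show ?thesis
    using saturated_subgroupD(3)[OF saturated_subgroupD(5) saturated_subgroupD(5)] assms
    by (metis fraction_of_def)
qed

text \<open>Uniqueness of the value of the functional: \<open>M\<close> contains no multiple of
  \<open>e\<close> by an integer that \<open>p\<close> does not divide, since saturation would then
  put \<open>e\<close> into \<open>M\<close>.\<close>

lemma fraction_of_multiple:
  assumes "fraction_of M e ([k] \<cdot> e) n m" "e \<notin> M"
  shows "p dvd n * k - m"
proof -
  have "[n] \<cdot> ([k] \<cdot> e) \<ominus> [m] \<cdot> e = [(n * k - m)] \<cdot> e"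
    using e by (simp add: minus_eq add.int_pow_pow add.int_pow_diff mult.commute)
  then have "[(n * k - m)] \<cdot> e \<in> M" using assms(1) by (simp add: fraction_of_def)
  then show ?thesis using assms(2) M e unfolding saturated_subgroup_def by blast
qed

end

end

section \<open>Primitive central idempotents\<close>

context rng
begin

definition primitive_idempotent :: "'a \<Rightarrow> bool" where
  "primitive_idempotent e \<longleftrightarrow> central_idempotent R e \<and> e \<noteq> \<zero> \<and>
    (\<forall>f. central_idempotent R f \<and> f \<noteq> \<zero> \<and> f \<otimes> e = f \<longrightarrow> f = e)"

lemma central_idempotentD:
  assumes "central_idempotent R e"
  shows "e \<in> carrier R" "e \<otimes> e = e" "a \<in> carrier R \<Longrightarrow> e \<otimes> a = a \<otimes> e"
  using assms unfolding central_idempotent_def by blast+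

lemma central_idempotent_mult:
  assumes "central_idempotent R e" "central_idempotent R f"
  shows "central_idempotent R (e \<otimes> f)"
proof -
  note e = central_idempotentD[OF assms(1)] and f = central_idempotentD[OF assms(2)]
  have "(e \<otimes> f) \<otimes> (e \<otimes> f) = e \<otimes> ((f \<otimes> e) \<otimes> f)" using e(1) f(1) m_closed by (simp add: m_assoc)
  also have "\<dots> = e \<otimes> ((e \<otimes> f) \<otimes> f)" using f(3)[OF e(1)] by simp
  also have "\<dots> = (e \<otimes> e) \<otimes> (f \<otimes> f)" using e(1) f(1) m_closed by (simp add: m_assoc)
  finally have "(e \<otimes> f) \<otimes> (e \<otimes> f) = e \<otimes> f" using e(2) f(2) by simp
  moreover have "(e \<otimes> f) \<otimes> a = a \<otimes> (e \<otimes> f)" if a: "a \<in> carrier R" for a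
  proof -
    have "(e \<otimes> f) \<otimes> a = e \<otimes> (a \<otimes> f)" using e(1) f(1) f(3)[OF a] a by (simp add: m_assoc)
    also have "\<dots> = (a \<otimes> e) \<otimes> f" using e(1) f(1) e(3)[OF a] a by (simp add: m_assoc[symmetric])
    finally show ?thesis using e(1) f(1) a by (simp add: m_assoc)
  qed
  ultimately show ?thesis using e(1) f(1) m_closed unfolding central_idempotent_def by blast
qed

lemma left_idealI:
  assumes "I \<subseteq> carrier R" "\<zero> \<in> I" "\<And>a b. \<lbrakk>a \<in> I; b \<in> I\<rbrakk> \<Longrightarrow> a \<oplus> b \<in> I" "\<And>a. a \<in> I \<Longrightarrow> \<ominus> a \<in> I"
    "\<And>a b. \<lbrakk>a \<in> carrier R; b \<in> I\<rbrakk> \<Longrightarrow> a \<otimes> b \<in> I"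
  shows "left_ideal I R"
  unfolding left_ideal_def additive_subgroup_iff using assms by blast

lemma fixed_left_ideal:
  assumes "e \<in> carrier R"
  shows "left_ideal {a. a \<in> carrier R \<and> a \<otimes> e = a} R"
  by (rule left_idealI) (use assms in \<open>auto simp: zero_mult l_distr uminus_mult m_assoc m_closed\<close>)

lemma annihilator_left_ideal:
  assumes "E \<subseteq> carrier R"
  shows "left_ideal {a. a \<in> carrier R \<and> (\<forall>e\<in>E. a \<otimes> e = \<zero>)} R"
  by (rule left_idealI)
    (use assms in \<open>auto simp: zero_mult l_distr uminus_mult m_assoc m_closed uminus_zero subset_iff\<close>)

text \<open>For central idempotents, \<open>g \<otimes> f = g\<close> means that the left ideal
  generated by \<open>g\<close> lies in that generated by \<open>f\<close>, and equality of these
  ideals forces \<open>g = f\<close>. A minimal such ideal below that of \<open>e\<close> therefore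
  gives a primitive idempotent.\<close>

lemma exists_primitive_idempotent:
  assumes art: "left_artinian R" and e: "central_idempotent R e" "e \<noteq> \<zero>"
  obtains f where "primitive_idempotent f" "f \<otimes> e = f"
proof -
  let ?J = "\<lambda>f. {a. a \<in> carrier R \<and> a \<otimes> f = a}"
  let ?P = "\<lambda>J. \<exists>f. central_idempotent R f \<and> f \<noteq> \<zero> \<and> J = ?J f"
  obtain J where "?P J" and sub: "J \<subseteq> ?J e" and min: "\<And>K. \<lbrakk>?P K; K \<subseteq> J\<rbrakk> \<Longrightarrow> K = J"
  proof (rule dcc_minimal[OF art[unfolded left_artinian_iff_dcc], of ?P "?J e"])
    show "J \<in> {I. left_ideal I R}" if "?P J" for J
      using that fixed_left_ideal central_idempotentD(1) by blast
    show "?P (?J e)" using e by blast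
  qed blast
  then obtain f where f: "central_idempotent R f" "f \<noteq> \<zero>" and J: "J = ?J f" by blast
  note fD = central_idempotentD[OF f(1)]
  have "f \<in> J" using fD(1,2) J by simp
  then have "f \<otimes> e = f" using sub by blast
  moreover have "primitive_idempotent f"
    unfolding primitive_idempotent_def
  proof (intro conjI allI impI f)
    fix g assume g: "central_idempotent R g \<and> g \<noteq> \<zero> \<and> g \<otimes> f = g"
    then have gD: "g \<in> carrier R" "g \<otimes> f = g" using central_idempotentD by auto
    have "?J g \<subseteq> J"
    proof
      fix a assume a: "a \<in> ?J g"
      then have "a \<otimes> f = (a \<otimes> g) \<otimes> f" by simp
      also have "\<dots> = a \<otimes> (g \<otimes> f)" using a gD(1) fD(1) by (intro m_assoc) auto
      finally show "a \<in> J" using a J gD(2) by simp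
    qed
    then have "?J g = J" using min[of "?J g"] g by blast
    then have "f \<otimes> g = f" using \<open>f \<in> J\<close> by blast
    then show "g = f" using gD fD(3)[OF gD(1)] by metis
  qed
  ultimately show ?thesis using that by blast
qed

lemma primitive_idempotents_orthogonal:
  assumes "primitive_idempotent e" "primitive_idempotent f" "e \<noteq> f"
  shows "e \<otimes> f = \<zero>"
proof (rule ccontr)
  assume nz: "e \<otimes> f \<noteq> \<zero>"
  have ef: "central_idempotent R e" "central_idempotent R f" using assms unfolding primitive_idempotent_def by auto
  note e = central_idempotentD[OF ef(1)] and f = central_idempotentD[OF ef(2)]
  have 1: "(e \<otimes> f) \<otimes> f = e \<otimes> f" using e(1) f(1,2) by (simp add: m_assoc)
  have "(e \<otimes> f) \<otimes> e = e \<otimes> (e \<otimes> f)" using e(1) f(1) f(3)[OF e(1)] by (simp add: m_assoc)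
  then have 2: "(e \<otimes> f) \<otimes> e = e \<otimes> f" using e(1,2) f(1) by (simp add: m_assoc[symmetric])
  show False
    using assms nz 1 2 central_idempotent_mult[OF ef] unfolding primitive_idempotent_def by metis
qed

text \<open>In an infinite sequence of distinct primitive idempotents, each one annihilates its
  predecessors but not itself, so the annihilators of the initial segments descend strictly.\<close>

lemma finite_primitive_idempotents:
  assumes art: "left_artinian R"
  shows "finite {e. primitive_idempotent e}"
proof (rule ccontr)
  assume "infinite {e. primitive_idempotent e}"
  then obtain s :: "nat \<Rightarrow> 'a" where s: "inj s" "range s \<subseteq> {e. primitive_idempotent e}"
    by (meson infinite_countable_subset)
  have prim: "primitive_idempotent (s i)" for i using s(2) by blast
  then have ci: "central_idempotent R (s i)" "s i \<noteq> \<zero>" for i unfolding primitive_idempotent_def by blast+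
  define I where "I n = {a. a \<in> carrier R \<and> (\<forall>e\<in>s ` {..<n}. a \<otimes> e = \<zero>)}" for n
  have "left_ideal (I n) R" for n
    unfolding I_def using central_idempotentD(1)[OF ci(1)] by (intro annihilator_left_ideal) blast
  moreover have "I (Suc n) \<subseteq> I n" for n by (auto simp: I_def)
  ultimately obtain N where N: "\<And>n. n \<ge> N \<Longrightarrow> I n = I N"
    using art unfolding left_artinian_def by meson
  have "s N \<otimes> s i = \<zero>" if "i < N" for i
    using primitive_idempotents_orthogonal[OF prim prim] s(1) that by (metis injD less_irrefl)
  then have "s N \<in> I N" using central_idempotentD(1)[OF ci(1)] by (auto simp: I_def)
  then have "s N \<in> I (Suc N)" using N[of "Suc N"] by simp
  then have "s N \<otimes> s N = \<zero>" by (auto simp: I_def)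
  then show False using central_idempotentD(2)[OF ci(1)[of N]] ci(2)[of N] by simp
qed

end

section \<open>Groupoids and partial actions\<close>

context groupoid
begin

lemma ginv_unique:
  assumes "g \<in> Mor G" "h \<in> Mor G" "Src G h = Tgt G g" "Tgt G h = Src G g" "Comp G h g = Src G g"
    and "k \<in> Mor G" "Src G k = Tgt G g" "Tgt G k = Src G g" "Comp G g k = Tgt G g"
  shows "h = k"
proof -
  have "h = Comp G h (Comp G g k)" using assms Comp_Src[of h] by simp
  also have "\<dots> = Comp G (Comp G h g) k" using assms by (intro Comp_assoc[symmetric]) auto
  also have "\<dots> = k" using assms Comp_Tgt[of k] by simp
  finally show ?thesis .
qed

lemma ginv:
  assumes "g \<in> Mor G"
  shows "ginv G g \<in> Mor G \<and> Src G (ginv G g) = Tgt G g \<and> Tgt G (ginv G g) = Src G g \<and>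
    Comp G (ginv G g) g = Src G g \<and> Comp G g (ginv G g) = Tgt G g"
  unfolding ginv_def
proof (rule theI')
  show "\<exists>!h. h \<in> Mor G \<and> Src G h = Tgt G g \<and> Tgt G h = Src G g \<and>
     Comp G h g = Src G g \<and> Comp G g h = Tgt G g"
  proof (rule ex_ex1I)
    show "\<exists>h. h \<in> Mor G \<and> Src G h = Tgt G g \<and> Tgt G h = Src G g \<and>
      Comp G h g = Src G g \<and> Comp G g h = Tgt G g"
      using invertible[OF assms] by blast
    fix h k assume "h \<in> Mor G \<and> Src G h = Tgt G g \<and> Tgt G h = Src G g \<and>
      Comp G h g = Src G g \<and> Comp G g h = Tgt G g"
      "k \<in> Mor G \<and> Src G k = Tgt G g \<and> Tgt G k = Src G g \<and>
      Comp G k g = Src G g \<and> Comp G g k = Tgt G g"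
    then show "h = k" by (intro ginv_unique[OF assms, of h k]) blast+
  qed
qed

lemma ginv_simps [simp]:
  assumes "g \<in> Mor G"
  shows "ginv G g \<in> Mor G" "Src G (ginv G g) = Tgt G g" "Tgt G (ginv G g) = Src G g"
    "Comp G (ginv G g) g = Src G g" "Comp G g (ginv G g) = Tgt G g"
  using ginv[OF assms] by auto

lemma ginv_eqI:
  assumes "g \<in> Mor G" "h \<in> Mor G" "Src G h = Tgt G g" "Tgt G h = Src G g" "Comp G h g = Src G g"
  shows "ginv G g = h"
  using ginv_unique[OF assms ginv_simps(1,2,3,5)[OF assms(1)]] by simp

lemma ginv_ginv [simp]:
  assumes "g \<in> Mor G"
  shows "ginv G (ginv G g) = g"
  by (rule ginv_eqI) (simp_all add: assms)

lemma Obj_Mor: "y \<in> Obj G \<Longrightarrow> y \<in> Mor G"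
  and Src_Obj [simp]: "y \<in> Obj G \<Longrightarrow> Src G y = y"
  and Tgt_Obj [simp]: "y \<in> Obj G \<Longrightarrow> Tgt G y = y"
  unfolding Obj_def by blast+

lemma Src_in_Obj [simp]: "g \<in> Mor G \<Longrightarrow> Src G g \<in> Obj G"
  and Tgt_in_Obj [simp]: "g \<in> Mor G \<Longrightarrow> Tgt G g \<in> Obj G"
  unfolding Obj_def by (simp_all add: Src_Mor Tgt_Mor Src_Src Tgt_Src Src_Tgt Tgt_Tgt)

lemma Comp_Obj_left [simp]: "\<lbrakk>y \<in> Obj G; g \<in> Mor G; Tgt G g = y\<rbrakk> \<Longrightarrow> Comp G y g = g"
  using Comp_Tgt by blast

lemma Comp_Obj_right [simp]: "\<lbrakk>y \<in> Obj G; g \<in> Mor G; Src G g = y\<rbrakk> \<Longrightarrow> Comp G g y = g"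
  using Comp_Src by blast

lemma ginv_Obj [simp]: "y \<in> Obj G \<Longrightarrow> ginv G y = y"
  by (rule ginv_eqI) (simp_all add: Obj_Mor)

lemma Comp_ginv_cancel:
  assumes "g \<in> Mor G" "h \<in> Mor G"
  shows "Src G g = Tgt G h \<Longrightarrow> Comp G (ginv G g) (Comp G g h) = h"
    and "Tgt G g = Tgt G h \<Longrightarrow> Comp G g (Comp G (ginv G g) h) = h"
    and "Src G g = Tgt G h \<Longrightarrow> Comp G (Comp G g h) (ginv G h) = g"
proof -
  show "Comp G (ginv G g) (Comp G g h) = h" if "Src G g = Tgt G h"
    using Comp_assoc[of "ginv G g" g h] assms that Comp_Tgt[of h] by simp
  show "Comp G g (Comp G (ginv G g) h) = h" if "Tgt G g = Tgt G h"
    using Comp_assoc[of g "ginv G g" h] assms that Comp_Tgt[of h] by simp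
  show "Comp G (Comp G g h) (ginv G h) = g" if "Src G g = Tgt G h"
    using Comp_assoc[of g h "ginv G h"] assms that Comp_Src[of g] by simp
qed

lemma ginv_Comp:
  assumes "g \<in> Mor G" "h \<in> Mor G" "Src G g = Tgt G h"
  shows "ginv G (Comp G g h) = Comp G (ginv G h) (ginv G g)"
proof (rule ginv_eqI)
  have "Comp G (Comp G (ginv G h) (ginv G g)) (Comp G g h) = Comp G (ginv G h) (Comp G (ginv G g) (Comp G g h))"
    using assms by (intro Comp_assoc) (auto simp: Comp_Mor Tgt_Comp)
  also have "\<dots> = Src G h" using assms by (simp add: Comp_ginv_cancel)
  finally show "Comp G (Comp G (ginv G h) (ginv G g)) (Comp G g h) = Src G (Comp G g h)"
    using assms by (simp add: Src_Comp)
qed (use assms in \<open>auto simp: Comp_Mor Src_Comp Tgt_Comp\<close>)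

end

section \<open>Identities and composition in a unital partial action\<close>

context unital_partial_action
begin

definition unit :: "'a \<Rightarrow> 'c" where
  "unit g = ideal_unit A (D g)"

text \<open>Cutting down by the identity of the domain makes \<open>\<alpha> g\<close> total,
  additive and multiplicative on A, so the product formula of the skew ring can be handled without
  domain conditions.\<close>

definition act :: "'a \<Rightarrow> 'c \<Rightarrow> 'c" where
  "act g a = \<alpha> g (a \<otimes>\<^bsub>A\<^esub> unit (ginv G g))"

lemma generates_unit:
  assumes "g \<in> Mor G"
  shows "generates_unital A (D g) (unit g)"
  unfolding unit_def ideal_unit_def
  using unital[OF assms] generates_unital_unique by (metis theI)

lemma unit_closed [simp]: "g \<in> Mor G \<Longrightarrow> unit g \<in> carrier A"
  and unit_idem [simp]: "g \<in> Mor G \<Longrightarrow> unit g \<otimes>\<^bsub>A\<^esub> unit g = unit g"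
  and unit_central: "\<lbrakk>g \<in> Mor G; a \<in> carrier A\<rbrakk> \<Longrightarrow> unit g \<otimes>\<^bsub>A\<^esub> a = a \<otimes>\<^bsub>A\<^esub> unit g"
  using generates_unit unfolding generates_unital_def central_idempotent_def by blast+

lemma D_iff:
  assumes "g \<in> Mor G"
  shows "a \<in> D g \<longleftrightarrow> a \<in> carrier A \<and> a \<otimes>\<^bsub>A\<^esub> unit g = a"
proof -
  have "D g = (\<lambda>a. a \<otimes>\<^bsub>A\<^esub> unit g) ` carrier A"
    using generates_unit[OF assms] unfolding generates_unital_def by blast
  then show ?thesis using assms by (auto simp: m_assoc m_closed image_iff) metis
qed

lemma D_carrier: "\<lbrakk>g \<in> Mor G; a \<in> D g\<rbrakk> \<Longrightarrow> a \<in> carrier A"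
  and D_unit: "\<lbrakk>g \<in> Mor G; a \<in> D g\<rbrakk> \<Longrightarrow> a \<otimes>\<^bsub>A\<^esub> unit g = a"
  by (auto simp: D_iff)

lemma unit_D [simp]: "g \<in> Mor G \<Longrightarrow> unit g \<in> D g"
  by (simp add: D_iff)

lemma D_mult_right:
  assumes "g \<in> Mor G" "a \<in> D g" "b \<in> carrier A"
  shows "a \<otimes>\<^bsub>A\<^esub> b \<in> D g"
proof -
  have a: "a \<in> carrier A" "a \<otimes>\<^bsub>A\<^esub> unit g = a" using assms D_iff by auto
  have "a \<otimes>\<^bsub>A\<^esub> b \<otimes>\<^bsub>A\<^esub> unit g = a \<otimes>\<^bsub>A\<^esub> (unit g \<otimes>\<^bsub>A\<^esub> b)"
    using a assms by (simp add: m_assoc unit_central)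
  also have "\<dots> = a \<otimes>\<^bsub>A\<^esub> unit g \<otimes>\<^bsub>A\<^esub> b" using a(1) assms by (simp add: m_assoc)
  finally show ?thesis using a assms by (simp add: D_iff m_closed)
qed

lemma D_mult_left: "\<lbrakk>g \<in> Mor G; a \<in> D g; b \<in> carrier A\<rbrakk> \<Longrightarrow> b \<otimes>\<^bsub>A\<^esub> a \<in> D g"
  by (simp add: D_iff m_closed m_assoc)

lemma zero_D [simp]: "g \<in> Mor G \<Longrightarrow> \<zero>\<^bsub>A\<^esub> \<in> D g"
  by (simp add: D_iff zero_mult)

lemma add_D: "\<lbrakk>g \<in> Mor G; a \<in> D g; b \<in> D g\<rbrakk> \<Longrightarrow> a \<oplus>\<^bsub>A\<^esub> b \<in> D g"
  by (simp add: D_iff l_distr)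

lemma minus_D: "\<lbrakk>g \<in> Mor G; a \<in> D g\<rbrakk> \<Longrightarrow> \<ominus>\<^bsub>A\<^esub> a \<in> D g"
  by (simp add: D_iff uminus_mult)

lemma alpha_bij: "g \<in> Mor G \<Longrightarrow> bij_betw (\<alpha> g) (D (ginv G g)) (D g)"
  and alpha_add: "\<lbrakk>g \<in> Mor G; a \<in> D (ginv G g); b \<in> D (ginv G g)\<rbrakk> \<Longrightarrow> \<alpha> g (a \<oplus>\<^bsub>A\<^esub> b) = \<alpha> g a \<oplus>\<^bsub>A\<^esub> \<alpha> g b"
  and alpha_mult: "\<lbrakk>g \<in> Mor G; a \<in> D (ginv G g); b \<in> D (ginv G g)\<rbrakk> \<Longrightarrow> \<alpha> g (a \<otimes>\<^bsub>A\<^esub> b) = \<alpha> g a \<otimes>\<^bsub>A\<^esub> \<alpha> g b"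
  using iso[of g] unfolding rng_iso_def by auto

lemma alpha_D: "\<lbrakk>g \<in> Mor G; a \<in> D (ginv G g)\<rbrakk> \<Longrightarrow> \<alpha> g a \<in> D g"
  using alpha_bij bij_betwE by blast

lemma alpha_ginv:
  assumes "g \<in> Mor G" "a \<in> D (ginv G g)"
  shows "\<alpha> (ginv G g) (\<alpha> g a) = a"
proof -
  have "\<alpha> g a \<in> D (ginv G (ginv G g))" using assms by (simp add: alpha_D)
  then have "a \<in> D (ginv G (Src G g)) \<and> \<alpha> (Src G g) a = \<alpha> (ginv G g) (\<alpha> g a)"
    using act_Comp[of "ginv G g" g a] assms by simp
  then show ?thesis using act_Obj[of "Src G g" a] assms by simp
qed

lemma alpha_unit:
  assumes "g \<in> Mor G"
  shows "\<alpha> g (unit (ginv G g)) = unit g"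
proof -
  obtain a where a: "a \<in> D (ginv G g)" "\<alpha> g a = unit g"
    using alpha_bij[OF assms] unit_D[OF assms] by (metis bij_betw_def imageE)
  have u: "\<alpha> g (unit (ginv G g)) \<in> D g" using assms by (simp add: alpha_D)
  have "unit g = \<alpha> g (a \<otimes>\<^bsub>A\<^esub> unit (ginv G g))" using a assms by (simp add: D_unit)
  also have "\<dots> = unit g \<otimes>\<^bsub>A\<^esub> \<alpha> g (unit (ginv G g))" using a assms by (simp add: alpha_mult)
  also have "\<dots> = \<alpha> g (unit (ginv G g))" using u assms by (simp add: unit_central D_carrier D_unit)
  finally show ?thesis by simp
qed

lemma alpha_zero [simp]:
  assumes "g \<in> Mor G"
  shows "\<alpha> g \<zero>\<^bsub>A\<^esub> = \<zero>\<^bsub>A\<^esub>"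
proof -
  have c: "\<alpha> g \<zero>\<^bsub>A\<^esub> \<in> carrier A" using alpha_D[OF assms, of "\<zero>\<^bsub>A\<^esub>"] assms D_carrier by simp
  have "\<alpha> g \<zero>\<^bsub>A\<^esub> \<oplus>\<^bsub>A\<^esub> \<alpha> g \<zero>\<^bsub>A\<^esub> = \<alpha> g \<zero>\<^bsub>A\<^esub>"
    using alpha_add[OF assms, of "\<zero>\<^bsub>A\<^esub>" "\<zero>\<^bsub>A\<^esub>"] assms by simp
  then show ?thesis using c by simp
qed

text \<open>The map \<open>\<alpha> g\<close> sends the intersection of \<open>D (ginv G g)\<close>
  and \<open>D h\<close> into that of \<open>D g\<close> and \<open>D (Comp G g h)\<close>: an
  element of \<open>D h\<close> is \<open>\<alpha> h c\<close>, and applying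
  \<open>\<alpha> g\<close> gives \<open>\<alpha> (Comp G g h) c\<close>. The same argument for
  \<open>ginv G g\<close> and \<open>Comp G g h\<close> shows that the inverse maps back. The two
  sides of the equation are the identities of these corresponding ideals.\<close>

lemma alpha_unit_unit:
  assumes g: "g \<in> Mor G" and h: "h \<in> Mor G" and gh: "Src G g = Tgt G h"
  shows "\<alpha> g (unit (ginv G g) \<otimes>\<^bsub>A\<^esub> unit h) = unit g \<otimes>\<^bsub>A\<^esub> unit (Comp G g h)"
proof -
  have maps: "\<alpha> g a \<in> D (Comp G g h)" if g: "g \<in> Mor G" and h: "h \<in> Mor G" and gh: "Src G g = Tgt G h"
    and a: "a \<in> D (ginv G g)" "a \<in> D h" for g h a
  proof -
    let ?c = "\<alpha> (ginv G h) a"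
    have c: "?c \<in> D (ginv G h)" using alpha_D[of "ginv G h" a] h a by simp
    moreover have "\<alpha> h ?c = a" using alpha_ginv[of "ginv G h" a] h a by simp
    ultimately have "?c \<in> D (ginv G (Comp G g h)) \<and> \<alpha> (Comp G g h) ?c = \<alpha> g a"
      using act_Comp[OF g h gh, of ?c] a by simp
    then show ?thesis using alpha_D[of "Comp G g h" ?c] g h gh by (simp add: Comp_Mor)
  qed
  let ?w = "\<alpha> g (unit (ginv G g) \<otimes>\<^bsub>A\<^esub> unit h)" and ?k = "Comp G g h"
  have k: "?k \<in> Mor G" using g h gh by (simp add: Comp_Mor)
  have w1: "unit (ginv G g) \<otimes>\<^bsub>A\<^esub> unit h \<in> D (ginv G g)" "unit (ginv G g) \<otimes>\<^bsub>A\<^esub> unit h \<in> D h"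
    using g h by (auto intro: D_mult_left D_mult_right)
  have wD: "?w \<in> D g" "?w \<in> D ?k" using maps[OF g h gh w1] alpha_D[OF g w1(1)] by auto
  let ?z = "unit g \<otimes>\<^bsub>A\<^esub> unit ?k"
  have z: "?z \<in> D g" "?z \<in> D ?k" using g k by (auto intro: D_mult_left D_mult_right)
  have zc: "?z \<in> carrier A" using g k m_closed by simp
  let ?y = "\<alpha> (ginv G g) ?z"
  have y: "?y \<in> D (ginv G g)" "?y \<in> D h"
    using alpha_D[of "ginv G g" ?z] maps[of "ginv G g" ?k ?z] z g h gh k
    by (auto simp: Tgt_Comp Comp_ginv_cancel)
  have yc: "?y \<in> carrier A" using y(2) h by (rule D_carrier[rotated])
  have "?y = ?y \<otimes>\<^bsub>A\<^esub> (unit (ginv G g) \<otimes>\<^bsub>A\<^esub> unit h)"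
    using y yc g h by (simp add: m_assoc[symmetric] D_unit)
  then have "\<alpha> g ?y = \<alpha> g ?y \<otimes>\<^bsub>A\<^esub> ?w" using alpha_mult[OF g y(1) w1(1)] by simp
  moreover have "\<alpha> g ?y = ?z" using alpha_ginv[of "ginv G g" ?z] z g by simp
  ultimately have "?z = ?z \<otimes>\<^bsub>A\<^esub> ?w" by simp
  also have "\<dots> = ?w \<otimes>\<^bsub>A\<^esub> unit g \<otimes>\<^bsub>A\<^esub> unit ?k"
  proof -
    have w: "?w \<in> carrier A" using wD g D_carrier by blast
    have "?z \<otimes>\<^bsub>A\<^esub> ?w = unit g \<otimes>\<^bsub>A\<^esub> (?w \<otimes>\<^bsub>A\<^esub> unit ?k)"
      using w g k by (simp add: m_assoc unit_central[of ?k ?w])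
    also have "\<dots> = ?w \<otimes>\<^bsub>A\<^esub> unit g \<otimes>\<^bsub>A\<^esub> unit ?k"
      using w g k by (simp add: m_assoc[symmetric] unit_central[of g ?w])
    finally show ?thesis .
  qed
  also have "\<dots> = ?w" using wD g k by (simp add: D_unit)
  finally show ?thesis by simp
qed

lemma unit_inverse_D: "\<lbrakk>g \<in> Mor G; a \<in> carrier A\<rbrakk> \<Longrightarrow> a \<otimes>\<^bsub>A\<^esub> unit (ginv G g) \<in> D (ginv G g)"
  by (simp add: D_mult_left)

lemma act_D: "\<lbrakk>g \<in> Mor G; a \<in> carrier A\<rbrakk> \<Longrightarrow> act g a \<in> D g"
  unfolding act_def by (simp add: alpha_D unit_inverse_D)

lemma act_closed [simp]: "\<lbrakk>g \<in> Mor G; a \<in> carrier A\<rbrakk> \<Longrightarrow> act g a \<in> carrier A"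
  using act_D D_carrier by blast

lemma act_add: "\<lbrakk>g \<in> Mor G; a \<in> carrier A; b \<in> carrier A\<rbrakk> \<Longrightarrow> act g (a \<oplus>\<^bsub>A\<^esub> b) = act g a \<oplus>\<^bsub>A\<^esub> act g b"
  unfolding act_def by (simp add: l_distr alpha_add unit_inverse_D)

lemma act_zero [simp]: "g \<in> Mor G \<Longrightarrow> act g \<zero>\<^bsub>A\<^esub> = \<zero>\<^bsub>A\<^esub>"
  unfolding act_def by (simp add: zero_mult)

lemma act_mult:
  assumes "g \<in> Mor G" "a \<in> carrier A" "b \<in> carrier A"
  shows "act g (a \<otimes>\<^bsub>A\<^esub> b) = act g a \<otimes>\<^bsub>A\<^esub> act g b"
proof -
  let ?e = "unit (ginv G g)"
  have e: "?e \<in> carrier A" using assms by simp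
  have "(a \<otimes>\<^bsub>A\<^esub> ?e) \<otimes>\<^bsub>A\<^esub> (b \<otimes>\<^bsub>A\<^esub> ?e) = a \<otimes>\<^bsub>A\<^esub> ((?e \<otimes>\<^bsub>A\<^esub> b) \<otimes>\<^bsub>A\<^esub> ?e)"
    using assms e by (simp add: m_assoc m_closed)
  also have "\<dots> = a \<otimes>\<^bsub>A\<^esub> b \<otimes>\<^bsub>A\<^esub> ?e"
    using assms e by (simp add: unit_central[of "ginv G g" b] m_assoc m_closed)
  finally show ?thesis unfolding act_def using assms by (simp add: alpha_mult[symmetric] unit_inverse_D)
qed

lemma act_alpha: "\<lbrakk>g \<in> Mor G; a \<in> D (ginv G g)\<rbrakk> \<Longrightarrow> act g a = \<alpha> g a"
  unfolding act_def by (simp add: D_unit)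

lemma act_Obj': "\<lbrakk>y \<in> Obj G; a \<in> carrier A\<rbrakk> \<Longrightarrow> act y a = a \<otimes>\<^bsub>A\<^esub> unit y"
  unfolding act_def using act_Obj[of y] by (simp add: D_mult_left Obj_Mor)

lemma act_unit:
  assumes "g \<in> Mor G" "h \<in> Mor G" "Src G g = Tgt G h"
  shows "act g (unit h) = unit g \<otimes>\<^bsub>A\<^esub> unit (Comp G g h)"
  unfolding act_def unit_central[OF assms(2) unit_closed[OF ginv_simps(1)[OF assms(1)]]]
  using alpha_unit_unit[OF assms] unit_central[of "ginv G g" "unit h"] assms by simp

text \<open>The factor \<open>unit g\<close> records that the composite may have a smaller domain
  than the action of the product. Multiplying \<open>c\<close> by the identities of both
  \<open>D (ginv G r)\<close> and \<open>D (ginv G (Comp G g r))\<close> moves it to where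
  \<open>\<alpha> g (\<alpha> r c)\<close> and \<open>\<alpha> (Comp G g r) c\<close> agree.\<close>

lemma act_act:
  assumes g: "g \<in> Mor G" and r: "r \<in> Mor G" and gr: "Src G g = Tgt G r" and c: "c \<in> carrier A"
  shows "act g (act r c) = unit g \<otimes>\<^bsub>A\<^esub> act (Comp G g r) c"
proof -
  let ?k = "Comp G g r" and ?g' = "ginv G g" and ?r' = "ginv G r"
  let ?k' = "ginv G ?k"
  have k: "?k \<in> Mor G" using g r gr by (simp add: Comp_Mor)
  have k': "?k' = Comp G ?r' ?g'" using ginv_Comp[OF g r gr] .
  have er: "\<alpha> r (unit ?r' \<otimes>\<^bsub>A\<^esub> unit ?k') = unit r \<otimes>\<^bsub>A\<^esub> unit ?g'"
    using alpha_unit_unit[OF r, of ?k'] g r gr k unfolding k'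
    by (simp add: Comp_Mor Tgt_Comp Comp_ginv_cancel)
  let ?d = "c \<otimes>\<^bsub>A\<^esub> unit ?r' \<otimes>\<^bsub>A\<^esub> unit ?k'"
  have dD: "?d \<in> D ?r'" "?d \<in> D ?k'"
    using D_mult_right[of ?r' "c \<otimes>\<^bsub>A\<^esub> unit ?r'" "unit ?k'"]
      D_mult_left[of ?k' "unit ?k'" "c \<otimes>\<^bsub>A\<^esub> unit ?r'"] D_mult_left[of ?r' "unit ?r'" c] c r k
    by (simp_all add: m_closed)
  have "act r c \<otimes>\<^bsub>A\<^esub> unit ?g' = act r c \<otimes>\<^bsub>A\<^esub> (unit r \<otimes>\<^bsub>A\<^esub> unit ?g')"
    using g r c act_D[OF r c] by (simp add: m_assoc[symmetric] D_unit)
  also have "\<dots> = \<alpha> r ((c \<otimes>\<^bsub>A\<^esub> unit ?r') \<otimes>\<^bsub>A\<^esub> (unit ?r' \<otimes>\<^bsub>A\<^esub> unit ?k'))"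
    unfolding er[symmetric] act_def using r c k by (intro alpha_mult[symmetric]) (simp_all add: D_mult_right unit_inverse_D)
  also have "(c \<otimes>\<^bsub>A\<^esub> unit ?r') \<otimes>\<^bsub>A\<^esub> (unit ?r' \<otimes>\<^bsub>A\<^esub> unit ?k') = ?d"
  proof -
    have "(c \<otimes>\<^bsub>A\<^esub> unit ?r') \<otimes>\<^bsub>A\<^esub> (unit ?r' \<otimes>\<^bsub>A\<^esub> unit ?k') = c \<otimes>\<^bsub>A\<^esub> (unit ?r' \<otimes>\<^bsub>A\<^esub> unit ?r') \<otimes>\<^bsub>A\<^esub> unit ?k'"
      using r c k by (simp add: m_assoc m_closed del: unit_idem)
    then show ?thesis using r by simp
  qed
  finally have eq: "act r c \<otimes>\<^bsub>A\<^esub> unit ?g' = \<alpha> r ?d" .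
  have "\<alpha> r ?d \<in> D ?g'" unfolding eq[symmetric] using g r c by (simp add: D_mult_left)
  then have "\<alpha> ?k ?d = \<alpha> g (\<alpha> r ?d)" using act_Comp[OF g r gr dD(1)] by blast
  then have "act g (act r c) = \<alpha> ?k ?d" unfolding act_def[of g] eq by simp
  also have "?d = (c \<otimes>\<^bsub>A\<^esub> unit ?k') \<otimes>\<^bsub>A\<^esub> (unit ?k' \<otimes>\<^bsub>A\<^esub> unit ?r')"
  proof -
    have "(c \<otimes>\<^bsub>A\<^esub> unit ?k') \<otimes>\<^bsub>A\<^esub> (unit ?k' \<otimes>\<^bsub>A\<^esub> unit ?r') = c \<otimes>\<^bsub>A\<^esub> (unit ?k' \<otimes>\<^bsub>A\<^esub> unit ?k') \<otimes>\<^bsub>A\<^esub> unit ?r'"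
      using r c k by (simp add: m_assoc m_closed del: unit_idem)
    then show ?thesis using r k c by (simp add: m_assoc m_closed unit_central[of ?k' "unit ?r'"])
  qed
  also have "\<alpha> ?k \<dots> = act ?k c \<otimes>\<^bsub>A\<^esub> \<alpha> ?k (unit ?k' \<otimes>\<^bsub>A\<^esub> unit ?r')"
    unfolding act_def using r c k by (intro alpha_mult) (simp_all add: D_mult_right unit_inverse_D)
  also have "\<alpha> ?k (unit ?k' \<otimes>\<^bsub>A\<^esub> unit ?r') = unit ?k \<otimes>\<^bsub>A\<^esub> unit g"
    using alpha_unit_unit[OF k, of ?r'] g r gr by (simp add: Src_Comp Comp_ginv_cancel)
  also have "act ?k c \<otimes>\<^bsub>A\<^esub> (unit ?k \<otimes>\<^bsub>A\<^esub> unit g) = unit g \<otimes>\<^bsub>A\<^esub> act ?k c"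
    using g k c act_D[OF k c] by (simp add: m_assoc[symmetric] D_unit unit_central[of g])
  finally show ?thesis .
qed

end

section \<open>The partial skew groupoid ring\<close>

context unital_partial_action
begin

abbreviation "S \<equiv> skew_ring G A D \<alpha>"

lemma skew_carrier:
  "u \<in> carrier S \<longleftrightarrow> (\<forall>g\<in>Mor G. u g \<in> D g) \<and> (\<forall>g. g \<notin> Mor G \<longrightarrow> u g = \<zero>\<^bsub>A\<^esub>) \<and>
    finite {g. u g \<noteq> \<zero>\<^bsub>A\<^esub>}"
  by (simp add: skew_ring_def)

lemma skew_zero [simp]: "\<zero>\<^bsub>S\<^esub> = (\<lambda>g. \<zero>\<^bsub>A\<^esub>)"
  and skew_add: "u \<oplus>\<^bsub>S\<^esub> v = (\<lambda>g. u g \<oplus>\<^bsub>A\<^esub> v g)"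
  by (simp_all add: skew_ring_def)

lemma skew_D: "\<lbrakk>u \<in> carrier S; g \<in> Mor G\<rbrakk> \<Longrightarrow> u g \<in> D g"
  and skew_outside: "\<lbrakk>u \<in> carrier S; g \<notin> Mor G\<rbrakk> \<Longrightarrow> u g = \<zero>\<^bsub>A\<^esub>"
  and skew_finite: "u \<in> carrier S \<Longrightarrow> finite {g. u g \<noteq> \<zero>\<^bsub>A\<^esub>}"
  and skew_support: "\<lbrakk>u \<in> carrier S; u g \<noteq> \<zero>\<^bsub>A\<^esub>\<rbrakk> \<Longrightarrow> g \<in> Mor G"
  using skew_carrier by blast+

lemma skew_closed [simp]:
  assumes "u \<in> carrier S"
  shows "u g \<in> carrier A"
  using assms skew_D[of u g] skew_outside[of u g] D_carrier[of g "u g"] by (cases "g \<in> Mor G") simp_all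

lemma skew_carrierI:
  assumes "\<And>g. g \<in> Mor G \<Longrightarrow> u g \<in> D g" "finite F" "\<And>g. u g \<noteq> \<zero>\<^bsub>A\<^esub> \<Longrightarrow> g \<in> F \<and> g \<in> Mor G"
  shows "u \<in> carrier S"
  unfolding skew_carrier using assms by (auto intro: finite_subset[OF _ assms(2)])

lemma skew_uminus_carrier:
  assumes "u \<in> carrier S"
  shows "(\<lambda>g. \<ominus>\<^bsub>A\<^esub> u g) \<in> carrier S"
proof (rule skew_carrierI[of _ "{g. u g \<noteq> \<zero>\<^bsub>A\<^esub>}"])
  show "g \<in> {g. u g \<noteq> \<zero>\<^bsub>A\<^esub>} \<and> g \<in> Mor G" if "\<ominus>\<^bsub>A\<^esub> u g \<noteq> \<zero>\<^bsub>A\<^esub>" for g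
    using that skew_support[OF assms, of g] by (cases "u g = \<zero>\<^bsub>A\<^esub>") simp_all
qed (use assms in \<open>simp_all add: minus_D skew_D skew_finite\<close>)

lemma skew_abelian_group: "abelian_group S"
proof (rule abelian_groupI)
  show "u \<oplus>\<^bsub>S\<^esub> v \<in> carrier S" if uv: "u \<in> carrier S" "v \<in> carrier S" for u v
  proof (rule skew_carrierI[of _ "{g. u g \<noteq> \<zero>\<^bsub>A\<^esub>} \<union> {g. v g \<noteq> \<zero>\<^bsub>A\<^esub>}"])
    show "(u \<oplus>\<^bsub>S\<^esub> v) g \<in> D g" if "g \<in> Mor G" for g using that uv by (simp add: skew_add add_D skew_D)
    show "finite ({g. u g \<noteq> \<zero>\<^bsub>A\<^esub>} \<union> {g. v g \<noteq> \<zero>\<^bsub>A\<^esub>})" using uv skew_finite by simp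
    show "g \<in> {g. u g \<noteq> \<zero>\<^bsub>A\<^esub>} \<union> {g. v g \<noteq> \<zero>\<^bsub>A\<^esub>} \<and> g \<in> Mor G" if "(u \<oplus>\<^bsub>S\<^esub> v) g \<noteq> \<zero>\<^bsub>A\<^esub>" for g
      using that uv skew_support[of u g] skew_support[of v g] by (cases "u g = \<zero>\<^bsub>A\<^esub>") (auto simp: skew_add)
  qed
  show "\<zero>\<^bsub>S\<^esub> \<in> carrier S" by (rule skew_carrierI[of _ "{}"]) simp_all
  show "\<exists>v\<in>carrier S. v \<oplus>\<^bsub>S\<^esub> u = \<zero>\<^bsub>S\<^esub>" if u: "u \<in> carrier S" for u
  proof (rule bexI)
    show "(\<lambda>g. \<ominus>\<^bsub>A\<^esub> u g) \<oplus>\<^bsub>S\<^esub> u = \<zero>\<^bsub>S\<^esub>" using u by (simp add: skew_add l_neg)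
    show "(\<lambda>g. \<ominus>\<^bsub>A\<^esub> u g) \<in> carrier S" using u by (rule skew_uminus_carrier)
  qed
  show "(u \<oplus>\<^bsub>S\<^esub> v) \<oplus>\<^bsub>S\<^esub> w = u \<oplus>\<^bsub>S\<^esub> (v \<oplus>\<^bsub>S\<^esub> w)"
    if "u \<in> carrier S" "v \<in> carrier S" "w \<in> carrier S" for u v w
    using that by (simp add: skew_add a_assoc)
  show "u \<oplus>\<^bsub>S\<^esub> v = v \<oplus>\<^bsub>S\<^esub> u" if "u \<in> carrier S" "v \<in> carrier S" for u v
    using that by (simp add: skew_add a_comm)
qed (simp add: skew_add)

lemma skew_minus:
  assumes "u \<in> carrier S"
  shows "\<ominus>\<^bsub>S\<^esub> u = (\<lambda>g. \<ominus>\<^bsub>A\<^esub> u g)"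
proof -
  interpret S: abelian_group S by (rule skew_abelian_group)
  show ?thesis
    by (rule S.minus_equality[OF _ assms skew_uminus_carrier[OF assms]]) (use assms in \<open>simp add: skew_add l_neg\<close>)
qed

lemma skew_mult_pairs:
  "(u \<otimes>\<^bsub>S\<^esub> v) k = finsum A (\<lambda>(g, h). u g \<otimes>\<^bsub>A\<^esub> \<alpha> g (v h \<otimes>\<^bsub>A\<^esub> ideal_unit A (D (ginv G g))))
    {(g, h). g \<in> Mor G \<and> h \<in> Mor G \<and> u g \<noteq> \<zero>\<^bsub>A\<^esub> \<and> v h \<noteq> \<zero>\<^bsub>A\<^esub> \<and>
      Src G g = Tgt G h \<and> Comp G g h = k}"
  by (simp add: skew_ring_def)

lemma skew_mult_outside:
  assumes "k \<notin> Mor G"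
  shows "(u \<otimes>\<^bsub>S\<^esub> v) k = \<zero>\<^bsub>A\<^esub>"
proof -
  have "{(g, h). g \<in> Mor G \<and> h \<in> Mor G \<and> u g \<noteq> \<zero>\<^bsub>A\<^esub> \<and> v h \<noteq> \<zero>\<^bsub>A\<^esub> \<and>
          Src G g = Tgt G h \<and> Comp G g h = k} = {}"
    using assms Comp_Mor by blast
  then show ?thesis by (simp only: skew_mult_pairs finsum_empty)
qed

text \<open>In a pair with product \<open>k\<close> the first entry determines the second, which
  leaves a single sum. The set \<open>F\<close> may exceed the support so that the products of
  different elements can share one index set.\<close>

lemma skew_mult:
  assumes u: "u \<in> carrier S" and v: "v \<in> carrier S" and k: "k \<in> Mor G"
    and F: "finite F" "{g. u g \<noteq> \<zero>\<^bsub>A\<^esub>} \<subseteq> F"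
  shows "(u \<otimes>\<^bsub>S\<^esub> v) k
    = finsum A (\<lambda>g. u g \<otimes>\<^bsub>A\<^esub> act g (v (Comp G (ginv G g) k))) {g \<in> F. g \<in> Mor G \<and> Tgt G g = Tgt G k}"
proof -
  let ?P = "{(g, h). g \<in> Mor G \<and> h \<in> Mor G \<and> u g \<noteq> \<zero>\<^bsub>A\<^esub> \<and> v h \<noteq> \<zero>\<^bsub>A\<^esub> \<and>
          Src G g = Tgt G h \<and> Comp G g h = k}"
  let ?T = "{g \<in> F. g \<in> Mor G \<and> Tgt G g = Tgt G k}"
  let ?R = "{g \<in> ?T. u g \<noteq> \<zero>\<^bsub>A\<^esub> \<and> v (Comp G (ginv G g) k) \<noteq> \<zero>\<^bsub>A\<^esub>}"
  let ?f = "\<lambda>g. (g, Comp G (ginv G g) k)"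
  let ?t = "\<lambda>(g, h). u g \<otimes>\<^bsub>A\<^esub> \<alpha> g (v h \<otimes>\<^bsub>A\<^esub> ideal_unit A (D (ginv G g)))"
  have P: "?P = ?f ` ?R"
  proof
    show "?P \<subseteq> ?f ` ?R"
    proof
      fix gh assume "gh \<in> ?P"
      then obtain g h where gh: "gh = (g, h)" "g \<in> Mor G" "h \<in> Mor G" "u g \<noteq> \<zero>\<^bsub>A\<^esub>" "v h \<noteq> \<zero>\<^bsub>A\<^esub>"
          "Src G g = Tgt G h" "Comp G g h = k" by blast
      have "Comp G (ginv G g) k = h" using gh Comp_ginv_cancel(1)[of g h] by simp
      moreover have "Tgt G g = Tgt G k" using gh Tgt_Comp[of g h] by simp
      ultimately show "gh \<in> ?f ` ?R" using gh F by (intro image_eqI[of _ _ g]) auto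
    qed
    show "?f ` ?R \<subseteq> ?P"
      using k by (auto simp: Comp_Mor Tgt_Comp Comp_ginv_cancel)
  qed
  have "(u \<otimes>\<^bsub>S\<^esub> v) k = finsum A ?t ?P" by (rule skew_mult_pairs)
  also have "\<dots> = finsum A (\<lambda>g. ?t (?f g)) ?R"
    unfolding P
  proof (rule finsum_reindex)
    show "?t \<in> ?f ` ?R \<rightarrow> carrier A"
      using u v act_closed m_closed unfolding act_def unit_def by auto
    show "inj_on ?f ?R" by (rule inj_onI) simp
  qed
  also have "\<dots> = finsum A (\<lambda>g. u g \<otimes>\<^bsub>A\<^esub> act g (v (Comp G (ginv G g) k))) ?T"
  proof (rule add.finprod_mono_neutral_cong_left)
    show "finite ?T" using F by simp
    show "u g \<otimes>\<^bsub>A\<^esub> act g (v (Comp G (ginv G g) k)) = \<zero>\<^bsub>A\<^esub>" if "g \<in> ?T - ?R" for g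
      using that u v by (auto simp: zero_mult)
    show "(\<lambda>g. u g \<otimes>\<^bsub>A\<^esub> act g (v (Comp G (ginv G g) k))) \<in> ?T \<rightarrow> carrier A"
      using u v by (auto intro!: m_closed)
  qed (auto simp: act_def unit_def)
  finally show ?thesis .
qed

text \<open>Since \<open>b\<close> is its own product with \<open>unit h\<close>, its image is a
  multiple of \<open>act g (unit h)\<close>, which lies in \<open>D (Comp G g h)\<close>. This is
  what places the coefficients of a product in the right ideals.\<close>

lemma act_shift_D:
  assumes "g \<in> Mor G" "h \<in> Mor G" "Src G g = Tgt G h" "b \<in> D h"
  shows "act g b \<in> D (Comp G g h)"
proof -
  have b: "b \<in> carrier A" "b = b \<otimes>\<^bsub>A\<^esub> unit h" using assms D_iff by auto
  have k: "Comp G g h \<in> Mor G" using assms by (simp add: Comp_Mor)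
  have "act g b = act g b \<otimes>\<^bsub>A\<^esub> act g (unit h)"
    using act_mult[of g b "unit h"] b assms by simp
  also have "\<dots> = (act g b \<otimes>\<^bsub>A\<^esub> unit g) \<otimes>\<^bsub>A\<^esub> unit (Comp G g h)"
    using assms b k by (simp add: act_unit m_assoc)
  finally show ?thesis using D_mult_left[OF k unit_D[OF k], of "act g b \<otimes>\<^bsub>A\<^esub> unit g"] assms b
    by (simp add: m_closed)
qed

lemma finsum_D:
  assumes "k \<in> Mor G" "finite F" "\<And>g. g \<in> F \<Longrightarrow> f g \<in> D k"
  shows "finsum A f F \<in> D k"
  using assms(2,3)
proof (induction F rule: finite_induct)
  case empty then show ?case using assms(1) by simp
next
  case (insert g F)
  then have "f \<in> F \<rightarrow> carrier A" "f g \<in> carrier A" using D_carrier[OF assms(1)] by auto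
  then show ?case using insert assms(1) by (simp add: add_D)
qed

lemma skew_mult_closed:
  assumes u: "u \<in> carrier S" and v: "v \<in> carrier S"
  shows "u \<otimes>\<^bsub>S\<^esub> v \<in> carrier S"
proof (rule skew_carrierI[of _ "(\<lambda>(g, h). Comp G g h) ` ({g. u g \<noteq> \<zero>\<^bsub>A\<^esub>} \<times> {g. v g \<noteq> \<zero>\<^bsub>A\<^esub>})"])
  let ?U = "{g. u g \<noteq> \<zero>\<^bsub>A\<^esub>}"
  note mult = skew_mult[OF u v _ skew_finite[OF u] order_refl]
  show "finite ((\<lambda>(g, h). Comp G g h) ` (?U \<times> {g. v g \<noteq> \<zero>\<^bsub>A\<^esub>}))"
    using u v skew_finite by simp
  show "(u \<otimes>\<^bsub>S\<^esub> v) k \<in> D k" if k: "k \<in> Mor G" for k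
    unfolding mult[OF k]
  proof (rule finsum_D[OF k])
    fix g assume g: "g \<in> {g \<in> ?U. g \<in> Mor G \<and> Tgt G g = Tgt G k}"
    then have "act g (v (Comp G (ginv G g) k)) \<in> D (Comp G g (Comp G (ginv G g) k))"
      using k v by (intro act_shift_D) (auto simp: Comp_Mor Tgt_Comp skew_D)
    then show "u g \<otimes>\<^bsub>A\<^esub> act g (v (Comp G (ginv G g) k)) \<in> D k"
      using g k u by (intro D_mult_left) (auto simp: Comp_ginv_cancel)
  qed (use skew_finite[OF u] in simp)
  fix k assume nz: "(u \<otimes>\<^bsub>S\<^esub> v) k \<noteq> \<zero>\<^bsub>A\<^esub>"
  then have k: "k \<in> Mor G" using skew_mult_outside by blast
  have "\<exists>g. g \<in> ?U \<and> g \<in> Mor G \<and> Tgt G g = Tgt G k \<and> v (Comp G (ginv G g) k) \<noteq> \<zero>\<^bsub>A\<^esub>"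
  proof (rule ccontr)
    assume "\<not> ?thesis"
    then have "(u \<otimes>\<^bsub>S\<^esub> v) k = \<zero>\<^bsub>A\<^esub>"
      unfolding mult[OF k] using u by (intro add.finprod_one_eqI) (auto simp: zero_mult)
    then show False using nz by simp
  qed
  then obtain g where g: "g \<in> ?U" "g \<in> Mor G" "Tgt G g = Tgt G k" "v (Comp G (ginv G g) k) \<noteq> \<zero>\<^bsub>A\<^esub>"
    by blast
  then have "k = Comp G g (Comp G (ginv G g) k)" using k by (simp add: Comp_ginv_cancel)
  then show "k \<in> (\<lambda>(g, h). Comp G g h) ` (?U \<times> {g. v g \<noteq> \<zero>\<^bsub>A\<^esub>}) \<and> k \<in> Mor G"
    using g k by (intro conjI image_eqI[of _ _ "(g, Comp G (ginv G g) k)"]) auto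
qed

lemma skew_l_distr:
  assumes u: "u \<in> carrier S" "u' \<in> carrier S" and v: "v \<in> carrier S"
  shows "(u \<oplus>\<^bsub>S\<^esub> u') \<otimes>\<^bsub>S\<^esub> v = u \<otimes>\<^bsub>S\<^esub> v \<oplus>\<^bsub>S\<^esub> u' \<otimes>\<^bsub>S\<^esub> v"
proof
  fix k
  interpret S: abelian_group S by (rule skew_abelian_group)
  let ?F = "{g. u g \<noteq> \<zero>\<^bsub>A\<^esub>} \<union> {g. u' g \<noteq> \<zero>\<^bsub>A\<^esub>}"
  have F: "finite ?F" using u skew_finite by simp
  have sub: "{g. (u \<oplus>\<^bsub>S\<^esub> u') g \<noteq> \<zero>\<^bsub>A\<^esub>} \<subseteq> ?F" by (auto simp: skew_add)
  show "((u \<oplus>\<^bsub>S\<^esub> u') \<otimes>\<^bsub>S\<^esub> v) k = (u \<otimes>\<^bsub>S\<^esub> v \<oplus>\<^bsub>S\<^esub> u' \<otimes>\<^bsub>S\<^esub> v) k"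
  proof (cases "k \<in> Mor G")
    case True
    show ?thesis
      unfolding skew_mult[OF S.a_closed[OF u] v True F sub] skew_add[of "u \<otimes>\<^bsub>S\<^esub> v"]
        skew_mult[OF u(1) v True F Un_upper1] skew_mult[OF u(2) v True F Un_upper2]
      by (subst finsum_addf[symmetric])
        (use u v in \<open>auto intro!: m_closed finsum_cong' simp: skew_add l_distr\<close>)
  qed (simp add: skew_add skew_mult_outside)
qed

lemma skew_r_distr:
  assumes u: "u \<in> carrier S" "u' \<in> carrier S" and v: "v \<in> carrier S"
  shows "v \<otimes>\<^bsub>S\<^esub> (u \<oplus>\<^bsub>S\<^esub> u') = v \<otimes>\<^bsub>S\<^esub> u \<oplus>\<^bsub>S\<^esub> v \<otimes>\<^bsub>S\<^esub> u'"
proof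
  fix k
  interpret S: abelian_group S by (rule skew_abelian_group)
  note F = skew_finite[OF v] order_refl
  show "(v \<otimes>\<^bsub>S\<^esub> (u \<oplus>\<^bsub>S\<^esub> u')) k = (v \<otimes>\<^bsub>S\<^esub> u \<oplus>\<^bsub>S\<^esub> v \<otimes>\<^bsub>S\<^esub> u') k"
  proof (cases "k \<in> Mor G")
    case True
    show ?thesis
      unfolding skew_mult[OF v S.a_closed[OF u] True F] skew_add[of "v \<otimes>\<^bsub>S\<^esub> u"]
        skew_mult[OF v u(1) True F] skew_mult[OF v u(2) True F]
      by (subst finsum_addf[symmetric])
        (use u v in \<open>auto intro!: m_closed finsum_cong' simp: skew_add r_distr act_add\<close>)
  qed (simp add: skew_add skew_mult_outside)
qed

section \<open>Monomials and associativity\<close>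

definition monomial :: "'c \<Rightarrow> 'a \<Rightarrow> 'a \<Rightarrow> 'c" where
  "monomial a g = (\<lambda>k. if k = g then a else \<zero>\<^bsub>A\<^esub>)"

lemma monomial_carrier: "\<lbrakk>g \<in> Mor G; a \<in> D g\<rbrakk> \<Longrightarrow> monomial a g \<in> carrier S"
  by (rule skew_carrierI[of _ "{g}"]) (auto simp: monomial_def split: if_splits)

lemma monomial_mult:
  assumes g: "g \<in> Mor G" "a \<in> D g" and v: "v \<in> carrier S" and k: "k \<in> Mor G"
  shows "(monomial a g \<otimes>\<^bsub>S\<^esub> v) k
    = (if Tgt G g = Tgt G k then a \<otimes>\<^bsub>A\<^esub> act g (v (Comp G (ginv G g) k)) else \<zero>\<^bsub>A\<^esub>)"
proof -
  have "{h. monomial a g h \<noteq> \<zero>\<^bsub>A\<^esub>} \<subseteq> {g}" by (auto simp: monomial_def)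
  note mult = skew_mult[OF monomial_carrier[OF g] v k _ this]
  have a: "a \<in> carrier A" using g D_carrier by blast
  show ?thesis
  proof (cases "Tgt G g = Tgt G k")
    case True
    then have "{h \<in> {g}. h \<in> Mor G \<and> Tgt G h = Tgt G k} = {g}" using g by auto
    then show ?thesis using mult True a g v by (simp add: monomial_def m_closed)
  next
    case False
    then have empty: "{h \<in> {g}. h \<in> Mor G \<and> Tgt G h = Tgt G k} = {}" by auto
    have "(monomial a g \<otimes>\<^bsub>S\<^esub> v) k = \<zero>\<^bsub>A\<^esub>" by (subst mult) (simp_all only: empty finsum_empty finite.intros)
    then show ?thesis using False by simp
  qed
qed

lemma mult_monomial:
  assumes h: "h \<in> Mor G" "b \<in> D h" and u: "u \<in> carrier S" and k: "k \<in> Mor G"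
  shows "(u \<otimes>\<^bsub>S\<^esub> monomial b h) k
    = (if Src G k = Src G h then u (Comp G k (ginv G h)) \<otimes>\<^bsub>A\<^esub> act (Comp G k (ginv G h)) b else \<zero>\<^bsub>A\<^esub>)"
proof -
  let ?m = "Comp G k (ginv G h)"
  \<comment> \<open>Adding \<open>?m\<close> keeps the only index that can contribute inside the sum
    even when \<open>u\<close> vanishes there.\<close>
  let ?F = "insert ?m {g. u g \<noteq> \<zero>\<^bsub>A\<^esub>}"
  let ?T = "{g \<in> ?F. g \<in> Mor G \<and> Tgt G g = Tgt G k}"
  have b: "b \<in> carrier A" using h D_carrier by blast
  have "finite ?F" using skew_finite[OF u] by simp
  note mult = skew_mult[OF u monomial_carrier[OF h] k this subset_insertI]
  have *: "Comp G (ginv G g) k = h \<longleftrightarrow> Src G k = Src G h \<and> g = ?m" if g: "g \<in> ?T" for g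
  proof
    assume eq: "Comp G (ginv G g) k = h"
    have "Src G h = Src G k" using g k Src_Comp[of "ginv G g" k] unfolding eq by simp
    moreover have "Comp G g h = k" using g k Comp_ginv_cancel(2)[of g k] unfolding eq by simp
    moreover have "Tgt G h = Src G g" using g k Tgt_Comp[of "ginv G g" k] unfolding eq by simp
    ultimately show "Src G k = Src G h \<and> g = ?m" using Comp_ginv_cancel(3)[of g h] g h by simp
  next
    assume eq: "Src G k = Src G h \<and> g = ?m"
    then show "Comp G (ginv G g) k = h"
      using k h Comp_ginv_cancel(1)[of "ginv G k" h]
      by (simp add: ginv_Comp Comp_assoc)
  qed
  show ?thesis
  proof (cases "Src G k = Src G h")
    case True
    have m: "?m \<in> ?T" using k h True by (simp add: Comp_Mor Tgt_Comp)
    have "(u \<otimes>\<^bsub>S\<^esub> monomial b h) k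
        = finsum A (\<lambda>g. if ?m = g then u g \<otimes>\<^bsub>A\<^esub> act g b else \<zero>\<^bsub>A\<^esub>) ?T"
      unfolding mult
      by (rule finsum_cong') (use * u b True in \<open>auto simp: monomial_def zero_mult m_closed\<close>)
    also have "\<dots> = u ?m \<otimes>\<^bsub>A\<^esub> act ?m b"
      by (rule finsum_singleton[OF m]) (use u b skew_finite[OF u] in \<open>auto simp: m_closed\<close>)
    finally show ?thesis using True by simp
  next
    case False
    have "(u \<otimes>\<^bsub>S\<^esub> monomial b h) k = \<zero>\<^bsub>A\<^esub>"
      unfolding mult
      by (rule add.finprod_one_eqI) (use * u False in \<open>auto simp: monomial_def zero_mult\<close>)
    then show ?thesis using False by simp
  qed
qed

lemma skew_induct [consumes 1, case_names zero add]:
  assumes u: "u \<in> carrier S" and zero: "P (\<lambda>g. \<zero>\<^bsub>A\<^esub>)"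
    and add: "\<And>u g a. \<lbrakk>u \<in> carrier S; P u; g \<in> Mor G; a \<in> D g\<rbrakk> \<Longrightarrow> P (u \<oplus>\<^bsub>S\<^esub> monomial a g)"
  shows "P u"
proof -
  have "\<forall>u\<in>carrier S. {g. u g \<noteq> \<zero>\<^bsub>A\<^esub>} \<subseteq> F \<longrightarrow> P u" if "finite F" for F
    using that
  proof (induction F rule: finite_induct)
    case empty
    have "P u" if "{g. u g \<noteq> \<zero>\<^bsub>A\<^esub>} \<subseteq> {}" for u
    proof -
      have "u = (\<lambda>g. \<zero>\<^bsub>A\<^esub>)" using that by auto
      then show ?thesis using zero by simp
    qed
    then show ?case by blast
  next
    case (insert g F)
    show ?case
    proof (intro ballI impI)
      fix u assume u: "u \<in> carrier S" and sub: "{h. u h \<noteq> \<zero>\<^bsub>A\<^esub>} \<subseteq> insert g F"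
      show "P u"
      proof (cases "u g = \<zero>\<^bsub>A\<^esub>")
        case True
        then have "{h. u h \<noteq> \<zero>\<^bsub>A\<^esub>} \<subseteq> F" using sub by auto
        then show ?thesis using insert.IH u by blast
      next
        case False
        then have g: "g \<in> Mor G" "u g \<in> D g" using u skew_support skew_D by auto
        define w where "w = u(g := \<zero>\<^bsub>A\<^esub>)"
        have w: "w \<in> carrier S"
          by (rule skew_carrierI[of _ "{h. u h \<noteq> \<zero>\<^bsub>A\<^esub>}"])
            (use u g skew_finite[OF u] in \<open>auto simp: w_def skew_D skew_support split: if_splits\<close>)
        have "{h. w h \<noteq> \<zero>\<^bsub>A\<^esub>} \<subseteq> F" using sub by (auto simp: w_def)
        then have "P w" using insert.IH w by blast
        then have "P (w \<oplus>\<^bsub>S\<^esub> monomial (u g) g)" using add w g by blast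
        moreover have "w \<oplus>\<^bsub>S\<^esub> monomial (u g) g = u"
          using u by (auto simp: skew_add w_def monomial_def)
        ultimately show ?thesis by simp
      qed
    qed
  qed
  then show ?thesis using u skew_finite[OF u] by blast
qed

lemma zero_skew_mult:
  assumes "v \<in> carrier S"
  shows "(\<lambda>g. \<zero>\<^bsub>A\<^esub>) \<otimes>\<^bsub>S\<^esub> v = (\<lambda>g. \<zero>\<^bsub>A\<^esub>)"
  by (simp add: skew_ring_def)

text \<open>Left multiplication by a monomial has a closed formula for every \<open>w\<close>, so
  only the first two factors need to be monomials. The factor \<open>unit g\<close> produced by
  composing the actions is absorbed by \<open>act g b\<close>, which lies in
  \<open>D g\<close>.\<close>

lemma monomial_monomial_assoc:
  assumes g: "g \<in> Mor G" "a \<in> D g" and r: "r \<in> Mor G" "b \<in> D r" and w: "w \<in> carrier S"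
  shows "(monomial a g \<otimes>\<^bsub>S\<^esub> monomial b r) \<otimes>\<^bsub>S\<^esub> w = monomial a g \<otimes>\<^bsub>S\<^esub> (monomial b r \<otimes>\<^bsub>S\<^esub> w)"
proof -
  have a: "a \<in> carrier A" and b: "b \<in> carrier A" using g r D_carrier by blast+
  note bw = skew_mult_closed[OF monomial_carrier[OF r] w]
  let ?k = "Comp G g r"
  have rhs: "(monomial a g \<otimes>\<^bsub>S\<^esub> (monomial b r \<otimes>\<^bsub>S\<^esub> w)) k = (if Tgt G g = Tgt G k \<and> Tgt G r = Src G g
      then a \<otimes>\<^bsub>A\<^esub> act g b \<otimes>\<^bsub>A\<^esub> act ?k (w (Comp G (ginv G ?k) k)) else \<zero>\<^bsub>A\<^esub>)" if k: "k \<in> Mor G" for k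
  proof (cases "Tgt G g = Tgt G k")
    case True
    let ?m = "Comp G (ginv G g) k"
    have m: "?m \<in> Mor G" "Tgt G ?m = Src G g" using True k g by (auto simp: Comp_Mor Tgt_Comp)
    show ?thesis
    proof (cases "Tgt G r = Src G g")
      case rg: True
      have "Comp G (ginv G r) ?m = Comp G (ginv G ?k) k"
        using g r k rg True by (simp add: ginv_Comp Comp_assoc)
      moreover have "act g (b \<otimes>\<^bsub>A\<^esub> act r c) = act g b \<otimes>\<^bsub>A\<^esub> act ?k c" if c: "c \<in> carrier A" for c
      proof -
        have k: "?k \<in> Mor G" using g r rg by (simp add: Comp_Mor)
        have "act g (b \<otimes>\<^bsub>A\<^esub> act r c) = act g b \<otimes>\<^bsub>A\<^esub> unit g \<otimes>\<^bsub>A\<^esub> act ?k c"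
          using act_mult[OF g(1) b] act_act[OF g(1) r(1) _ c] g r b c rg k by (simp add: m_assoc)
        then show ?thesis using act_D[OF g(1) b] g by (simp add: D_unit)
      qed
      ultimately show ?thesis
        using monomial_mult[OF g bw k] monomial_mult[OF r w m(1)] True rg m w g r a b
        by (simp add: m_assoc Comp_Mor)
    next
      case False
      then show ?thesis
        using monomial_mult[OF g bw k] monomial_mult[OF r w m(1)] True m g a by (simp add: zero_mult)
    qed
  next
    case False
    then show ?thesis using monomial_mult[OF g bw k] by simp
  qed
  have prod: "monomial a g \<otimes>\<^bsub>S\<^esub> monomial b r
      = (if Tgt G r = Src G g then monomial (a \<otimes>\<^bsub>A\<^esub> act g b) ?k else (\<lambda>g. \<zero>\<^bsub>A\<^esub>))"
  proof
    fix k
    show "(monomial a g \<otimes>\<^bsub>S\<^esub> monomial b r) k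
      = (if Tgt G r = Src G g then monomial (a \<otimes>\<^bsub>A\<^esub> act g b) ?k else (\<lambda>g. \<zero>\<^bsub>A\<^esub>)) k"
    proof (cases "k \<in> Mor G")
      case True
      have iff: "Tgt G g = Tgt G k \<and> Comp G (ginv G g) k = r \<longleftrightarrow> Tgt G r = Src G g \<and> k = ?k"
        using Comp_ginv_cancel[of g k] Comp_ginv_cancel[of g r] Tgt_Comp[of "ginv G g" k] Tgt_Comp[of g r]
          True g r by auto
      show ?thesis
        unfolding monomial_mult[OF g monomial_carrier[OF r] True]
        using iff g a by (auto simp: monomial_def zero_mult)
    next
      case False
      then show ?thesis
        using skew_mult_outside[OF False] Comp_Mor[of g r] g r by (auto simp: monomial_def)
    qed
  qed
  show ?thesis
  proof
    fix k
    show "((monomial a g \<otimes>\<^bsub>S\<^esub> monomial b r) \<otimes>\<^bsub>S\<^esub> w) k = (monomial a g \<otimes>\<^bsub>S\<^esub> (monomial b r \<otimes>\<^bsub>S\<^esub> w)) k"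
    proof (cases "k \<in> Mor G")
      case True
      show ?thesis
      proof (cases "Tgt G r = Src G g")
        case rg: True
        have k: "?k \<in> Mor G" using g r rg by (simp add: Comp_Mor)
        have "a \<otimes>\<^bsub>A\<^esub> act g b \<in> D ?k"
          using act_shift_D[OF g(1) r(1) _ r(2)] rg a by (simp add: D_mult_left[OF k])
        then show ?thesis
          using rhs[OF True] monomial_mult[OF k _ w True] rg g r unfolding prod by (simp add: Tgt_Comp)
      next
        case False
        then show ?thesis using rhs[OF True] w unfolding prod by (simp add: zero_skew_mult)
      qed
    qed (simp add: skew_mult_outside)
  qed
qed

lemma skew_assoc:
  assumes u: "u \<in> carrier S" and v: "v \<in> carrier S" and w: "w \<in> carrier S"
  shows "(u \<otimes>\<^bsub>S\<^esub> v) \<otimes>\<^bsub>S\<^esub> w = u \<otimes>\<^bsub>S\<^esub> (v \<otimes>\<^bsub>S\<^esub> w)"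
proof -
  interpret S: abelian_group S by (rule skew_abelian_group)
  have 1: "(monomial a g \<otimes>\<^bsub>S\<^esub> v) \<otimes>\<^bsub>S\<^esub> w = monomial a g \<otimes>\<^bsub>S\<^esub> (v \<otimes>\<^bsub>S\<^esub> w)"
    if g: "g \<in> Mor G" "a \<in> D g" for g a
    using v
  proof (induction v rule: skew_induct)
    case zero
    have "monomial a g \<otimes>\<^bsub>S\<^esub> (\<lambda>g. \<zero>\<^bsub>A\<^esub>) = (\<lambda>g. \<zero>\<^bsub>A\<^esub>)" by (simp add: skew_ring_def)
    then show ?case using w by (simp add: zero_skew_mult)
  next
    case (add v r b)
    then show ?case
      using g w monomial_carrier monomial_monomial_assoc
      by (simp add: skew_r_distr skew_l_distr skew_mult_closed)
  qed
  show ?thesis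
    using u
  proof (induction u rule: skew_induct)
    case zero then show ?case using v w by (simp add: zero_skew_mult skew_mult_closed)
  next
    case (add u g a)
    then show ?case
      using v w monomial_carrier 1 by (simp add: skew_l_distr skew_mult_closed)
  qed
qed

lemma skew_rng: "rng S"
proof -
  interpret S: abelian_group S by (rule skew_abelian_group)
  show ?thesis
    by unfold_locales (simp_all add: skew_mult_closed skew_assoc skew_l_distr skew_r_distr)
qed

section \<open>One-sided ideals cut out by additive conditions\<close>

text \<open>
  Testing monomials is enough: they generate the skew groupoid ring additively.
\<close>

definition left_core :: "('a \<Rightarrow> 'c) set \<Rightarrow> ('a \<Rightarrow> 'c) set" where
  "left_core Y = {s. s \<in> carrier S \<and> (\<forall>g\<in>Mor G. \<forall>a\<in>D g. monomial a g \<otimes>\<^bsub>S\<^esub> s \<in> Y)}"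

definition right_core :: "('a \<Rightarrow> 'c) set \<Rightarrow> ('a \<Rightarrow> 'c) set" where
  "right_core Y = {s. s \<in> carrier S \<and> (\<forall>g\<in>Mor G. \<forall>a\<in>D g. s \<otimes>\<^bsub>S\<^esub> monomial a g \<in> Y)}"

text \<open>The core consists of the \<open>s\<close> for which every product \<open>r s\<close>
  lies in \<open>Y\<close>. If \<open>s\<close> has this property then so does \<open>t s\<close>,
  because \<open>r (t s)\<close> is \<open>(r t) s\<close>; \<open>Y\<close> itself has to be closed
  only under addition and negation.\<close>

lemma left_core_left_ideal:
  assumes Y: "additive_subgroup Y S"
  shows "left_ideal (left_core Y) S"
proof -
  interpret S: rng S by (rule skew_rng)
  have z: "\<zero>\<^bsub>S\<^esub> \<in> Y" and add: "\<And>u v. \<lbrakk>u \<in> Y; v \<in> Y\<rbrakk> \<Longrightarrow> u \<oplus>\<^bsub>S\<^esub> v \<in> Y"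
    and minus: "\<And>u. u \<in> Y \<Longrightarrow> \<ominus>\<^bsub>S\<^esub> u \<in> Y"
    using Y unfolding S.additive_subgroup_iff by blast+
  have zm: "u \<otimes>\<^bsub>S\<^esub> \<zero>\<^bsub>S\<^esub> = \<zero>\<^bsub>S\<^esub>" for u by (simp add: skew_ring_def)
  have all: "t \<otimes>\<^bsub>S\<^esub> s \<in> Y" if s: "s \<in> left_core Y" and t: "t \<in> carrier S" for s t
    using t
  proof (induction t rule: skew_induct)
    case zero
    then show ?case using s z zero_skew_mult[of s] by (simp add: left_core_def)
  next
    case (add u g a)
    then show ?case using s add monomial_carrier[of g a]
      by (simp add: left_core_def S.l_distr \<open>\<And>u v. \<lbrakk>u \<in> Y; v \<in> Y\<rbrakk> \<Longrightarrow> u \<oplus>\<^bsub>S\<^esub> v \<in> Y\<close>)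
  qed
  show ?thesis
    unfolding left_ideal_def S.additive_subgroup_iff
  proof (intro conjI ballI)
    show "left_core Y \<subseteq> carrier S" by (auto simp: left_core_def)
    show "\<zero>\<^bsub>S\<^esub> \<in> left_core Y"
      unfolding left_core_def mem_Collect_eq zm using z S.zero_closed by blast
    show "u \<oplus>\<^bsub>S\<^esub> v \<in> left_core Y" if "u \<in> left_core Y" "v \<in> left_core Y" for u v
      using that add monomial_carrier by (simp add: left_core_def S.r_distr)
    show "\<ominus>\<^bsub>S\<^esub> u \<in> left_core Y" if u: "u \<in> left_core Y" for u
    proof -
      have uc: "u \<in> carrier S" using u by (simp add: left_core_def)
      have "monomial a g \<otimes>\<^bsub>S\<^esub> (\<ominus>\<^bsub>S\<^esub> u) = \<ominus>\<^bsub>S\<^esub> (monomial a g \<otimes>\<^bsub>S\<^esub> u)" if g: "g \<in> Mor G" "a \<in> D g" for g a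
      proof -
        note c = S.m_closed[OF monomial_carrier[OF g] uc] S.m_closed[OF monomial_carrier[OF g] S.a_inv_closed[OF uc]]
        have "monomial a g \<otimes>\<^bsub>S\<^esub> (\<ominus>\<^bsub>S\<^esub> u) \<oplus>\<^bsub>S\<^esub> monomial a g \<otimes>\<^bsub>S\<^esub> u = \<zero>\<^bsub>S\<^esub>"
          using S.r_distr[OF S.a_inv_closed[OF uc] uc monomial_carrier[OF g]] uc S.l_neg[OF uc] zm by metis
        from S.minus_equality[OF this c] show ?thesis by (rule sym)
      qed
      then show ?thesis using u minus uc unfolding left_core_def by (auto simp del: skew_zero)
    qed
    show "r \<otimes>\<^bsub>S\<^esub> u \<in> left_core Y" if r: "r \<in> carrier S" and u: "u \<in> left_core Y" for r u
    proof -
      have uc: "u \<in> carrier S" using u by (simp add: left_core_def)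
      have "monomial a g \<otimes>\<^bsub>S\<^esub> (r \<otimes>\<^bsub>S\<^esub> u) \<in> Y" if g: "g \<in> Mor G" "a \<in> D g" for g a
        using all[OF u S.m_closed[OF monomial_carrier[OF g] r]] S.m_assoc[OF monomial_carrier[OF g] r uc] by simp
      then show ?thesis using S.m_closed[OF r uc] by (simp add: left_core_def)
    qed
  qed
qed

lemma right_core_right_ideal:
  assumes Y: "additive_subgroup Y S"
  shows "right_ideal (right_core Y) S"
proof -
  interpret S: rng S by (rule skew_rng)
  have z: "\<zero>\<^bsub>S\<^esub> \<in> Y" and add: "\<And>u v. \<lbrakk>u \<in> Y; v \<in> Y\<rbrakk> \<Longrightarrow> u \<oplus>\<^bsub>S\<^esub> v \<in> Y"
    and minus: "\<And>u. u \<in> Y \<Longrightarrow> \<ominus>\<^bsub>S\<^esub> u \<in> Y"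
    using Y unfolding S.additive_subgroup_iff by blast+
  have zm: "\<zero>\<^bsub>S\<^esub> \<otimes>\<^bsub>S\<^esub> u = \<zero>\<^bsub>S\<^esub>" for u by (simp add: skew_ring_def)
  have mz: "u \<otimes>\<^bsub>S\<^esub> \<zero>\<^bsub>S\<^esub> = \<zero>\<^bsub>S\<^esub>" for u by (simp add: skew_ring_def)
  have all: "s \<otimes>\<^bsub>S\<^esub> t \<in> Y" if s: "s \<in> right_core Y" and t: "t \<in> carrier S" for s t
    using t
  proof (induction t rule: skew_induct)
    case zero
    then show ?case using z mz[of s] by simp
  next
    case (add u g a)
    then show ?case using s add monomial_carrier[of g a]
      by (simp add: right_core_def S.r_distr \<open>\<And>u v. \<lbrakk>u \<in> Y; v \<in> Y\<rbrakk> \<Longrightarrow> u \<oplus>\<^bsub>S\<^esub> v \<in> Y\<close>)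
  qed
  show ?thesis
    unfolding right_ideal_def S.additive_subgroup_iff
  proof (intro conjI ballI)
    show "right_core Y \<subseteq> carrier S" by (auto simp: right_core_def)
    show "\<zero>\<^bsub>S\<^esub> \<in> right_core Y"
      unfolding right_core_def mem_Collect_eq zm using z S.zero_closed by blast
    show "u \<oplus>\<^bsub>S\<^esub> v \<in> right_core Y" if "u \<in> right_core Y" "v \<in> right_core Y" for u v
      using that add monomial_carrier by (simp add: right_core_def S.l_distr)
    show "\<ominus>\<^bsub>S\<^esub> u \<in> right_core Y" if u: "u \<in> right_core Y" for u
    proof -
      have uc: "u \<in> carrier S" using u by (simp add: right_core_def)
      have "(\<ominus>\<^bsub>S\<^esub> u) \<otimes>\<^bsub>S\<^esub> monomial a g = \<ominus>\<^bsub>S\<^esub> (u \<otimes>\<^bsub>S\<^esub> monomial a g)" if g: "g \<in> Mor G" "a \<in> D g" for g a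
      proof -
        note c = S.m_closed[OF uc monomial_carrier[OF g]] S.m_closed[OF S.a_inv_closed[OF uc] monomial_carrier[OF g]]
        have "(\<ominus>\<^bsub>S\<^esub> u) \<otimes>\<^bsub>S\<^esub> monomial a g \<oplus>\<^bsub>S\<^esub> u \<otimes>\<^bsub>S\<^esub> monomial a g = \<zero>\<^bsub>S\<^esub>"
          using S.l_distr[OF S.a_inv_closed[OF uc] uc monomial_carrier[OF g]] uc S.l_neg[OF uc] zm by metis
        from S.minus_equality[OF this c] show ?thesis by (rule sym)
      qed
      then show ?thesis using u minus uc unfolding right_core_def by (auto simp del: skew_zero)
    qed
    show "u \<otimes>\<^bsub>S\<^esub> r \<in> right_core Y" if r: "r \<in> carrier S" and u: "u \<in> right_core Y" for r u
    proof -
      have uc: "u \<in> carrier S" using u by (simp add: right_core_def)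
      have "(u \<otimes>\<^bsub>S\<^esub> r) \<otimes>\<^bsub>S\<^esub> monomial a g \<in> Y" if g: "g \<in> Mor G" "a \<in> D g" for g a
        using all[OF u S.m_closed[OF r monomial_carrier[OF g]]] S.m_assoc[OF uc r monomial_carrier[OF g]] by simp
      then show ?thesis using S.m_closed[OF uc r] by (simp add: right_core_def)
    qed
  qed
qed

lemma left_core_mono: "Y \<subseteq> Z \<Longrightarrow> left_core Y \<subseteq> left_core Z"
  and right_core_mono: "Y \<subseteq> Z \<Longrightarrow> right_core Y \<subseteq> right_core Z"
  by (auto simp: left_core_def right_core_def)

section \<open>Descent of the chain conditions to the base ring\<close>

lemma rng_finsum_ldistr:
  assumes "finite F" "f \<in> F \<rightarrow> carrier A" "a \<in> carrier A"
  shows "finsum A f F \<otimes>\<^bsub>A\<^esub> a = finsum A (\<lambda>i. f i \<otimes>\<^bsub>A\<^esub> a) F"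
  using assms(1,2)
proof (induction F rule: finite_induct)
  case empty then show ?case using assms(3) by (simp add: zero_mult)
next
  case (insert i F)
  then have "f \<in> F \<rightarrow> carrier A" "f i \<in> carrier A" "(\<lambda>i. f i \<otimes>\<^bsub>A\<^esub> a) \<in> F \<rightarrow> carrier A"
    using assms(3) m_closed by auto
  then show ?case using insert assms(3) by (simp add: l_distr m_closed)
qed

text \<open>Placing \<open>c\<close> at \<open>y\<close> or at \<open>z\<close> gives two
  decompositions of the same element, which must coincide.\<close>

lemma direct_sum_disjoint:
  assumes ds: "is_direct_sum A D (Obj G)" and fin: "finite (Obj G)"
    and y: "y \<in> Obj G" and z: "z \<in> Obj G" "y \<noteq> z" and c: "c \<in> D y" "c \<in> D z"
  shows "c = \<zero>\<^bsub>A\<^esub>"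
proof -
  have cc: "c \<in> carrier A" using c(1) y D_carrier Obj_Mor by blast
  let ?b = "\<lambda>y. \<lambda>w\<in>Obj G. if y = w then c else \<zero>\<^bsub>A\<^esub>"
  have b: "?b y \<in> (\<Pi>\<^sub>E y\<in>Obj G. D y) \<and> c = finsum A (?b y) (Obj G)" if y: "y \<in> Obj G" "c \<in> D y" for y
  proof
    show "?b y \<in> (\<Pi>\<^sub>E y\<in>Obj G. D y)" using y by (auto simp: Obj_Mor)
    have "finsum A (?b y) (Obj G) = finsum A (\<lambda>w. if y = w then c else \<zero>\<^bsub>A\<^esub>) (Obj G)"
      using cc by (intro finsum_cong') auto
    also have "\<dots> = c" using finsum_singleton[OF y(1) fin, of "\<lambda>_. c"] cc by simp
    finally show "c = finsum A (?b y) (Obj G)" by simp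
  qed
  have "?b y = ?b z" using ds cc b[OF y c(1)] b[OF z(1) c(2)] unfolding is_direct_sum_def by blast
  then have "?b y y = ?b z y" by simp
  then show ?thesis using y z by simp
qed

text \<open>The component of \<open>a\<close> at \<open>y\<close> is its product with
  \<open>unit y\<close>, because that unit sends the other summands into intersections of two
  summands, which are zero. The sum of the object units is thus an identity of A, which is not
  assumed to have one.\<close>

lemma direct_sum_units:
  assumes ds: "is_direct_sum A D (Obj G)" and fin: "finite (Obj G)" and a: "a \<in> carrier A"
  shows "a = finsum A (\<lambda>y. a \<otimes>\<^bsub>A\<^esub> unit y) (Obj G)"
proof -
  obtain b where b: "b \<in> (\<Pi>\<^sub>E y\<in>Obj G. D y)" "a = finsum A b (Obj G)"
    using ds a unfolding is_direct_sum_def by blast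
  have bc: "b y \<in> carrier A" if "y \<in> Obj G" for y
    using b(1) that D_carrier Obj_Mor by blast
  have "a \<otimes>\<^bsub>A\<^esub> unit y = b y" if y: "y \<in> Obj G" for y
  proof -
    have "a \<otimes>\<^bsub>A\<^esub> unit y = finsum A (\<lambda>z. b z \<otimes>\<^bsub>A\<^esub> unit y) (Obj G)"
      unfolding b(2) using bc y by (intro rng_finsum_ldistr[OF fin]) (auto simp: Obj_Mor)
    also have "\<dots> = finsum A (\<lambda>z. if y = z then b z else \<zero>\<^bsub>A\<^esub>) (Obj G)"
    proof (rule finsum_cong')
      fix z assume z: "z \<in> Obj G"
      have bz: "b z \<in> D z" using b(1) z by blast
      show "b z \<otimes>\<^bsub>A\<^esub> unit y = (if y = z then b z else \<zero>\<^bsub>A\<^esub>)"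
      proof (cases "y = z")
        case True then show ?thesis using bz z by (simp add: D_unit Obj_Mor)
      next
        case False
        have "b z \<otimes>\<^bsub>A\<^esub> unit y \<in> D y" "b z \<otimes>\<^bsub>A\<^esub> unit y \<in> D z"
          using y z bz bc by (simp_all add: D_mult_left D_mult_right Obj_Mor)
        then show ?thesis using direct_sum_disjoint[OF ds fin y z False] False by simp
      qed
    qed (use bc in auto)
    also have "\<dots> = b y" using bc by (intro finsum_singleton[OF y fin]) auto
    finally show ?thesis .
  qed
  then have "finsum A (\<lambda>y. a \<otimes>\<^bsub>A\<^esub> unit y) (Obj G) = finsum A b (Obj G)"
    using bc by (intro finsum_cong') auto
  then show ?thesis using b(2) by simp
qed

definition diagonal :: "'c \<Rightarrow> 'a \<Rightarrow> 'c" where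
  "diagonal a = (\<lambda>g. if g \<in> Obj G then a \<otimes>\<^bsub>A\<^esub> unit g else \<zero>\<^bsub>A\<^esub>)"

text \<open>Coefficients off the objects are left free. The condition is merely additive; the cores
  turn it into a one-sided ideal.\<close>

definition diagonal_in :: "'c set \<Rightarrow> ('a \<Rightarrow> 'c) set" where
  "diagonal_in I = {s. s \<in> carrier S \<and> (\<forall>y\<in>Obj G. s y \<in> I)}"

lemma diagonal_carrier:
  assumes "finite (Obj G)" "a \<in> carrier A"
  shows "diagonal a \<in> carrier S"
  by (rule skew_carrierI[OF _ assms(1)])
    (use assms in \<open>auto simp: diagonal_def D_mult_left Obj_Mor split: if_splits\<close>)

lemma diagonal_in_subgroup:
  assumes I: "additive_subgroup I A"
  shows "additive_subgroup (diagonal_in I) S"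
proof -
  interpret S: rng S by (rule skew_rng)
  have I': "\<zero>\<^bsub>A\<^esub> \<in> I" "\<And>a b. \<lbrakk>a \<in> I; b \<in> I\<rbrakk> \<Longrightarrow> a \<oplus>\<^bsub>A\<^esub> b \<in> I" "\<And>a. a \<in> I \<Longrightarrow> \<ominus>\<^bsub>A\<^esub> a \<in> I"
    using I unfolding additive_subgroup_iff by blast+
  show ?thesis
    unfolding S.additive_subgroup_iff
  proof (intro conjI ballI)
    show "diagonal_in I \<subseteq> carrier S" by (auto simp: diagonal_in_def)
    show "\<zero>\<^bsub>S\<^esub> \<in> diagonal_in I" using I' S.zero_closed by (simp add: diagonal_in_def)
    show "u \<oplus>\<^bsub>S\<^esub> v \<in> diagonal_in I" if "u \<in> diagonal_in I" "v \<in> diagonal_in I" for u v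
      using that I' S.a_closed[of u v] by (simp add: diagonal_in_def skew_add)
    show "\<ominus>\<^bsub>S\<^esub> u \<in> diagonal_in I" if "u \<in> diagonal_in I" for u
      using that I' S.a_inv_closed[of u] by (simp add: diagonal_in_def skew_minus)
  qed
qed

lemma additive_subgroup_finsum:
  assumes I: "additive_subgroup I A" and "finite F" "\<And>i. i \<in> F \<Longrightarrow> f i \<in> I"
  shows "finsum A f F \<in> I"
  using assms(2,3)
proof (induction F rule: finite_induct)
  case empty then show ?case using I by (simp add: additive_subgroup_iff)
next
  case (insert i F)
  have "f \<in> F \<rightarrow> carrier A" "f i \<in> carrier A" using insert I by (auto simp: additive_subgroup_iff)
  then show ?case using insert I by (simp add: additive_subgroup_iff)
qed

text \<open>The ideal \<open>I\<close> is recovered from its image. At an object \<open>y\<close>,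
  the product of a monomial at \<open>g\<close> with coefficient \<open>b\<close> and
  \<open>diagonal a\<close> can have a nonzero coefficient only for \<open>g = y\<close>, where it
  is \<open>b\<close> times \<open>a\<close> times \<open>unit y\<close> and so lies in
  \<open>I\<close> if \<open>a\<close> does. Conversely, the choice \<open>b = unit y\<close>
  returns the component of \<open>a\<close> at \<open>y\<close>, and summing over the objects
  returns \<open>a\<close>.\<close>

lemma left_artinian_base:
  assumes ds: "is_direct_sum A D (Obj G)" and fin: "finite (Obj G)" and art: "left_artinian S"
  shows "left_artinian A"
  unfolding left_artinian_iff_dcc
proof (rule dcc_embed)
  let ?\<Phi> = "\<lambda>I. left_core (diagonal_in I)"
  show "dcc {I. left_ideal I S}" using art by (simp add: left_artinian_iff_dcc)
  show "?\<Phi> I \<in> {I. left_ideal I S}" if "I \<in> {I. left_ideal I A}" for I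
    using that by (simp add: left_core_left_ideal diagonal_in_subgroup left_ideal_def[of I])
  show "?\<Phi> I \<subseteq> ?\<Phi> J" if "I \<subseteq> J" for I J
    using that by (intro left_core_mono) (auto simp: diagonal_in_def)
  have *: "a \<in> I \<longleftrightarrow> a \<in> carrier A \<and> diagonal a \<in> ?\<Phi> I" if I: "left_ideal I A" for a I
  proof
    have sub: "I \<subseteq> carrier A" and z: "\<zero>\<^bsub>A\<^esub> \<in> I" and add: "additive_subgroup I A"
      using I unfolding left_ideal_def additive_subgroup_iff by blast+
    have mult: "b \<otimes>\<^bsub>A\<^esub> a \<in> I" if "a \<in> I" "b \<in> carrier A" for a b
      using I that unfolding left_ideal_def by blast
    {
      assume a: "a \<in> I"
      have ac: "a \<in> carrier A" using a sub by blast
      note dc = diagonal_carrier[OF fin ac]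
      have "(monomial b g \<otimes>\<^bsub>S\<^esub> diagonal a) y \<in> I" if g: "g \<in> Mor G" "b \<in> D g" and y: "y \<in> Obj G" for g b y
      proof -
        have bc: "b \<in> carrier A" using g D_carrier by blast
        show ?thesis
        proof (cases "Tgt G g = y")
          case True
          have c: "Comp G (ginv G g) y = ginv G g" using True g y by (intro Comp_Obj_right) simp_all
          show ?thesis
          proof (cases "ginv G g \<in> Obj G")
            case obj: True
            then have "g \<in> Obj G" using ginv_ginv[OF g(1)] ginv_Obj by metis
            then have "g = y" using True by simp
            then have "(monomial b g \<otimes>\<^bsub>S\<^esub> diagonal a) y = b \<otimes>\<^bsub>A\<^esub> ((a \<otimes>\<^bsub>A\<^esub> unit y) \<otimes>\<^bsub>A\<^esub> unit y)"
              using monomial_mult[OF g dc Obj_Mor[OF y]] y ac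
              by (simp add: diagonal_def act_Obj' Obj_Mor m_closed)
            also have "\<dots> = b \<otimes>\<^bsub>A\<^esub> (unit y \<otimes>\<^bsub>A\<^esub> a)"
              using y ac unit_central[OF Obj_Mor[OF y] ac] by (simp add: m_assoc Obj_Mor)
            finally show ?thesis using mult[OF mult[OF a, of "unit y"] bc] y by (simp add: Obj_Mor)
          next
            case False
            then show ?thesis using monomial_mult[OF g dc Obj_Mor[OF y]] True y c g bc z
              by (simp add: diagonal_def zero_mult)
          qed
        next
          case False
          then show ?thesis using monomial_mult[OF g dc Obj_Mor[OF y]] y z by simp
        qed
      qed
      then show "a \<in> carrier A \<and> diagonal a \<in> ?\<Phi> I"
        using ac dc skew_mult_closed[OF monomial_carrier dc] by (auto simp: left_core_def diagonal_in_def)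
    next
      assume a: "a \<in> carrier A \<and> diagonal a \<in> ?\<Phi> I"
      note dc = diagonal_carrier[OF fin conjunct1[OF a]]
      have "a \<otimes>\<^bsub>A\<^esub> unit y \<in> I" if y: "y \<in> Obj G" for y
      proof -
        have "(monomial (unit y) y \<otimes>\<^bsub>S\<^esub> diagonal a) y \<in> I"
          using a y by (simp add: left_core_def diagonal_in_def Obj_Mor)
        moreover have "(monomial (unit y) y \<otimes>\<^bsub>S\<^esub> diagonal a) y = unit y \<otimes>\<^bsub>A\<^esub> ((a \<otimes>\<^bsub>A\<^esub> unit y) \<otimes>\<^bsub>A\<^esub> unit y)"
          using monomial_mult[OF Obj_Mor[OF y] unit_D[OF Obj_Mor[OF y]] dc Obj_Mor[OF y]] y a
          by (simp add: diagonal_def act_Obj' Obj_Mor m_closed)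
        moreover have "\<dots> = a \<otimes>\<^bsub>A\<^esub> unit y"
          using y a unit_central[OF Obj_Mor[OF y], of "a \<otimes>\<^bsub>A\<^esub> unit y"] by (simp add: m_assoc Obj_Mor m_closed)
        ultimately show ?thesis by simp
      qed
      then show "a \<in> I"
        using direct_sum_units[OF ds fin, of a] additive_subgroup_finsum[OF add fin, of "\<lambda>y. a \<otimes>\<^bsub>A\<^esub> unit y"] a
        by simp
    }
  qed
  show "inj_on ?\<Phi> {I. left_ideal I A}"
    by (rule inj_onI) (use * in blast)
qed

lemma right_artinian_base:
  assumes ds: "is_direct_sum A D (Obj G)" and fin: "finite (Obj G)" and art: "right_artinian S"
  shows "right_artinian A"
  unfolding right_artinian_iff_dcc
proof (rule dcc_embed)
  let ?\<Phi> = "\<lambda>I. right_core (diagonal_in I)"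
  show "dcc {I. right_ideal I S}" using art by (simp add: right_artinian_iff_dcc)
  show "?\<Phi> I \<in> {I. right_ideal I S}" if "I \<in> {I. right_ideal I A}" for I
    using that by (simp add: right_core_right_ideal diagonal_in_subgroup right_ideal_def[of I])
  show "?\<Phi> I \<subseteq> ?\<Phi> J" if "I \<subseteq> J" for I J
    using that by (intro right_core_mono) (auto simp: diagonal_in_def)
  have *: "a \<in> I \<longleftrightarrow> a \<in> carrier A \<and> diagonal a \<in> ?\<Phi> I" if I: "right_ideal I A" for a I
  proof
    have sub: "I \<subseteq> carrier A" and z: "\<zero>\<^bsub>A\<^esub> \<in> I" and add: "additive_subgroup I A"
      using I unfolding right_ideal_def additive_subgroup_iff by blast+
    have mult: "a \<otimes>\<^bsub>A\<^esub> b \<in> I" if "a \<in> I" "b \<in> carrier A" for a b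
      using I that unfolding right_ideal_def by blast
    {
      assume a: "a \<in> I"
      have ac: "a \<in> carrier A" using a sub by blast
      note dc = diagonal_carrier[OF fin ac]
      have "(diagonal a \<otimes>\<^bsub>S\<^esub> monomial b g) y \<in> I" if g: "g \<in> Mor G" "b \<in> D g" and y: "y \<in> Obj G" for g b y
      proof -
        have bc: "b \<in> carrier A" using g D_carrier by blast
        show ?thesis
        proof (cases "Src G g = y")
          case True
          have c: "Comp G y (ginv G g) = ginv G g" using True g y by (intro Comp_Obj_left) simp_all
          show ?thesis
          proof (cases "ginv G g \<in> Obj G")
            case obj: True
            then have "g \<in> Obj G" using ginv_ginv[OF g(1)] ginv_Obj by metis
            then have "g = y" using True by simp
            then have "(diagonal a \<otimes>\<^bsub>S\<^esub> monomial b g) y = a \<otimes>\<^bsub>A\<^esub> unit y \<otimes>\<^bsub>A\<^esub> (b \<otimes>\<^bsub>A\<^esub> unit y)"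
              using mult_monomial[OF g dc Obj_Mor[OF y]] y bc c
              by (simp add: diagonal_def act_Obj' Obj_Mor)
            then show ?thesis using mult[OF mult[OF a, of "unit y"], of "b \<otimes>\<^bsub>A\<^esub> unit y"] bc y
              by (simp add: Obj_Mor m_closed)
          next
            case False
            then show ?thesis using mult_monomial[OF g dc Obj_Mor[OF y]] True y c g bc z
              by (simp add: diagonal_def zero_mult)
          qed
        next
          case False
          then show ?thesis using mult_monomial[OF g dc Obj_Mor[OF y]] y z by auto
        qed
      qed
      then show "a \<in> carrier A \<and> diagonal a \<in> ?\<Phi> I"
        using ac dc skew_mult_closed[OF dc monomial_carrier] by (auto simp: right_core_def diagonal_in_def)
    next
      assume a: "a \<in> carrier A \<and> diagonal a \<in> ?\<Phi> I"
      note dc = diagonal_carrier[OF fin conjunct1[OF a]]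
      have "a \<otimes>\<^bsub>A\<^esub> unit y \<in> I" if y: "y \<in> Obj G" for y
      proof -
        have "(diagonal a \<otimes>\<^bsub>S\<^esub> monomial (unit y) y) y \<in> I"
          using a y by (simp add: right_core_def diagonal_in_def Obj_Mor)
        moreover have "(diagonal a \<otimes>\<^bsub>S\<^esub> monomial (unit y) y) y = a \<otimes>\<^bsub>A\<^esub> unit y"
          using mult_monomial[OF Obj_Mor[OF y] unit_D[OF Obj_Mor[OF y]] dc Obj_Mor[OF y]] y a
          by (simp add: diagonal_def act_Obj' Obj_Mor m_assoc)
        ultimately show ?thesis by simp
      qed
      then show "a \<in> I"
        using direct_sum_units[OF ds fin, of a] additive_subgroup_finsum[OF add fin, of "\<lambda>y. a \<otimes>\<^bsub>A\<^esub> unit y"] a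
        by simp
    }
  qed
  show "inj_on ?\<Phi> {I. right_ideal I A}"
    by (rule inj_onI) (use * in blast)
qed

end

section \<open>Finiteness of the support\<close>

context unital_partial_action
begin

lemma D_subset_Tgt:
  assumes "g \<in> Mor G"
  shows "D g \<subseteq> D (Tgt G g)"
proof -
  have "additive_subgroup (D g) (A\<lparr>carrier := D (Tgt G g)\<rparr>)"
    using ideal_in_Tgt[OF assms] unfolding rng_ideal_def left_ideal_def by blast
  from additive_subgroup.a_subset[OF this] show ?thesis by simp
qed

lemma alpha_central_idempotent:
  assumes g: "g \<in> Mor G" and e: "central_idempotent A e" "e \<in> D (ginv G g)"
  shows "central_idempotent A (\<alpha> g e)"
proof -
  let ?f = "\<alpha> g e"
  note eD = central_idempotentD[OF e(1)]
  have fD: "?f \<in> D g" using alpha_D[OF g e(2)] .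
  then have fc: "?f \<in> carrier A" using g D_carrier by blast
  have "?f \<otimes>\<^bsub>A\<^esub> ?f = ?f" using alpha_mult[OF g e(2) e(2)] eD(2) by simp
  moreover have "?f \<otimes>\<^bsub>A\<^esub> a = a \<otimes>\<^bsub>A\<^esub> ?f" if a: "a \<in> carrier A" for a
  proof -
    let ?b = "a \<otimes>\<^bsub>A\<^esub> unit g"
    let ?c = "\<alpha> (ginv G g) ?b"
    have b: "?b \<in> D g" using a g by (simp add: D_mult_left)
    have c: "?c \<in> D (ginv G g)" "\<alpha> g ?c = ?b"
      using alpha_D[of "ginv G g" ?b] alpha_ginv[of "ginv G g" ?b] b g by simp_all
    have cc: "?c \<in> carrier A" using c(1) g D_carrier[of "ginv G g"] by simp
    have "?f \<otimes>\<^bsub>A\<^esub> a = (?f \<otimes>\<^bsub>A\<^esub> unit g) \<otimes>\<^bsub>A\<^esub> a" using fD g by (simp add: D_unit)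
    also have "\<dots> = ?f \<otimes>\<^bsub>A\<^esub> ?b" using fc a g by (simp add: m_assoc unit_central[of g a])
    also have "\<dots> = \<alpha> g (e \<otimes>\<^bsub>A\<^esub> ?c)" using alpha_mult[OF g e(2) c(1)] c(2) by simp
    also have "\<dots> = \<alpha> g (?c \<otimes>\<^bsub>A\<^esub> e)" using eD(3)[OF cc] by simp
    also have "\<dots> = ?b \<otimes>\<^bsub>A\<^esub> ?f" using alpha_mult[OF g c(1) e(2)] c(2) by simp
    also have "\<dots> = a \<otimes>\<^bsub>A\<^esub> (?f \<otimes>\<^bsub>A\<^esub> unit g)" using fc a g by (simp add: m_assoc unit_central[of g ?f])
    also have "\<dots> = a \<otimes>\<^bsub>A\<^esub> ?f" using fD g by (simp add: D_unit)
    finally show ?thesis .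
  qed
  ultimately show ?thesis using fc unfolding central_idempotent_def by blast
qed

lemma alpha_nonzero:
  assumes "g \<in> Mor G" "e \<in> D (ginv G g)" "e \<noteq> \<zero>\<^bsub>A\<^esub>"
  shows "\<alpha> g e \<noteq> \<zero>\<^bsub>A\<^esub>"
  using alpha_ginv[OF assms(1,2)] assms alpha_zero[of "ginv G g"] by auto

lemma alpha_primitive_idempotent:
  assumes g: "g \<in> Mor G" and e: "primitive_idempotent e" "e \<in> D (ginv G g)"
  shows "primitive_idempotent (\<alpha> g e)"
proof -
  have ci: "central_idempotent A e" "e \<noteq> \<zero>\<^bsub>A\<^esub>" using e(1) unfolding primitive_idempotent_def by blast+
  let ?f = "\<alpha> g e"
  have fD: "?f \<in> D g" using alpha_D[OF g e(2)] .
  show ?thesis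
    unfolding primitive_idempotent_def
  proof (intro conjI allI impI)
    show "central_idempotent A ?f" by (rule alpha_central_idempotent[OF g ci(1) e(2)])
    show "?f \<noteq> \<zero>\<^bsub>A\<^esub>" by (rule alpha_nonzero[OF g e(2) ci(2)])
    fix h assume h: "central_idempotent A h \<and> h \<noteq> \<zero>\<^bsub>A\<^esub> \<and> h \<otimes>\<^bsub>A\<^esub> ?f = h"
    then have hc: "h \<in> carrier A" using central_idempotentD by blast
    have hD: "h \<in> D g" using D_mult_left[OF g fD hc] h by simp
    let ?h = "\<alpha> (ginv G g) h"
    have hD': "h \<in> D (ginv G (ginv G g))" using hD g by simp
    have g': "ginv G g \<in> Mor G" using g by simp
    have "central_idempotent A ?h" "?h \<noteq> \<zero>\<^bsub>A\<^esub>"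
      using alpha_central_idempotent[OF g' _ hD'] alpha_nonzero[OF g' hD'] h by auto
    moreover have "?h \<otimes>\<^bsub>A\<^esub> e = ?h"
    proof -
      have "?h \<otimes>\<^bsub>A\<^esub> \<alpha> (ginv G g) ?f = \<alpha> (ginv G g) (h \<otimes>\<^bsub>A\<^esub> ?f)"
        using alpha_mult[OF g' hD', of ?f] fD g by simp
      then show ?thesis using h alpha_ginv[OF g e(2)] by simp
    qed
    ultimately have "?h = e" using e(1) unfolding primitive_idempotent_def by blast
    then show "h = ?f" using alpha_ginv[OF g' hD'] g by simp
  qed
qed

section \<open>Stabilizers of primitive idempotents\<close>

definition idempotent_stabilizer :: "'a \<Rightarrow> 'c \<Rightarrow> 'a monoid" where
  "idempotent_stabilizer x e = \<lparr>carrier = {h \<in> isotropy G x. e \<in> D (ginv G h) \<and> \<alpha> h e = e},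
    monoid.mult = Comp G, one = x\<rparr>"

lemma stabilizerD:
  assumes "h \<in> carrier (idempotent_stabilizer x e)"
  shows "h \<in> Mor G" "Src G h = x" "Tgt G h = x" "e \<in> D (ginv G h)" "\<alpha> h e = e"
  using assms by (auto simp: idempotent_stabilizer_def isotropy_def)

lemma alpha_transfer:
  assumes g: "g \<in> Mor G" and h: "h \<in> Mor G" and gh: "Src G g = Tgt G h"
    and "e \<in> D (ginv G h)" "\<alpha> h e = f" "f \<in> D (ginv G g)" "\<alpha> g f = f'"
  shows "e \<in> D (ginv G (Comp G g h))" "\<alpha> (Comp G g h) e = f'"
  using act_Comp[OF g h gh, of e] assms by auto

lemma stabilizerI:
  assumes "h \<in> Mor G" "Src G h = x" "Tgt G h = x" "e \<in> D (ginv G h)" "\<alpha> h e = e"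
  shows "h \<in> carrier (idempotent_stabilizer x e)"
  using assms by (auto simp: idempotent_stabilizer_def isotropy_def)

text \<open>Domains cause no loss here: an element that fixes \<open>e\<close> returns it to the
  domain of the next one, so composites are defined at \<open>e\<close> and fix it.\<close>

lemma stabilizer_group:
  assumes x: "x \<in> Obj G" and e: "e \<in> D x"
  shows "Group.group (idempotent_stabilizer x e)"
    and "\<And>h. h \<in> carrier (idempotent_stabilizer x e) \<Longrightarrow> inv\<^bsub>idempotent_stabilizer x e\<^esub> h = ginv G h"
proof -
  have inv: "ginv G h \<in> carrier (idempotent_stabilizer x e)" if "h \<in> carrier (idempotent_stabilizer x e)" for h
  proof (rule stabilizerI)
    note h = stabilizerD[OF that]
    show "e \<in> D (ginv G (ginv G h))" using alpha_D[OF h(1,4)] h by simp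
    show "\<alpha> (ginv G h) e = e" using alpha_ginv[OF h(1,4)] h(5) by simp
  qed (use stabilizerD[OF that] in simp_all)
  have mult: "Comp G h k \<in> carrier (idempotent_stabilizer x e)"
    if "h \<in> carrier (idempotent_stabilizer x e)" "k \<in> carrier (idempotent_stabilizer x e)" for h k
  proof (rule stabilizerI)
    note h = stabilizerD[OF that(1)] and k = stabilizerD[OF that(2)]
    show "e \<in> D (ginv G (Comp G h k))" "\<alpha> (Comp G h k) e = e"
      using alpha_transfer[of h k e e e] h k by auto
    show "Comp G h k \<in> Mor G" "Src G (Comp G h k) = x" "Tgt G (Comp G h k) = x"
      using h k by (auto simp: Comp_Mor Src_Comp Tgt_Comp)
  qed
  have one: "x \<in> carrier (idempotent_stabilizer x e)"
    using x e act_Obj[OF x e] by (intro stabilizerI) (auto simp: Obj_Mor)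
  have simps: "\<one>\<^bsub>idempotent_stabilizer x e\<^esub> = x" "monoid.mult (idempotent_stabilizer x e) = Comp G" by (auto simp: idempotent_stabilizer_def)
  show grp: "Group.group (idempotent_stabilizer x e)"
  proof (rule groupI)
    show "h \<otimes>\<^bsub>idempotent_stabilizer x e\<^esub> k \<in> carrier (idempotent_stabilizer x e)"
      if "h \<in> carrier (idempotent_stabilizer x e)" "k \<in> carrier (idempotent_stabilizer x e)" for h k
      using mult that by (simp add: simps)
    show "\<exists>k\<in>carrier (idempotent_stabilizer x e). k \<otimes>\<^bsub>idempotent_stabilizer x e\<^esub> h = \<one>\<^bsub>idempotent_stabilizer x e\<^esub>"
      if "h \<in> carrier (idempotent_stabilizer x e)" for h
      using inv[OF that] stabilizerD[OF that] by (intro bexI[of _ "ginv G h"]) (simp_all add: simps)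
    show "h \<otimes>\<^bsub>idempotent_stabilizer x e\<^esub> k \<otimes>\<^bsub>idempotent_stabilizer x e\<^esub> l = h \<otimes>\<^bsub>idempotent_stabilizer x e\<^esub> (k \<otimes>\<^bsub>idempotent_stabilizer x e\<^esub> l)"
      if "h \<in> carrier (idempotent_stabilizer x e)" "k \<in> carrier (idempotent_stabilizer x e)" "l \<in> carrier (idempotent_stabilizer x e)" for h k l
      using that by (simp add: simps Comp_assoc stabilizerD)
    show "\<one>\<^bsub>idempotent_stabilizer x e\<^esub> \<otimes>\<^bsub>idempotent_stabilizer x e\<^esub> h = h" if "h \<in> carrier (idempotent_stabilizer x e)" for h
      using x stabilizerD[OF that] by (simp add: simps)
  qed (simp add: simps one)
  show "inv\<^bsub>idempotent_stabilizer x e\<^esub> h = ginv G h" if h: "h \<in> carrier (idempotent_stabilizer x e)" for h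
    by (rule group.inv_equality[OF grp _ h inv[OF h]]) (use stabilizerD[OF h] in \<open>simp add: simps\<close>)
qed

lemma unit_nonzero:
  assumes "g \<in> Mor G" "D g \<noteq> {\<zero>\<^bsub>A\<^esub>}"
  shows "unit g \<noteq> \<zero>\<^bsub>A\<^esub>"
proof
  assume "unit g = \<zero>\<^bsub>A\<^esub>"
  then have "D g \<subseteq> {\<zero>\<^bsub>A\<^esub>}" using D_iff[OF assms(1)] zero_mult by auto
  then show False using assms zero_D by blast
qed

text \<open>Each \<open>h\<close> with nonzero \<open>D h\<close> moves some primitive idempotent
  \<open>E h\<close> to a primitive idempotent. Only finitely many pairs of source and image exist,
  so infinitely many \<open>h\<close> share the pair of one \<open>h0\<close>, and the products of
  \<open>ginv G h0\<close> with these \<open>h\<close> all fix \<open>E h0\<close>.\<close>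

lemma infinite_stabilizer:
  assumes art: "left_artinian A" and x: "x \<in> Obj G"
    and inf: "infinite {h \<in> isotropy G x. D h \<noteq> {\<zero>\<^bsub>A\<^esub>}}"
  obtains e where "primitive_idempotent e" "e \<in> D x" "infinite (carrier (idempotent_stabilizer x e))"
proof -
  let ?H = "{h \<in> isotropy G x. D h \<noteq> {\<zero>\<^bsub>A\<^esub>}}"
  have H: "h \<in> Mor G" "Src G h = x" "Tgt G h = x" "D h \<noteq> {\<zero>\<^bsub>A\<^esub>}" if "h \<in> ?H" for h
    using that by (auto simp: isotropy_def)
  have "\<exists>e. primitive_idempotent e \<and> e \<in> D (ginv G h)" if h: "h \<in> ?H" for h
  proof -
    have h': "ginv G h \<in> Mor G" using H[OF h] by simp
    have "unit (ginv G h) \<noteq> \<zero>\<^bsub>A\<^esub>"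
      using alpha_unit[of h] unit_nonzero[of h] H[OF h] alpha_zero[of h] by auto
    moreover have "central_idempotent A (unit (ginv G h))"
      using generates_unit[OF h'] unfolding generates_unital_def by blast
    ultimately obtain e where "primitive_idempotent e" "e \<otimes>\<^bsub>A\<^esub> unit (ginv G h) = e"
      using exists_primitive_idempotent[OF art] by blast
    then show ?thesis
      using D_iff[OF h'] central_idempotentD(1) unfolding primitive_idempotent_def by blast
  qed
  then obtain E where E: "\<And>h. h \<in> ?H \<Longrightarrow> primitive_idempotent (E h) \<and> E h \<in> D (ginv G h)" by metis
  let ?f = "\<lambda>h. (E h, \<alpha> h (E h))"
  have "?f ` ?H \<subseteq> {e. primitive_idempotent e} \<times> {e. primitive_idempotent e}"
  proof (rule image_subsetI)
    fix h assume h: "h \<in> ?H"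
    then show "?f h \<in> {e. primitive_idempotent e} \<times> {e. primitive_idempotent e}"
      using E[OF h] alpha_primitive_idempotent[OF H(1)[OF h]] by simp
  qed
  then have "finite (?f ` ?H)" using finite_primitive_idempotents[OF art] finite_subset by blast
  then obtain h0 where h0: "h0 \<in> ?H" and inf0: "infinite {h \<in> ?H. ?f h = ?f h0}"
    using pigeonhole_infinite[OF inf] by blast
  let ?e = "E h0"
  let ?K = "{h \<in> ?H. ?f h = ?f h0}"
  note H0 = H[OF h0] and E0 = E[OF h0]
  have fD: "\<alpha> h0 ?e \<in> D h0" using alpha_D[of h0 ?e] H0 E0 by simp
  have "Comp G (ginv G h0) h \<in> carrier (idempotent_stabilizer x ?e)" if "h \<in> ?K" for h
  proof (rule stabilizerI)
    have h: "h \<in> ?H" "E h = ?e" "\<alpha> h ?e = \<alpha> h0 ?e" using that by auto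
    note Hh = H[OF h(1)]
    have "?e \<in> D (ginv G h)" using E[OF h(1)] h(2) by simp
    moreover have "\<alpha> h0 ?e \<in> D (ginv G (ginv G h0))" using fD H0 by simp
    ultimately show "?e \<in> D (ginv G (Comp G (ginv G h0) h))" "\<alpha> (Comp G (ginv G h0) h) ?e = ?e"
      using alpha_transfer[of "ginv G h0" h ?e "\<alpha> h0 ?e" ?e] H0 Hh h(3) alpha_ginv[of h0 ?e] E0 by simp_all
    show "Comp G (ginv G h0) h \<in> Mor G" "Src G (Comp G (ginv G h0) h) = x" "Tgt G (Comp G (ginv G h0) h) = x"
      using H0 Hh by (simp_all add: Comp_Mor Src_Comp Tgt_Comp)
  qed
  then have "(\<lambda>h. Comp G (ginv G h0) h) ` ?K \<subseteq> carrier (idempotent_stabilizer x ?e)" by blast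
  moreover have "inj_on (\<lambda>h. Comp G (ginv G h0) h) ?K"
  proof (rule inj_on_inverseI[where g = "Comp G h0"])
    fix h assume "h \<in> ?K"
    then have h: "h \<in> ?H" by blast
    show "Comp G h0 (Comp G (ginv G h0) h) = h"
      using Comp_ginv_cancel(2)[OF H0(1) H(1)[OF h]] H0(3) H(3)[OF h] by simp
  qed
  ultimately have "infinite (carrier (idempotent_stabilizer x ?e))"
    using inf0 by (meson finite_imageD finite_subset)
  moreover have "?e \<in> D x"
    using D_subset_Tgt[of "ginv G h0"] H0 E0 by auto
  ultimately show ?thesis using that E0 by blast
qed

lemma act_int_pow:
  assumes g: "g \<in> Mor G" and a: "a \<in> carrier A"
  shows "act g ([(k::int)] \<cdot>\<^bsub>A\<^esub> a) = [k] \<cdot>\<^bsub>A\<^esub> act g a"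
proof (induction k rule: int_induct[where k = 0])
  case base then show ?case using g by simp
next
  case (step1 i)
  then show ?case using g a by (simp add: add.int_pow_mult act_add)
next
  case (step2 i)
  have "act g (\<ominus>\<^bsub>A\<^esub> a) \<oplus>\<^bsub>A\<^esub> act g a = \<zero>\<^bsub>A\<^esub>"
    using g a by (simp add: act_add[symmetric] l_neg)
  then have "act g (\<ominus>\<^bsub>A\<^esub> a) = \<ominus>\<^bsub>A\<^esub> act g a"
    using g a by (intro minus_equality[symmetric]) simp_all
  then show ?case using step2 g a by (simp add: add.int_pow_diff act_add)
qed

lemma D_int_pow:
  assumes "g \<in> Mor G" "a \<in> D g"
  shows "[(k::int)] \<cdot>\<^bsub>A\<^esub> a \<in> D g"
  using assms D_carrier[OF assms] by (simp add: D_iff int_pow_mult_left)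

section \<open>From the skew ring to the group ring of a stabilizer\<close>

context
  fixes x e p M
  assumes x: "x \<in> Obj G" and e: "e \<in> carrier A" "e \<otimes>\<^bsub>A\<^esub> e = e" "e \<in> D x"
    and p: "prime_modulus p" and M: "saturated_subgroup p M" "e \<notin> M"
    and frac: "\<And>b. b \<in> carrier A \<Longrightarrow> \<exists>n m. \<not> p dvd n \<and> fraction_of M e b n m"
begin

abbreviation "H \<equiv> idempotent_stabilizer x e"

definition group_ring_lift :: "('a \<Rightarrow> int) \<Rightarrow> 'a \<Rightarrow> 'c" where
  "group_ring_lift v = (\<lambda>h. if h \<in> carrier H then [v h] \<cdot>\<^bsub>A\<^esub> unit h else \<zero>\<^bsub>A\<^esub>)"

text \<open>
  Read through the functional \<open>b \<mapsto> m/n\<close>, the coefficients on \<open>H\<close> form an element of the left ideal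
  of the group ring over the prime field that \<open>L\<close> stands for.
\<close>

definition fractions_in :: "('a \<Rightarrow> int) set \<Rightarrow> ('a \<Rightarrow> 'c) set" where
  "fractions_in L = {s. s \<in> carrier S \<and> (\<exists>n v. \<not> p dvd n \<and> v \<in> L \<and>
    (\<forall>h\<in>carrier H. fraction_of M e (e \<otimes>\<^bsub>A\<^esub> s h) n (v h)))}"

lemma e_unit: "h \<in> carrier H \<Longrightarrow> e \<otimes>\<^bsub>A\<^esub> unit h = e"
  using alpha_D[of h e] stabilizerD[of h x e] by (simp add: D_unit)

lemma group_ring_lift_carrier:
  assumes v: "v \<in> group_ring H"
  shows "group_ring_lift v \<in> carrier S"
proof (rule skew_carrierI[of _ "{h. v h \<noteq> 0}"])
  show "finite {h. v h \<noteq> 0}" using v by (rule group_ring_finite)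
  show "group_ring_lift v g \<in> D g" if "g \<in> Mor G" for g
    using that by (simp add: group_ring_lift_def D_int_pow)
  show "g \<in> {h. v h \<noteq> 0} \<and> g \<in> Mor G" if "group_ring_lift v g \<noteq> \<zero>\<^bsub>A\<^esub>" for g
    using that stabilizerD(1)[of g x e] by (auto simp: group_ring_lift_def split: if_splits)
qed

lemma fractions_in_subgroup:
  assumes L: "saturated_ideal p H L"
  shows "additive_subgroup (fractions_in L) S"
proof -
  interpret S: rng S by (rule skew_rng)
  note frac_lemmas = fraction_of_zero[OF M(1) e(1)] fraction_of_add[OF M(1) e(1)] fraction_of_minus[OF M(1) e(1)]
  have p1: "\<not> p dvd 1" using p by (simp add: prime_modulus_def)
  show ?thesis
    unfolding S.additive_subgroup_iff
  proof (intro conjI ballI)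
    show "fractions_in L \<subseteq> carrier S" by (auto simp: fractions_in_def)
    show "\<zero>\<^bsub>S\<^esub> \<in> fractions_in L"
      unfolding fractions_in_def mem_Collect_eq
      using S.zero_closed p1 sat_zero[OF L] e frac_lemmas(1)
      by (intro conjI exI[of _ 1] exI[of _ "\<lambda>_. 0"]) (simp_all add: zero_mult)
    show "s \<oplus>\<^bsub>S\<^esub> t \<in> fractions_in L" if st: "s \<in> fractions_in L" "t \<in> fractions_in L" for s t
    proof -
      obtain n v where s: "s \<in> carrier S" "\<not> p dvd n" "v \<in> L"
        "\<And>h. h \<in> carrier H \<Longrightarrow> fraction_of M e (e \<otimes>\<^bsub>A\<^esub> s h) n (v h)"
        using st(1) unfolding fractions_in_def by blast
      obtain n' v' where t: "t \<in> carrier S" "\<not> p dvd n'" "v' \<in> L"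
        "\<And>h. h \<in> carrier H \<Longrightarrow> fraction_of M e (e \<otimes>\<^bsub>A\<^esub> t h) n' (v' h)"
        using st(2) unfolding fractions_in_def by blast
      have "fraction_of M e (e \<otimes>\<^bsub>A\<^esub> (s \<oplus>\<^bsub>S\<^esub> t) h) (n * n') (n' * v h + n * v' h)" if "h \<in> carrier H" for h
        using frac_lemmas(2)[OF s(4)[OF that] _ t(4)[OF that]] s(1) t(1) e
        by (simp add: skew_add r_distr m_closed)
      moreover have "\<not> p dvd n * n'" using s(2) t(2) prime_modulusD[OF p] by blast
      moreover have "(\<lambda>h. n' * v h + n * v' h) \<in> L"
        by (intro sat_add[OF L] sat_scale[OF L] s t)
      ultimately show ?thesis
        unfolding fractions_in_def mem_Collect_eq using S.a_closed[OF s(1) t(1)]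
        by (intro conjI exI[of _ "n * n'"] exI[of _ "\<lambda>h. n' * v h + n * v' h"]) simp_all
    qed
    show "\<ominus>\<^bsub>S\<^esub> s \<in> fractions_in L" if st: "s \<in> fractions_in L" for s
    proof -
      obtain n v where s: "s \<in> carrier S" "\<not> p dvd n" "v \<in> L"
        "\<And>h. h \<in> carrier H \<Longrightarrow> fraction_of M e (e \<otimes>\<^bsub>A\<^esub> s h) n (v h)"
        using st(1) unfolding fractions_in_def by blast
      have "fraction_of M e (e \<otimes>\<^bsub>A\<^esub> (\<ominus>\<^bsub>S\<^esub> s) h) n (- v h)" if "h \<in> carrier H" for h
        using frac_lemmas(3)[OF s(4)[OF that]] s(1) e by (simp add: skew_minus uminus_mult m_closed)
      moreover have "(\<lambda>h. - v h) \<in> L" using sat_scale[OF L s(3), of "-1"] by simp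
      ultimately show ?thesis
        unfolding fractions_in_def mem_Collect_eq using S.a_inv_closed[OF s(1)] s(2)
        by (intro conjI exI[of _ n] exI[of _ "\<lambda>h. - v h"]) simp_all
    qed
  qed
qed

lemma group_ring_lift_iff:
  assumes L: "saturated_ideal p H L"
  shows "v \<in> L \<longleftrightarrow> v \<in> group_ring H \<and> group_ring_lift v \<in> left_core (fractions_in L)"
proof
  interpret H: group H by (rule stabilizer_group[OF x e(3)])
  have mult: "monoid.mult H = Comp G" by (simp add: idempotent_stabilizer_def)
  {
    assume v: "v \<in> L"
    then have vH: "v \<in> group_ring H" using sat_sub[OF L] by blast
    note lc = group_ring_lift_carrier[OF vH]
    have "monomial a g \<otimes>\<^bsub>S\<^esub> group_ring_lift v \<in> fractions_in L" if g: "g \<in> Mor G" "a \<in> D g" for g a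
    proof -
      have a: "a \<in> carrier A" using g D_carrier by blast
      have ea: "e \<otimes>\<^bsub>A\<^esub> a \<in> carrier A" using e a m_closed by simp
      note mc = skew_mult_closed[OF monomial_carrier[OF g] lc]
      let ?s = "monomial a g \<otimes>\<^bsub>S\<^esub> group_ring_lift v"
      show ?thesis
      proof (cases "g \<in> carrier H")
        case True
        note gD = stabilizerD[OF True]
        obtain n m where nm: "\<not> p dvd n" "fraction_of M e (e \<otimes>\<^bsub>A\<^esub> a) n m" using frac[OF ea] by blast
        have "fraction_of M e (e \<otimes>\<^bsub>A\<^esub> ?s h) n (m * translate H g v h)" if h: "h \<in> carrier H" for h
        proof -
          note hD = stabilizerD[OF h]
          let ?h = "Comp G (ginv G g) h"
          let ?k = "v ?h"
          have ginvH: "inv\<^bsub>H\<^esub> g = ginv G g" using stabilizer_group(2)[OF x e(3) True] .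
          have hH: "?h \<in> carrier H" using H.m_closed[OF H.inv_closed[OF True] h] unfolding ginvH mult .
          have hm: "?h \<in> Mor G" "Tgt G ?h = x" using stabilizerD[OF hH] by auto
          have gh: "Comp G g ?h = h" using Comp_ginv_cancel(2)[of g h] gD hD by simp
          have "?s h = a \<otimes>\<^bsub>A\<^esub> act g ([?k] \<cdot>\<^bsub>A\<^esub> unit ?h)"
            using monomial_mult[OF g lc hD(1)] gD hD hH by (simp add: group_ring_lift_def)
          also have "act g ([?k] \<cdot>\<^bsub>A\<^esub> unit ?h) = [?k] \<cdot>\<^bsub>A\<^esub> (unit g \<otimes>\<^bsub>A\<^esub> unit h)"
            using act_int_pow[OF g(1) unit_closed[OF hm(1)]] act_unit[of g ?h] gD hm gh by simp
          finally have "?s h = [?k] \<cdot>\<^bsub>A\<^esub> (a \<otimes>\<^bsub>A\<^esub> (unit g \<otimes>\<^bsub>A\<^esub> unit h))"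
            using a gD hD m_closed by (simp add: int_pow_mult_right)
          also have "a \<otimes>\<^bsub>A\<^esub> (unit g \<otimes>\<^bsub>A\<^esub> unit h) = unit h \<otimes>\<^bsub>A\<^esub> a"
            using a gD hD g by (simp add: m_assoc[symmetric] D_unit unit_central[of h a])
          finally have "e \<otimes>\<^bsub>A\<^esub> ?s h = [?k] \<cdot>\<^bsub>A\<^esub> (e \<otimes>\<^bsub>A\<^esub> (unit h \<otimes>\<^bsub>A\<^esub> a))"
            using e a hD m_closed by (simp add: int_pow_mult_right)
          also have "e \<otimes>\<^bsub>A\<^esub> (unit h \<otimes>\<^bsub>A\<^esub> a) = e \<otimes>\<^bsub>A\<^esub> a"
            using e a hD e_unit[OF h] by (simp add: m_assoc[symmetric])
          finally have eq: "e \<otimes>\<^bsub>A\<^esub> ?s h = [?k] \<cdot>\<^bsub>A\<^esub> (e \<otimes>\<^bsub>A\<^esub> a)" .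
          have "translate H g v h = ?k" using h ginvH by (simp add: translate_def mult)
          then show ?thesis
            using fraction_of_scale[OF M(1) e(1) nm(2) ea, of ?k] unfolding eq by (simp add: mult.commute)
        qed
        moreover have "(\<lambda>h. m * translate H g v h) \<in> L"
          by (intro sat_scale[OF L] sat_translate[OF L True v])
        ultimately show ?thesis
          unfolding fractions_in_def mem_Collect_eq using mc nm(1)
          by (intro conjI exI[of _ n] exI[of _ "\<lambda>h. m * translate H g v h"]) simp_all
      next
        case False
        have "?s h = \<zero>\<^bsub>A\<^esub>" if h: "h \<in> carrier H" for h
        proof (cases "Tgt G g = Tgt G h")
          case True
          note hD = stabilizerD[OF h]
          let ?h = "Comp G (ginv G g) h"
          have "?h \<notin> carrier H"
          proof
            assume hH: "?h \<in> carrier H"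
            note hhD = stabilizerD[OF hH]
            have "Src G g = x" using hhD(3) Tgt_Comp[of "ginv G g" h] g hD True by simp
            have "ginv G ?h \<in> carrier H"
              using H.inv_closed[OF hH] stabilizer_group(2)[OF x e(3) hH] by simp
            from H.m_closed[OF h this] have "Comp G h (ginv G ?h) \<in> carrier H" by (simp add: mult)
            moreover have "Comp G h (ginv G ?h) = g"
              using Comp_ginv_cancel(3)[of g ?h] Comp_ginv_cancel(2)[of g h] g hD hhD True \<open>Src G g = x\<close> by simp
            ultimately show False using False by simp
          qed
          then show ?thesis
            using monomial_mult[OF g lc hD(1)] True g a by (simp add: group_ring_lift_def zero_mult)
        next
          case False
          then show ?thesis using monomial_mult[OF g lc stabilizerD(1)[OF h]] by simp
        qed
        then have "fraction_of M e (e \<otimes>\<^bsub>A\<^esub> ?s h) 1 0" if "h \<in> carrier H" for h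
          using that e fraction_of_zero[OF M(1) e(1)] by (simp add: zero_mult)
        moreover have "\<not> p dvd 1" using p by (simp add: prime_modulus_def)
        ultimately show ?thesis
          unfolding fractions_in_def mem_Collect_eq using mc sat_zero[OF L]
          by (intro conjI exI[of _ 1] exI[of _ "\<lambda>h. 0"]) simp_all
      qed
    qed
    then show "v \<in> group_ring H \<and> group_ring_lift v \<in> left_core (fractions_in L)"
      using vH lc by (simp add: left_core_def)
  next
    assume v: "v \<in> group_ring H \<and> group_ring_lift v \<in> left_core (fractions_in L)"
    then have vH: "v \<in> group_ring H" by blast
    note lc = group_ring_lift_carrier[OF vH]
    have xM: "x \<in> Mor G" using x by (rule Obj_Mor)
    \<comment> \<open>Testing with the identity at \<open>x\<close> turns the coefficient at h,
      multiplied by \<open>e\<close>, into the multiple of \<open>e\<close> by \<open>v h\<close>.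
      Uniqueness of fractions then makes \<open>n * v h\<close> and \<open>w h\<close> congruent
      modulo \<open>p\<close>, and saturation of \<open>L\<close> removes \<open>n\<close>.\<close>
    let ?s = "monomial (unit x) x \<otimes>\<^bsub>S\<^esub> group_ring_lift v"
    have "?s \<in> fractions_in L" using v xM by (simp add: left_core_def)
    then obtain n w where nw: "\<not> p dvd n" "w \<in> L"
      "\<And>h. h \<in> carrier H \<Longrightarrow> fraction_of M e (e \<otimes>\<^bsub>A\<^esub> ?s h) n (w h)"
      unfolding fractions_in_def by blast
    have dvd: "p dvd n * v h - w h" if h: "h \<in> carrier H" for h
    proof -
      note hD = stabilizerD[OF h]
      have "?s h = unit x \<otimes>\<^bsub>A\<^esub> act x ([v h] \<cdot>\<^bsub>A\<^esub> unit h)"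
        using monomial_mult[OF xM unit_D[OF xM] lc hD(1)] hD x h by (simp add: group_ring_lift_def)
      also have "\<dots> = unit x \<otimes>\<^bsub>A\<^esub> ([v h] \<cdot>\<^bsub>A\<^esub> unit h \<otimes>\<^bsub>A\<^esub> unit x)"
        using act_Obj'[OF x] hD by simp
      finally have "e \<otimes>\<^bsub>A\<^esub> ?s h = (e \<otimes>\<^bsub>A\<^esub> unit x) \<otimes>\<^bsub>A\<^esub> ([v h] \<cdot>\<^bsub>A\<^esub> unit h \<otimes>\<^bsub>A\<^esub> unit x)"
        using e xM hD m_closed by (simp add: m_assoc)
      also have "\<dots> = e \<otimes>\<^bsub>A\<^esub> [v h] \<cdot>\<^bsub>A\<^esub> unit h \<otimes>\<^bsub>A\<^esub> unit x"
        using e xM hD by (simp add: m_assoc D_unit)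
      also have "\<dots> = [v h] \<cdot>\<^bsub>A\<^esub> e"
        using e xM hD e_unit[OF h] by (simp add: int_pow_mult_right int_pow_mult_left D_unit)
      finally show ?thesis using fraction_of_multiple[OF M(1) e(1) _ M(2)] nw(3)[OF h] by simp
    qed
    have wH: "w \<in> group_ring H" using sat_sub[OF L nw(2)] .
    have "(\<lambda>h. n * v h - w h) \<in> L"
    proof (rule sat_dvd[OF L group_ring_diff[OF group_ring_scale[OF vH] wH]])
      show "p dvd n * v h - w h" for h
        using dvd group_ring_outside[OF vH] group_ring_outside[OF wH] by (cases "h \<in> carrier H") auto
    qed
    from sat_add[OF L this nw(2)] have "(\<lambda>h. n * v h) \<in> L" by simp
    then show "v \<in> L" using sat_cancel[OF L vH nw(1)] by blast
  }
qed

lemma stabilizer_group_ring_dcc: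
  assumes art: "left_artinian S"
  shows "group_ring_dcc p H"
  unfolding group_ring_dcc_def
proof (rule dcc_embed)
  let ?\<Phi> = "\<lambda>L. left_core (fractions_in L)"
  show "dcc {I. left_ideal I S}" using art by (simp add: left_artinian_iff_dcc)
  show "?\<Phi> L \<in> {I. left_ideal I S}" if "L \<in> {L. saturated_ideal p H L}" for L
    using that left_core_left_ideal[OF fractions_in_subgroup] by blast
  show "?\<Phi> I \<subseteq> ?\<Phi> J" if "I \<subseteq> J" for I J
    using that by (intro left_core_mono) (auto simp: fractions_in_def)
  show "inj_on ?\<Phi> {L. saturated_ideal p H L}"
  proof (rule inj_onI)
    fix I J assume "I \<in> {L. saturated_ideal p H L}" "J \<in> {L. saturated_ideal p H L}" "?\<Phi> I = ?\<Phi> J"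
    then show "I = J" using group_ring_lift_iff[of I] group_ring_lift_iff[of J] by blast
  qed
qed

end

lemma finite_support_isotropy:
  assumes art: "left_artinian S" "left_artinian A" and x: "x \<in> Obj G"
  shows "finite {h \<in> isotropy G x. D h \<noteq> {\<zero>\<^bsub>A\<^esub>}}"
proof (rule ccontr)
  assume "infinite {h \<in> isotropy G x. D h \<noteq> {\<zero>\<^bsub>A\<^esub>}}"
  then obtain e where e: "primitive_idempotent e" "e \<in> D x" and inf: "infinite (carrier (idempotent_stabilizer x e))"
    using infinite_stabilizer[OF art(2) x] by blast
  then have ce: "e \<in> carrier A" "e \<otimes>\<^bsub>A\<^esub> e = e" "e \<noteq> \<zero>\<^bsub>A\<^esub>"
    using central_idempotentD(1,2) unfolding primitive_idempotent_def by blast+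
  obtain p where p: "prime_modulus p" "\<And>n a. \<lbrakk>a \<in> carrier A; \<not> p dvd n\<rbrakk> \<Longrightarrow> [n] \<cdot>\<^bsub>A\<^esub> e \<noteq> [p] \<cdot>\<^bsub>A\<^esub> a"
    using exists_prime_modulus[OF ce] by blast
  obtain M where M: "saturated_subgroup p M" "e \<notin> M"
    and frac: "\<And>b. b \<in> carrier A \<Longrightarrow> \<exists>n m. \<not> p dvd n \<and> fraction_of M e b n m"
    using exists_functional_kernel[OF p(1) ce(1) p(2)] unfolding fraction_of_def by blast
  interpret H: group "idempotent_stabilizer x e" by (rule stabilizer_group[OF x e(2)])
  show False
    using H.group_ring_dcc_finite[OF stabilizer_group_ring_dcc[OF x ce(1,2) e(2) p(1) M frac art(1)] p(1)] inf
    by blast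
qed

section \<open>From one isotropy group to the whole groupoid\<close>

lemma D_nonzeroI:
  assumes "a \<in> D g" "a \<noteq> \<zero>\<^bsub>A\<^esub>"
  shows "D g \<noteq> {\<zero>\<^bsub>A\<^esub>}"
  using assms by auto

text \<open>The injective map \<open>\<alpha> k\<close> is defined on all of \<open>D g\<close>, so
  it sends the nonzero \<open>unit g\<close> to a nonzero element of
  \<open>D (Comp G k g)\<close>.\<close>

lemma D_nonzero_Comp_left:
  assumes g: "g \<in> Mor G" and k: "k \<in> Mor G" "Src G k = Tgt G g" "D g \<subseteq> D (ginv G k)" and nz: "D g \<noteq> {\<zero>\<^bsub>A\<^esub>}"
  shows "D (Comp G k g) \<noteq> {\<zero>\<^bsub>A\<^esub>}"
proof (rule D_nonzeroI)
  show "act k (unit g) \<in> D (Comp G k g)" using act_shift_D[OF k(1) g k(2)] g by simp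
  have "unit g \<in> D (ginv G k)" using k(3) g by auto
  then show "act k (unit g) \<noteq> \<zero>\<^bsub>A\<^esub>"
    using act_alpha[OF k(1)] alpha_nonzero[OF k(1)] unit_nonzero[OF g nz] by simp
qed

text \<open>The witness is \<open>unit g\<close>. It is the image under \<open>\<alpha> g\<close> of
  \<open>unit (ginv G g)\<close>, which lies in \<open>D k\<close>, so it belongs to
  \<open>D (Comp G g k)\<close>.\<close>

lemma D_nonzero_Comp_right:
  assumes g: "g \<in> Mor G" and k: "k \<in> Mor G" "Src G g = Tgt G k" "D (ginv G g) \<subseteq> D k" and nz: "D g \<noteq> {\<zero>\<^bsub>A\<^esub>}"
  shows "D (Comp G g k) \<noteq> {\<zero>\<^bsub>A\<^esub>}"
proof (rule D_nonzeroI)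
  have "unit (ginv G g) \<in> D (ginv G g)" using g by simp
  then show "act g (unit (ginv G g)) \<in> D (Comp G g k)"
    using act_shift_D[OF g k(1,2)] k(3) by blast
  have "act g (unit (ginv G g)) = unit g" using act_alpha[OF g] alpha_unit[OF g] g by simp
  then show "act g (unit (ginv G g)) \<noteq> \<zero>\<^bsub>A\<^esub>" using unit_nonzero[OF g nz] by simp
qed

text \<open>Composing \<open>g\<close> with transversal elements and their inverses gives a loop at
  \<open>x\<close>, and this loop together with the source and target of \<open>g\<close> determines
  \<open>g\<close>. Group type makes the ideals of \<open>\<tau> y\<close> and of its inverse as
  large as possible, so none of the four multiplications can send a nonzero \<open>D g\<close> to
  zero. The transversal is based at some \<open>w\<close> that may differ from \<open>x\<close>; the
  two outer factors move the loop from \<open>w\<close> to \<open>x\<close>.\<close>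

lemma finite_support:
  assumes gt: "group_type G D" and x: "x \<in> Obj G" and fin: "finite (Obj G)"
    and finx: "finite {h \<in> isotropy G x. D h \<noteq> {\<zero>\<^bsub>A\<^esub>}}"
  shows "finite {g \<in> Mor G. D g \<noteq> {\<zero>\<^bsub>A\<^esub>}}"
proof -
  obtain w \<tau> where w: "w \<in> Obj G" and \<tau>': "transversal G w \<tau>"
    and D\<tau>: "\<And>y. y \<in> Obj G \<Longrightarrow> D (ginv G (\<tau> y)) = D w \<and> D (\<tau> y) = D y"
    using gt unfolding group_type_def by blast
  have \<tau>: "\<tau> y \<in> Mor G" "Src G (\<tau> y) = w" "Tgt G (\<tau> y) = y" if "y \<in> Obj G" for y
    using \<tau>' that unfolding transversal_def by blast+
  let ?T = "{g \<in> Mor G. D g \<noteq> {\<zero>\<^bsub>A\<^esub>}}"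
  let ?k1 = "\<lambda>g. Comp G (ginv G (\<tau> (Tgt G g))) g"
  let ?k2 = "\<lambda>g. Comp G (?k1 g) (\<tau> (Src G g))"
  let ?k3 = "\<lambda>g. Comp G (\<tau> x) (?k2 g)"
  let ?k4 = "\<lambda>g. Comp G (?k3 g) (ginv G (\<tau> x))"
  let ?f = "\<lambda>g. (Src G g, Tgt G g, ?k4 g)"
  note \<tau>x = \<tau>[OF x]
  have props: "?k1 g \<in> Mor G \<and> Src G (?k1 g) = Src G g \<and> Tgt G (?k1 g) = w"
    "?k2 g \<in> Mor G \<and> Src G (?k2 g) = w \<and> Tgt G (?k2 g) = w"
    "?k3 g \<in> Mor G \<and> Src G (?k3 g) = w \<and> Tgt G (?k3 g) = x"
    "?k4 g \<in> Mor G \<and> Src G (?k4 g) = x \<and> Tgt G (?k4 g) = x" if g: "g \<in> Mor G" for g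
  proof -
    note s = \<tau>[OF Src_in_Obj[OF g]] and t = \<tau>[OF Tgt_in_Obj[OF g]]
    show 1: "?k1 g \<in> Mor G \<and> Src G (?k1 g) = Src G g \<and> Tgt G (?k1 g) = w"
      using g t by (simp add: Comp_Mor Src_Comp Tgt_Comp)
    show 2: "?k2 g \<in> Mor G \<and> Src G (?k2 g) = w \<and> Tgt G (?k2 g) = w"
      using 1 s by (simp add: Comp_Mor Src_Comp Tgt_Comp)
    show 3: "?k3 g \<in> Mor G \<and> Src G (?k3 g) = w \<and> Tgt G (?k3 g) = x"
      using 2 \<tau>x by (simp add: Comp_Mor Src_Comp Tgt_Comp)
    show "?k4 g \<in> Mor G \<and> Src G (?k4 g) = x \<and> Tgt G (?k4 g) = x"
      using 3 \<tau>x by (simp add: Comp_Mor Src_Comp Tgt_Comp)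
  qed
  have Dinv: "D (ginv G k) \<subseteq> D (Src G k)" if "k \<in> Mor G" for k
    using D_subset_Tgt[of "ginv G k"] that by simp
  have "?f ` ?T \<subseteq> Obj G \<times> Obj G \<times> {h \<in> isotropy G x. D h \<noteq> {\<zero>\<^bsub>A\<^esub>}}"
  proof (rule image_subsetI)
    fix g assume "g \<in> ?T"
    then have g: "g \<in> Mor G" "D g \<noteq> {\<zero>\<^bsub>A\<^esub>}" by auto
    note s = \<tau>[OF Src_in_Obj[OF g(1)]] and t = \<tau>[OF Tgt_in_Obj[OF g(1)]] and pr = props[OF g(1)]
    have "D (?k1 g) \<noteq> {\<zero>\<^bsub>A\<^esub>}"
      using D_nonzero_Comp_left[of g "ginv G (\<tau> (Tgt G g))"] g t D\<tau>[OF Tgt_in_Obj[OF g(1)]] D_subset_Tgt[OF g(1)] by simp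
    then have "D (?k2 g) \<noteq> {\<zero>\<^bsub>A\<^esub>}"
      using D_nonzero_Comp_right[of "?k1 g" "\<tau> (Src G g)"] g s pr(1) D\<tau>[OF Src_in_Obj[OF g(1)]] Dinv[of "?k1 g"] by simp
    then have "D (?k3 g) \<noteq> {\<zero>\<^bsub>A\<^esub>}"
      using D_nonzero_Comp_left[of "?k2 g" "\<tau> x"] pr(2) \<tau>x D\<tau>[OF x] D_subset_Tgt[of "?k2 g"] by simp
    then have "D (?k4 g) \<noteq> {\<zero>\<^bsub>A\<^esub>}"
      using D_nonzero_Comp_right[of "?k3 g" "ginv G (\<tau> x)"] pr(3) \<tau>x D\<tau>[OF x] Dinv[of "?k3 g"] by simp
    then show "?f g \<in> Obj G \<times> Obj G \<times> {h \<in> isotropy G x. D h \<noteq> {\<zero>\<^bsub>A\<^esub>}}"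
      using g pr(4) by (simp add: isotropy_def)
  qed
  moreover have "inj_on ?f ?T"
  proof (rule inj_onI)
    fix g h assume gh: "g \<in> ?T" "h \<in> ?T" "?f g = ?f h"
    then have m: "g \<in> Mor G" "h \<in> Mor G" and eq: "Src G g = Src G h" "Tgt G g = Tgt G h" "?k4 g = ?k4 h" by auto
    have recover: "?k3 k = Comp G (?k4 k) (\<tau> x)" "?k2 k = Comp G (ginv G (\<tau> x)) (?k3 k)"
      "?k1 k = Comp G (?k2 k) (ginv G (\<tau> (Src G k)))" "k = Comp G (\<tau> (Tgt G k)) (?k1 k)"
      if k: "k \<in> Mor G" for k
    proof -
      note s = \<tau>[OF Src_in_Obj[OF k]] and t = \<tau>[OF Tgt_in_Obj[OF k]] and pr = props[OF k]
      show "?k3 k = Comp G (?k4 k) (\<tau> x)"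
        using Comp_ginv_cancel(3)[of "?k3 k" "ginv G (\<tau> x)"] pr(3) \<tau>x by simp
      show "?k2 k = Comp G (ginv G (\<tau> x)) (?k3 k)"
        using Comp_ginv_cancel(1)[of "\<tau> x" "?k2 k"] pr(2) \<tau>x by simp
      show "?k1 k = Comp G (?k2 k) (ginv G (\<tau> (Src G k)))"
        using Comp_ginv_cancel(3)[of "?k1 k" "\<tau> (Src G k)"] pr(1) s by simp
      show "k = Comp G (\<tau> (Tgt G k)) (?k1 k)"
        using Comp_ginv_cancel(2)[of "\<tau> (Tgt G k)" k] k t by simp
    qed
    have "?k3 g = ?k3 h" using recover(1)[OF m(1)] recover(1)[OF m(2)] eq(3) by (metis (no_types))
    then have "?k2 g = ?k2 h" using recover(2)[OF m(1)] recover(2)[OF m(2)] by (metis (no_types))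
    then have "?k1 g = ?k1 h" using recover(3)[OF m(1)] recover(3)[OF m(2)] eq(1) by (metis (no_types))
    then show "g = h" using recover(4)[OF m(1)] recover(4)[OF m(2)] eq(2) by (metis (no_types))
  qed
  moreover have "finite (Obj G \<times> Obj G \<times> {h \<in> isotropy G x. D h \<noteq> {\<zero>\<^bsub>A\<^esub>}})" using fin finx by simp
  ultimately show ?thesis by (meson finite_imageD finite_subset)
qed

section \<open>Lifting the chain conditions from the base ring\<close>

definition supported :: "'a set \<Rightarrow> ('a \<Rightarrow> 'c) set \<Rightarrow> ('a \<Rightarrow> 'c) set" where
  "supported F I = {u \<in> I. {g. u g \<noteq> \<zero>\<^bsub>A\<^esub>} \<subseteq> F}"

text \<open>Induction on a finite set \<open>F\<close> that bounds the supports. Two elements with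
  the same coefficient at a new index \<open>g\<close> differ by one supported in \<open>F\<close>,
  so the chain is constant as soon as its coefficients at \<open>g\<close> and its part supported in
  \<open>F\<close> are. Only indices with nonzero ideal occur in supports, so finitely many steps
  reach the chain itself.\<close>

lemma chain_stabilizes:
  fixes I :: "nat \<Rightarrow> ('a \<Rightarrow> 'c) set"
  assumes T: "finite {g \<in> Mor G. D g \<noteq> {\<zero>\<^bsub>A\<^esub>}}"
    and I: "\<And>n. additive_subgroup (I n) S" "\<And>n. I (Suc n) \<subseteq> I n"
    and J: "\<And>g F. g \<in> Mor G \<Longrightarrow> \<exists>N. \<forall>n\<ge>N. (\<lambda>u. u g) ` supported F (I n) = (\<lambda>u. u g) ` supported F (I N)"
  shows "\<exists>N. \<forall>n\<ge>N. I n = I N"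
proof -
  interpret S: rng S by (rule skew_rng)
  have sub: "I n \<subseteq> carrier S" and zero: "\<zero>\<^bsub>S\<^esub> \<in> I n" and add: "\<And>u v. \<lbrakk>u \<in> I n; v \<in> I n\<rbrakk> \<Longrightarrow> u \<oplus>\<^bsub>S\<^esub> v \<in> I n"
    and minus: "\<And>u. u \<in> I n \<Longrightarrow> \<ominus>\<^bsub>S\<^esub> u \<in> I n" for n
    using I(1)[of n] unfolding S.additive_subgroup_iff by blast+
  have dec: "I n \<subseteq> I m" if "m \<le> n" for m n using I(2) that by (rule lift_Suc_antimono_le)
  have *: "\<exists>N. \<forall>n\<ge>N. supported F (I n) = supported F (I N)" if "finite F" "F \<subseteq> Mor G" for F
    using that
  proof (induction F rule: finite_induct)
    case empty
    have "supported {} (I n) = {\<zero>\<^bsub>S\<^esub>}" for n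
      using zero by (auto simp: supported_def)
    then show ?case by simp
  next
    case (insert g F)
    then obtain N1 where N1: "\<And>n. n \<ge> N1 \<Longrightarrow> supported F (I n) = supported F (I N1)" by auto
    obtain N2 where N2: "\<And>n. n \<ge> N2 \<Longrightarrow>
        (\<lambda>u. u g) ` supported (insert g F) (I n) = (\<lambda>u. u g) ` supported (insert g F) (I N2)"
      using J[of g "insert g F"] insert.prems by blast
    let ?N = "max N1 N2"
    have "supported (insert g F) (I n) = supported (insert g F) (I ?N)" if n: "n \<ge> ?N" for n
    proof
      show "supported (insert g F) (I n) \<subseteq> supported (insert g F) (I ?N)"
        using dec[OF n] by (auto simp: supported_def)
      show "supported (insert g F) (I ?N) \<subseteq> supported (insert g F) (I n)"
      proof
        fix u assume u: "u \<in> supported (insert g F) (I ?N)"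
        then have "u g \<in> (\<lambda>u. u g) ` supported (insert g F) (I n)"
          using N2[of n] N2[of ?N] n by auto
        then obtain v where v: "v \<in> supported (insert g F) (I n)" "v g = u g" by auto
        have uI: "u \<in> I ?N" "u \<in> carrier S" and vI: "v \<in> I n" "v \<in> I ?N" "v \<in> carrier S"
          using u v dec[OF n] sub by (auto simp: supported_def)
        let ?d = "u \<oplus>\<^bsub>S\<^esub> \<ominus>\<^bsub>S\<^esub> v"
        have d: "?d h = u h \<oplus>\<^bsub>A\<^esub> \<ominus>\<^bsub>A\<^esub> v h" for h using vI by (simp add: skew_add skew_minus)
        have "?d \<in> supported F (I ?N)"
          unfolding supported_def mem_Collect_eq
        proof (intro conjI subsetI)
          show "?d \<in> I ?N" by (intro add minus uI vI)
          fix h assume "h \<in> {h. ?d h \<noteq> \<zero>\<^bsub>A\<^esub>}"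
          then have nz: "u h \<oplus>\<^bsub>A\<^esub> \<ominus>\<^bsub>A\<^esub> v h \<noteq> \<zero>\<^bsub>A\<^esub>" using d by simp
          then have "h \<noteq> g" using v(2) uI by (auto simp: r_neg)
          moreover have "u h \<noteq> \<zero>\<^bsub>A\<^esub> \<or> v h \<noteq> \<zero>\<^bsub>A\<^esub>" using nz uminus_zero by auto
          ultimately show "h \<in> F" using u v(1) by (auto simp: supported_def)
        qed
        then have "?d \<in> I n" using N1[of n] N1[of ?N] n by (auto simp: supported_def)
        then have "?d \<oplus>\<^bsub>S\<^esub> v \<in> I n" using add vI by blast
        moreover have "?d \<oplus>\<^bsub>S\<^esub> v = u" using uI vI by (simp add: S.a_assoc S.l_neg del: skew_zero)
        ultimately show "u \<in> supported (insert g F) (I n)" using u by (auto simp: supported_def)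
      qed
    qed
    then show ?case by blast
  qed
  have "g \<in> {g \<in> Mor G. D g \<noteq> {\<zero>\<^bsub>A\<^esub>}}" if u: "u \<in> I n" and ug: "u g \<noteq> \<zero>\<^bsub>A\<^esub>" for u g n
  proof -
    have uc: "u \<in> carrier S" using u sub by blast
    have "g \<in> Mor G" using skew_support[OF uc ug] .
    then show ?thesis using D_nonzeroI[OF skew_D[OF uc] ug] by simp
  qed
  then have "supported {g \<in> Mor G. D g \<noteq> {\<zero>\<^bsub>A\<^esub>}} (I n) = I n" for n
    unfolding supported_def by blast
  then show ?thesis using *[OF T] by simp
qed

lemma additive_image:
  assumes I: "additive_subgroup I S" and g: "g \<in> Mor G"
  shows "additive_subgroup ((\<lambda>u. u g) ` supported F I) A"
proof -
  interpret S: rng S by (rule skew_rng)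
  have sub: "I \<subseteq> carrier S" and zero: "\<zero>\<^bsub>S\<^esub> \<in> I" and add: "\<And>u v. \<lbrakk>u \<in> I; v \<in> I\<rbrakk> \<Longrightarrow> u \<oplus>\<^bsub>S\<^esub> v \<in> I"
    and minus: "\<And>u. u \<in> I \<Longrightarrow> \<ominus>\<^bsub>S\<^esub> u \<in> I"
    using I unfolding S.additive_subgroup_iff by blast+
  show ?thesis
    unfolding additive_subgroup_iff
  proof (intro conjI ballI)
    show "(\<lambda>u. u g) ` supported F I \<subseteq> carrier A" using sub by (auto simp: supported_def)
    show "\<zero>\<^bsub>A\<^esub> \<in> (\<lambda>u. u g) ` supported F I"
      using zero by (intro image_eqI[of _ _ "\<zero>\<^bsub>S\<^esub>"]) (auto simp: supported_def)
    show "a \<oplus>\<^bsub>A\<^esub> b \<in> (\<lambda>u. u g) ` supported F I"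
      if ab: "a \<in> (\<lambda>u. u g) ` supported F I" "b \<in> (\<lambda>u. u g) ` supported F I" for a b
    proof -
      obtain u v where uv: "a = u g" "u \<in> supported F I" "b = v g" "v \<in> supported F I" using ab by blast
      have "{h. (u \<oplus>\<^bsub>S\<^esub> v) h \<noteq> \<zero>\<^bsub>A\<^esub>} \<subseteq> F"
      proof
        fix h assume "h \<in> {h. (u \<oplus>\<^bsub>S\<^esub> v) h \<noteq> \<zero>\<^bsub>A\<^esub>}"
        then have "u h \<noteq> \<zero>\<^bsub>A\<^esub> \<or> v h \<noteq> \<zero>\<^bsub>A\<^esub>" by (auto simp: skew_add)
        then show "h \<in> F" using uv by (auto simp: supported_def)
      qed
      then have "u \<oplus>\<^bsub>S\<^esub> v \<in> supported F I" using uv add by (simp add: supported_def)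
      then show ?thesis using uv by (intro image_eqI[of _ _ "u \<oplus>\<^bsub>S\<^esub> v"]) (simp_all add: skew_add)
    qed
    show "\<ominus>\<^bsub>A\<^esub> a \<in> (\<lambda>u. u g) ` supported F I" if a: "a \<in> (\<lambda>u. u g) ` supported F I" for a
    proof -
      obtain u where u: "a = u g" "u \<in> supported F I" using a by blast
      then have uc: "u \<in> carrier S" using sub by (auto simp: supported_def)
      have "{h. (\<ominus>\<^bsub>S\<^esub> u) h \<noteq> \<zero>\<^bsub>A\<^esub>} \<subseteq> F"
        using u uminus_zero by (auto simp: supported_def skew_minus[OF uc])
      then have "\<ominus>\<^bsub>S\<^esub> u \<in> supported F I" using u minus by (simp add: supported_def)
      then show ?thesis using u by (intro image_eqI[of _ _ "\<ominus>\<^bsub>S\<^esub> u"]) (simp_all add: skew_minus[OF uc])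
    qed
  qed
qed

text \<open>Left multiplication by a monomial at the object \<open>Tgt G g\<close> multiplies the
  coefficients with that target by \<open>b\<close> and kills the others. It enlarges no support, so
  the coefficients at \<open>g\<close> of the elements supported in \<open>F\<close> form a left
  ideal of A.\<close>

lemma left_artinian_skew:
  assumes T: "finite {g \<in> Mor G. D g \<noteq> {\<zero>\<^bsub>A\<^esub>}}" and art: "left_artinian A"
  shows "left_artinian S"
  unfolding left_artinian_def
proof (intro allI impI)
  fix I :: "nat \<Rightarrow> ('a \<Rightarrow> 'c) set"
  assume I: "(\<forall>n. left_ideal (I n) S) \<and> (\<forall>n. I (Suc n) \<subseteq> I n)"
  have add: "additive_subgroup (I n) S" and mult: "\<And>r u. \<lbrakk>r \<in> carrier S; u \<in> I n\<rbrakk> \<Longrightarrow> r \<otimes>\<^bsub>S\<^esub> u \<in> I n" for n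
    using I unfolding left_ideal_def by blast+
  interpret S: rng S by (rule skew_rng)
  have sub: "I n \<subseteq> carrier S" for n using add[of n] unfolding S.additive_subgroup_iff by blast
  show "\<exists>N. \<forall>n\<ge>N. I n = I N"
  proof (rule chain_stabilizes[OF T add])
    show "I (Suc n) \<subseteq> I n" for n using I by blast
    fix g F assume g: "g \<in> Mor G"
    let ?J = "\<lambda>n. (\<lambda>u. u g) ` supported F (I n)"
    have "left_ideal (?J n) A" for n
      unfolding left_ideal_def
    proof (intro conjI ballI)
      show "additive_subgroup (?J n) A" by (rule additive_image[OF add g])
      fix b c assume b: "b \<in> carrier A" and "c \<in> ?J n"
      then obtain u where u: "c = u g" "u \<in> supported F (I n)" by blast
      then have uI: "u \<in> I n" and uc: "u \<in> carrier S" using sub by (auto simp: supported_def)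
      let ?z = "Tgt G g"
      have z: "?z \<in> Obj G" "?z \<in> Mor G" using g Obj_Mor by auto
      let ?m = "monomial (b \<otimes>\<^bsub>A\<^esub> unit ?z) ?z"
      have bz: "b \<otimes>\<^bsub>A\<^esub> unit ?z \<in> D ?z" using b z by (simp add: D_mult_left)
      have m: "?m \<in> carrier S" using monomial_carrier[OF z(2) bz] .
      have val: "(?m \<otimes>\<^bsub>S\<^esub> u) k = (if Tgt G k = ?z then b \<otimes>\<^bsub>A\<^esub> u k else \<zero>\<^bsub>A\<^esub>)" if k: "k \<in> Mor G" for k
      proof (cases "Tgt G k = ?z")
        case True
        have ukD: "u k \<in> D ?z" using skew_D[OF uc k] D_subset_Tgt[OF k] True by auto
        have "(?m \<otimes>\<^bsub>S\<^esub> u) k = b \<otimes>\<^bsub>A\<^esub> unit ?z \<otimes>\<^bsub>A\<^esub> (u k \<otimes>\<^bsub>A\<^esub> unit ?z)"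
          using monomial_mult[OF z(2) bz uc k] True z k uc by (simp add: act_Obj')
        also have "\<dots> = b \<otimes>\<^bsub>A\<^esub> (unit ?z \<otimes>\<^bsub>A\<^esub> u k)" using ukD z b uc by (simp add: D_unit m_assoc)
        also have "unit ?z \<otimes>\<^bsub>A\<^esub> u k = u k" using ukD z uc by (simp add: unit_central[of ?z "u k"] D_unit)
        finally show ?thesis using True by simp
      next
        case False
        then show ?thesis using monomial_mult[OF z(2) bz uc k] z by auto
      qed
      have "{h. (?m \<otimes>\<^bsub>S\<^esub> u) h \<noteq> \<zero>\<^bsub>A\<^esub>} \<subseteq> F"
      proof
        fix h assume h: "h \<in> {h. (?m \<otimes>\<^bsub>S\<^esub> u) h \<noteq> \<zero>\<^bsub>A\<^esub>}"
        then have hM: "h \<in> Mor G" using skew_mult_outside by blast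
        then have "u h \<noteq> \<zero>\<^bsub>A\<^esub>" using h val[OF hM] b by (auto simp: zero_mult split: if_splits)
        then show "h \<in> F" using u by (auto simp: supported_def)
      qed
      then have "?m \<otimes>\<^bsub>S\<^esub> u \<in> supported F (I n)" using mult[OF m uI] by (simp add: supported_def)
      moreover have "(?m \<otimes>\<^bsub>S\<^esub> u) g = b \<otimes>\<^bsub>A\<^esub> c" using val[OF g] u by simp
      ultimately show "b \<otimes>\<^bsub>A\<^esub> c \<in> ?J n" by (intro image_eqI[of _ _ "?m \<otimes>\<^bsub>S\<^esub> u"]) simp_all
    qed
    moreover have "?J (Suc n) \<subseteq> ?J n" for n using I by (auto simp: supported_def)
    ultimately show "\<exists>N. \<forall>n\<ge>N. ?J n = ?J N"
      using art[unfolded left_artinian_def, rule_format, of ?J] by blast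
  qed
qed

text \<open>Right multiplication by a monomial at the object \<open>Src G g\<close> multiplies the
  coefficient at \<open>g\<close> by \<open>act g b\<close> instead of \<open>b\<close>. The
  coefficients therefore form a right ideal of A only after applying \<open>act (ginv G g)\<close>,
  which undoes the twist and is injective on \<open>D g\<close>.\<close>

lemma right_artinian_skew:
  assumes T: "finite {g \<in> Mor G. D g \<noteq> {\<zero>\<^bsub>A\<^esub>}}" and art: "right_artinian A"
  shows "right_artinian S"
  unfolding right_artinian_def
proof (intro allI impI)
  fix I :: "nat \<Rightarrow> ('a \<Rightarrow> 'c) set"
  assume I: "(\<forall>n. right_ideal (I n) S) \<and> (\<forall>n. I (Suc n) \<subseteq> I n)"
  have add: "additive_subgroup (I n) S" and mult: "\<And>r u. \<lbrakk>r \<in> carrier S; u \<in> I n\<rbrakk> \<Longrightarrow> u \<otimes>\<^bsub>S\<^esub> r \<in> I n" for n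
    using I unfolding right_ideal_def by blast+
  interpret S: rng S by (rule skew_rng)
  have sub: "I n \<subseteq> carrier S" for n using add[of n] unfolding S.additive_subgroup_iff by blast
  show "\<exists>N. \<forall>n\<ge>N. I n = I N"
  proof (rule chain_stabilizes[OF T add])
    show "I (Suc n) \<subseteq> I n" for n using I by blast
    fix g F assume g: "g \<in> Mor G"
    let ?g = "ginv G g"
    have g': "?g \<in> Mor G" using g by simp
    let ?J = "\<lambda>n. (\<lambda>u. u g) ` supported F (I n)"
    have JA: "additive_subgroup (?J n) A" for n by (rule additive_image[OF add g])
    have JD: "a \<in> D g" if "a \<in> ?J n" for a n using that sub[of n] skew_D[OF _ g] by (auto simp: supported_def)
    have "right_ideal (act ?g ` ?J n) A" for n
      unfolding right_ideal_def additive_subgroup_iff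
    proof (intro conjI ballI)
      have J: "?J n \<subseteq> carrier A" "\<zero>\<^bsub>A\<^esub> \<in> ?J n" "\<And>a b. \<lbrakk>a \<in> ?J n; b \<in> ?J n\<rbrakk> \<Longrightarrow> a \<oplus>\<^bsub>A\<^esub> b \<in> ?J n"
        "\<And>a. a \<in> ?J n \<Longrightarrow> \<ominus>\<^bsub>A\<^esub> a \<in> ?J n"
        using JA[of n] unfolding additive_subgroup_iff by blast+
      show "act ?g ` ?J n \<subseteq> carrier A" using J(1) g' by auto
      show "\<zero>\<^bsub>A\<^esub> \<in> act ?g ` ?J n" using J(2) g' by (intro image_eqI[of _ _ "\<zero>\<^bsub>A\<^esub>"]) simp_all
      show "a \<oplus>\<^bsub>A\<^esub> b \<in> act ?g ` ?J n" if ab: "a \<in> act ?g ` ?J n" "b \<in> act ?g ` ?J n" for a b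
      proof -
        obtain c d where cd: "c \<in> ?J n" "d \<in> ?J n" "a = act ?g c" "b = act ?g d" using ab by blast
        then have "a \<oplus>\<^bsub>A\<^esub> b = act ?g (c \<oplus>\<^bsub>A\<^esub> d)" using J(1) g' by (simp add: act_add subset_iff)
        then show ?thesis using J(3)[OF cd(1,2)] by blast
      qed
      show "\<ominus>\<^bsub>A\<^esub> a \<in> act ?g ` ?J n" if a: "a \<in> act ?g ` ?J n" for a
      proof -
        obtain c where c: "c \<in> ?J n" "a = act ?g c" using a by blast
        then have cc: "c \<in> carrier A" using J(1) by blast
        have "act ?g (\<ominus>\<^bsub>A\<^esub> c) \<oplus>\<^bsub>A\<^esub> act ?g c = \<zero>\<^bsub>A\<^esub>"
          using act_add[OF g', of "\<ominus>\<^bsub>A\<^esub> c" c] cc g' by (simp add: l_neg)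
        then have "\<ominus>\<^bsub>A\<^esub> a = act ?g (\<ominus>\<^bsub>A\<^esub> c)" using c(2) cc g' by (intro minus_equality) simp_all
        then show ?thesis using J(4)[OF c(1)] by blast
      qed
      fix b a assume b: "b \<in> carrier A" and a: "a \<in> act ?g ` ?J n"
      then obtain u where u: "a = act ?g (u g)" "u \<in> supported F (I n)" by blast
      then have uI: "u \<in> I n" and uc: "u \<in> carrier S" using sub by (auto simp: supported_def)
      let ?s = "Src G g"
      have s: "?s \<in> Obj G" "?s \<in> Mor G" using g Obj_Mor by auto
      let ?m = "monomial (b \<otimes>\<^bsub>A\<^esub> unit ?s) ?s"
      have bs: "b \<otimes>\<^bsub>A\<^esub> unit ?s \<in> D ?s" using b s by (simp add: D_mult_left)
      have m: "?m \<in> carrier S" using monomial_carrier[OF s(2) bs] .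
      have val: "(u \<otimes>\<^bsub>S\<^esub> ?m) k = (if Src G k = ?s then u k \<otimes>\<^bsub>A\<^esub> act k b else \<zero>\<^bsub>A\<^esub>)" if k: "k \<in> Mor G" for k
      proof (cases "Src G k = ?s")
        case True
        have "act k (b \<otimes>\<^bsub>A\<^esub> unit ?s) = act k b \<otimes>\<^bsub>A\<^esub> (unit k \<otimes>\<^bsub>A\<^esub> unit k)"
          using act_mult[OF k b unit_closed[OF s(2)]] act_unit[OF k s(2)] True s k by simp
        also have "\<dots> = act k b" using act_D[OF k b] k by (simp add: D_unit)
        finally show ?thesis using mult_monomial[OF s(2) bs uc k] True s k by simp
      next
        case False
        then show ?thesis using mult_monomial[OF s(2) bs uc k] s by auto
      qed
      have "{h. (u \<otimes>\<^bsub>S\<^esub> ?m) h \<noteq> \<zero>\<^bsub>A\<^esub>} \<subseteq> F"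
      proof
        fix h assume h: "h \<in> {h. (u \<otimes>\<^bsub>S\<^esub> ?m) h \<noteq> \<zero>\<^bsub>A\<^esub>}"
        then have hM: "h \<in> Mor G" using skew_mult_outside by blast
        then have "u h \<noteq> \<zero>\<^bsub>A\<^esub>" using h val[OF hM] b by (auto simp: zero_mult split: if_splits)
        then show "h \<in> F" using u by (auto simp: supported_def)
      qed
      then have "u \<otimes>\<^bsub>S\<^esub> ?m \<in> supported F (I n)" using mult[OF m uI] by (simp add: supported_def)
      then have "(u \<otimes>\<^bsub>S\<^esub> ?m) g \<in> ?J n" by blast
      moreover have "act ?g ((u \<otimes>\<^bsub>S\<^esub> ?m) g) = a \<otimes>\<^bsub>A\<^esub> b"
      proof -
        have aD: "a \<in> D ?g" using act_D[OF g', of "u g"] u(1) uc by simp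
        then have aDs: "a \<in> D ?s" using D_subset_Tgt[OF g'] g by auto
        have ac: "a \<in> carrier A" using aD g' D_carrier by blast
        have "act ?g ((u \<otimes>\<^bsub>S\<^esub> ?m) g) = a \<otimes>\<^bsub>A\<^esub> act ?g (act g b)"
          using val[OF g] act_mult[OF g', of "u g" "act g b"] u(1) uc g b by simp
        also have "act ?g (act g b) = unit ?g \<otimes>\<^bsub>A\<^esub> (b \<otimes>\<^bsub>A\<^esub> unit ?s)"
          using act_act[OF g' g _ b] g s b by (simp add: act_Obj')
        also have "a \<otimes>\<^bsub>A\<^esub> \<dots> = (a \<otimes>\<^bsub>A\<^esub> unit ?g) \<otimes>\<^bsub>A\<^esub> (unit ?s \<otimes>\<^bsub>A\<^esub> b)"
          using ac b g' s unit_central[OF s(2) b] by (simp add: m_assoc m_closed)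
        also have "\<dots> = (a \<otimes>\<^bsub>A\<^esub> unit ?s) \<otimes>\<^bsub>A\<^esub> b" using aD ac b g' s by (simp add: D_unit m_assoc)
        finally show ?thesis using aDs s by (simp add: D_unit)
      qed
      ultimately show "a \<otimes>\<^bsub>A\<^esub> b \<in> act ?g ` ?J n" by (metis image_eqI)
    qed
    moreover have "act ?g ` ?J (Suc n) \<subseteq> act ?g ` ?J n" for n
    proof -
      have "supported F (I (Suc n)) \<subseteq> supported F (I n)" using I by (auto simp: supported_def)
      then show ?thesis by blast
    qed
    ultimately obtain N where N: "\<And>n. n \<ge> N \<Longrightarrow> act ?g ` ?J n = act ?g ` ?J N"
      using art[unfolded right_artinian_def, rule_format, of "\<lambda>n. act ?g ` ?J n"] by blast
    have inj: "inj_on (act ?g) (D g)"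
    proof (rule inj_on_inverseI[where g = "\<alpha> g"])
      fix a assume "a \<in> D g"
      then show "\<alpha> g (act ?g a) = a" using act_alpha[OF g', of a] alpha_ginv[OF g', of a] g by simp
    qed
    have "?J n = ?J N" if "n \<ge> N" for n
      using inj_on_image_eq_iff[OF inj, of "?J n" "?J N"] N[OF that] JD by blast
    then show "\<exists>N. \<forall>n\<ge>N. ?J n = ?J N" by blast
  qed
qed

end

theorem theorem5p11:
  fixes G :: "('g, 'm) groupoid_data_scheme"
    and A :: "('a, 'r) ring_scheme"
    and D :: "'g \<Rightarrow> 'a set"
    and \<alpha> :: "'g \<Rightarrow> 'a \<Rightarrow> 'a"
    and x :: 'g
  assumes "connected_groupoid G"
    and "finite (Obj G)"
    and "x \<in> Obj G"
    and "unital_partial_action G A D \<alpha>"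
    and "group_type G D"
    and "is_direct_sum A D (Obj G)"
  shows "artinian (skew_ring G A D \<alpha>) \<longleftrightarrow>
    artinian A \<and> finite {h \<in> isotropy G x. D h \<noteq> {\<zero>\<^bsub>A\<^esub>}}"
proof -
  interpret unital_partial_action G A D \<alpha> by fact
  show ?thesis
  proof
    assume "artinian (skew_ring G A D \<alpha>)"
    then have S: "left_artinian (skew_ring G A D \<alpha>)" "right_artinian (skew_ring G A D \<alpha>)"
      by (simp_all add: artinian_def)
    have "left_artinian A" "right_artinian A"
      using left_artinian_base[OF assms(6,2) S(1)] right_artinian_base[OF assms(6,2) S(2)] by simp_all
    then show "artinian A \<and> finite {h \<in> isotropy G x. D h \<noteq> {\<zero>\<^bsub>A\<^esub>}}"
      using finite_support_isotropy[OF S(1) _ assms(3)] by (simp add: artinian_def)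
  next
    assume A: "artinian A \<and> finite {h \<in> isotropy G x. D h \<noteq> {\<zero>\<^bsub>A\<^esub>}}"
    then have T: "finite {g \<in> Mor G. D g \<noteq> {\<zero>\<^bsub>A\<^esub>}}"
      using finite_support[OF assms(5,3,2)] by blast
    then show "artinian (skew_ring G A D \<alpha>)"
      using left_artinian_skew[OF T] right_artinian_skew[OF T] A by (simp add: artinian_def)
  qed
qed

end
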